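(* Let $1\le r<\infty$, $\ell\in\mathbb{R}$ and $v_\ell(x,\omega)=(1+x^2+\omega^2)^{\ell/2}$. The modulation space $M^r_{v_\ell}$ is invariant under the special affine Fourier transform $\mathcal{F}_A$, i.e. $f\in M^r_{v_\ell}$ implies $\mathcal{F}_Af\in M^r_{v_\ell}$.
   Context: $A=\{a,b,c,d,p,q\}$ are real parameters with $ad-bc=1$ and $b\neq0$. The special affine Fourier transform is $\mathcal{F}_Af(\omega)=\frac{1}{\sqrt{|b|}}\int_{\mathbb{R}}f(t)e^{\frac{\pi i}{b}(at^2+2pt-2\omega t+2(bq-dp)\omega+d\omega^2)}\,dt$ for $f\in L^1(\mathbb{R})$. It equals $C_{d/b}M_{(bq-dp)/b}D_b\mathcal{F}C_{a/b}M_{p/b}$, where $C_sf(t)=e^{\pi i s t^2}f(t)$, $M_sf(t)=e^{2\pi i st}f(t)$, $D_sf(t)=|s|^{-1/2}f(t/s)$ and $\mathcal{F}f(\xi)=\int_{\mathbb{R}} f(t)e^{-2\pi i\xi t}dt$; through this formula it extends to tempered distributions $S'(\mathbb{R})$. For a weight $m$ and a fixed nonzero $g\in S(\mathbb{R})$, $M^r_m$ is the space of $f\in S'(\mathbb{R})$ with $\int_{\mathbb{R}}\int_{\mathbb{R}}|V_gf(x,\omega)|^rm(x,\omega)^r\,dx\,d\omega<\infty$, where $V_gf(x,\omega)=\int_{\mathbb{R}}f(t)\overline{g(t-x)}e^{-2\pi i\omega t}\,dt$ (duality pairing for distributions); different nonzero Schwartz windows give the same space with equivalent norms. *)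

theory Defs
  imports "HOL-Analysis.Analysis" "HOL-Library.FuncSet"
begin

definition vderiv :: "(real \<Rightarrow> complex) \<Rightarrow> real \<Rightarrow> complex" where
  "vderiv f t = vector_derivative f (at t)"

definition schwartz :: "(real \<Rightarrow> complex) set" where
  "schwartz = {f. (\<forall>n t. (vderiv ^^ n) f differentiable (at t)) \<and>
                  (\<forall>k n. \<exists>B. \<forall>t. \<bar>t\<bar> ^ k * norm ((vderiv ^^ n) f t) \<le> B)}"

definition schwartz_seminorm :: "nat \<Rightarrow> nat \<Rightarrow> (real \<Rightarrow> complex) \<Rightarrow> real" where
  "schwartz_seminorm k n f = (SUP t. \<bar>t\<bar> ^ k * norm ((vderiv ^^ n) f t))"

text \<open>A tempered distribution is a complex-linear functional on the Schwartz space that is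
  continuous for the locally convex topology given by the seminorms above; continuity is the
  bound by finitely many seminorms. The functional has the value \<^term>\<open>undefined\<close> off
  the Schwartz space, so that each distribution is represented by exactly one HOL function.
  The pairing is bilinear: an ordinary function \<open>f\<close> acts as
  \<open>\<phi> \<mapsto> \<integral> f \<phi>\<close>, without conjugation.\<close>

definition tempered :: "((real \<Rightarrow> complex) \<Rightarrow> complex) set" where
  "tempered = {T. T \<in> extensional schwartz \<and>
     (\<forall>\<phi>\<in>schwartz. \<forall>\<psi>\<in>schwartz. T (\<lambda>t. \<phi> t + \<psi> t) = T \<phi> + T \<psi>) \<and>
     (\<forall>z. \<forall>\<phi>\<in>schwartz. T (\<lambda>t. z * \<phi> t) = z * T \<phi>) \<and>
     (\<exists>B N. \<forall>\<phi>\<in>schwartz. norm (T \<phi>) \<le> B * (\<Sum>k\<le>N. \<Sum>n\<le>N. schwartz_seminorm k n \<phi>))}"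


definition chirp :: "real \<Rightarrow> (real \<Rightarrow> complex) \<Rightarrow> real \<Rightarrow> complex" where
  "chirp s f t = cis (pi * s * t\<^sup>2) * f t"

definition modulation :: "real \<Rightarrow> (real \<Rightarrow> complex) \<Rightarrow> real \<Rightarrow> complex" where
  "modulation s f t = cis (2 * pi * s * t) * f t"

definition dilation :: "real \<Rightarrow> (real \<Rightarrow> complex) \<Rightarrow> real \<Rightarrow> complex" where
  "dilation s f t = complex_of_real (\<bar>s\<bar> powr (-1/2)) * f (t / s)"

definition fourier :: "(real \<Rightarrow> complex) \<Rightarrow> real \<Rightarrow> complex" where
  "fourier f \<xi> = (\<integral>t. f t * cis (- 2 * pi * \<xi> * t) \<partial>lborel)"

definition saft_fun ::
  "real \<Rightarrow> real \<Rightarrow> real \<Rightarrow> real \<Rightarrow> real \<Rightarrow> real \<Rightarrow> (real \<Rightarrow> complex) \<Rightarrow> real \<Rightarrow> complex" where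
  "saft_fun a b c d p q f \<omega> = complex_of_real (1 / sqrt \<bar>b\<bar>) *
     (\<integral>t. f t * cis (pi / b * (a * t\<^sup>2 + 2 * p * t - 2 * \<omega> * t
                + 2 * (b * q - d * p) * \<omega> + d * \<omega>\<^sup>2)) \<partial>lborel)"

lemma saft_fun_factorization:
  assumes "b \<noteq> 0"
  shows "saft_fun a b c d p q f =
    chirp (d / b) (modulation ((b * q - d * p) / b) (dilation b
      (fourier (chirp (a / b) (modulation (p / b) f)))))"
proof
  fix \<omega>
  have e: "cis (pi / b * (a * t\<^sup>2 + 2 * p * t - 2 * \<omega> * t + 2 * (b * q - d * p) * \<omega> + d * \<omega>\<^sup>2)) =
      cis (pi * (d / b) * \<omega>\<^sup>2) * cis (2 * pi * ((b * q - d * p) / b) * \<omega>) *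
      (cis (pi * (a / b) * t\<^sup>2) * cis (2 * pi * (p / b) * t) * cis (- 2 * pi * (\<omega> / b) * t))" for t
  proof -
    have "pi / b * (a * t\<^sup>2 + 2 * p * t - 2 * \<omega> * t + 2 * (b * q - d * p) * \<omega> + d * \<omega>\<^sup>2) =
        pi * (d / b) * \<omega>\<^sup>2 + 2 * pi * ((b * q - d * p) / b) * \<omega> +
        (pi * (a / b) * t\<^sup>2 + 2 * pi * (p / b) * t + (- 2 * pi * (\<omega> / b) * t))"
      using assms by (simp add: field_simps)
    then show ?thesis
      by (simp only: cis_mult)
  qed
  have "f t * cis (pi / b * (a * t\<^sup>2 + 2 * p * t - 2 * \<omega> * t + 2 * (b * q - d * p) * \<omega> + d * \<omega>\<^sup>2)) =
      (cis (pi * (d / b) * \<omega>\<^sup>2) * cis (2 * pi * ((b * q - d * p) / b) * \<omega>)) *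
      (chirp (a / b) (modulation (p / b) f) t * cis (- 2 * pi * (\<omega> / b) * t))" for t
    unfolding e chirp_def modulation_def by (simp only: mult_ac)
  moreover have "1 / sqrt \<bar>b\<bar> = \<bar>b\<bar> powr (-1/2)"
    using assms by (simp add: powr_minus powr_half_sqrt field_simps)
  ultimately show "saft_fun a b c d p q f \<omega> =
    chirp (d / b) (modulation ((b * q - d * p) / b) (dilation b
      (fourier (chirp (a / b) (modulation (p / b) f))))) \<omega>"
    unfolding saft_fun_def chirp_def [of "d / b"] modulation_def [of "(b * q - d * p) / b"]
      dilation_def fourier_def
    by (simp only: integral_mult_right_zero) (simp only: mult_ac)
qed

text \<open>Each factor is extended to distributions by transposition for the bilinear pairing.
  Chirps, modulations and the Fourier transform are their own transposes; since
  \<open>\<integral> \<bar>s\<bar> powr (-1/2) f(t/s) \<phi>(t) dt = \<integral> f(u) \<bar>s\<bar> powr (1/2) \<phi>(s u) du\<close>,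
  the transpose of the dilation by \<open>s\<close> is the dilation by \<open>1/s\<close>.\<close>

definition dist_transpose ::
  "((real \<Rightarrow> complex) \<Rightarrow> (real \<Rightarrow> complex)) \<Rightarrow> ((real \<Rightarrow> complex) \<Rightarrow> complex) \<Rightarrow> (real \<Rightarrow> complex) \<Rightarrow> complex"
  where "dist_transpose P T = (\<lambda>\<phi>\<in>schwartz. T (P \<phi>))"

definition dist_chirp :: "real \<Rightarrow> ((real \<Rightarrow> complex) \<Rightarrow> complex) \<Rightarrow> (real \<Rightarrow> complex) \<Rightarrow> complex" where
  "dist_chirp s = dist_transpose (chirp s)"

definition dist_modulation :: "real \<Rightarrow> ((real \<Rightarrow> complex) \<Rightarrow> complex) \<Rightarrow> (real \<Rightarrow> complex) \<Rightarrow> complex" where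
  "dist_modulation s = dist_transpose (modulation s)"

definition dist_dilation :: "real \<Rightarrow> ((real \<Rightarrow> complex) \<Rightarrow> complex) \<Rightarrow> (real \<Rightarrow> complex) \<Rightarrow> complex" where
  "dist_dilation s = dist_transpose (dilation (1 / s))"

definition dist_fourier :: "((real \<Rightarrow> complex) \<Rightarrow> complex) \<Rightarrow> (real \<Rightarrow> complex) \<Rightarrow> complex" where
  "dist_fourier = dist_transpose fourier"

definition saft ::
  "real \<Rightarrow> real \<Rightarrow> real \<Rightarrow> real \<Rightarrow> real \<Rightarrow> real \<Rightarrow> ((real \<Rightarrow> complex) \<Rightarrow> complex) \<Rightarrow> (real \<Rightarrow> complex) \<Rightarrow> complex"
  where
  "saft a b c d p q T =
    dist_chirp (d / b) (dist_modulation ((b * q - d * p) / b) (dist_dilation b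
      (dist_fourier (dist_chirp (a / b) (dist_modulation (p / b) T)))))"


definition stft :: "(real \<Rightarrow> complex) \<Rightarrow> ((real \<Rightarrow> complex) \<Rightarrow> complex) \<Rightarrow> real \<Rightarrow> real \<Rightarrow> complex" where
  "stft g T x \<omega> = T (\<lambda>t. cnj (g (t - x)) * cis (- 2 * pi * \<omega> * t))"

definition modulation_space ::
  "real \<Rightarrow> (real \<Rightarrow> real \<Rightarrow> real) \<Rightarrow> (real \<Rightarrow> complex) \<Rightarrow> ((real \<Rightarrow> complex) \<Rightarrow> complex) set" where
  "modulation_space r m g = {T \<in> tempered.
     (\<integral>\<^sup>+ \<omega>. (\<integral>\<^sup>+ x. ennreal (norm (stft g T x \<omega>) powr r * m x \<omega> powr r) \<partial>lborel) \<partial>lborel) < \<infinity>}"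

definition poly_weight :: "real \<Rightarrow> real \<Rightarrow> real \<Rightarrow> real" where
  "poly_weight l x \<omega> = (1 + x\<^sup>2 + \<omega>\<^sup>2) powr (l / 2)"

end

theory Submission
  imports Defs "HOL-Probability.Probability" "HOL-Real_Asymp.Real_Asymp"
begin

text \<open>The transform is a composition of chirps, modulations, a dilation and the Fourier transform.
  Each factor carries the short-time Fourier transform for a window \<open>g\<close> to that for another Schwartz
  window \<open>g'\<close>, up to a unimodular factor and an affine map of the time-frequency plane, under
  which \<open>v\<^sub>\<ell>\<close> changes by a bounded factor. It remains to see that finiteness of the norm does not
  depend on the window: expressing one window by time-frequency shifts of the other bounds the new
  short-time Fourier transform by a convolution of the old one with a rapidly decaying kernel, and
  Peetre's and Young's inequalities apply. Moving the distribution under the integral sign in this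
  expansion is done through the fundamental theorem of calculus.\<close>

section \<open>Schwartz functions and bounded families\<close>

text \<open>No topology on Schwartz space is set up. A tempered \<open>T\<close> is known only
  through linearity and a seminorm bound, so every analytic fact about it is reduced to a bound on
  test functions that is uniform in a parameter: \<open>bounded_family\<close> says that the
  seminorms of \<open>\<Phi> i\<close> are at most a constant times \<open>w N i\<close>, and then
  \<open>T (\<Phi> i)\<close> obeys a bound of the same kind. The choice of index set and weight
  turns this one notion into membership in Schwartz space, continuity of operators, decay and
  Lipschitz continuity of curves, and smallness of quadrature errors. Vector-valued integration is
  thereby avoided: only scalar functions of the parameter are differentiated. Each factor of the
  transform changes the window, so finiteness is carried along for all Schwartz windows at once and
  the change of window happens a single time. There the weight costs a factor
  \<open>2^L (1+u^2)^L (1+\<eta>^2)^L\<close>; the kernel can pay for it because its order of decay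
  is arbitrary, and one further power keeps it integrable.\<close>

lemma vderiv_eqI:
  assumes "\<And>t. (f has_vector_derivative f' t) (at t)"
  shows "vderiv f = f'"
  using assms unfolding vderiv_def by (intro ext vector_derivative_at)

lemma schwartz_vderiv:
  assumes "f \<in> schwartz"
  shows "vderiv f \<in> schwartz"
proof -
  have "(vderiv ^^ n) (vderiv f) = (vderiv ^^ Suc n) f" for n
    by (simp add: funpow_swap1)
  with assms show ?thesis unfolding schwartz_def by (auto simp del: funpow.simps)
qed

lemma schwartz_funpow_vderiv: "f \<in> schwartz \<Longrightarrow> (vderiv ^^ n) f \<in> schwartz"
  by (induction n) (auto intro: schwartz_vderiv)

lemma schwartz_has_derivative:
  assumes "f \<in> schwartz"
  shows "(f has_vector_derivative vderiv f t) (at t)"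
proof -
  have "(vderiv ^^ 0) f differentiable (at t)"
    using assms unfolding schwartz_def by blast
  then show ?thesis unfolding vderiv_def by (simp add: vector_derivative_works)
qed

lemma schwartz_continuous: "f \<in> schwartz \<Longrightarrow> continuous_on A f"
  by (meson continuous_at_imp_continuous_on has_vector_derivative_continuous schwartz_has_derivative)

lemma schwartz_measurable [measurable_dest]: "f \<in> schwartz \<Longrightarrow> f \<in> borel_measurable borel"
  by (simp add: borel_measurable_continuous_onI schwartz_continuous)

lemma schwartz_seminorm_upper:
  assumes "f \<in> schwartz"
  shows "\<bar>t\<bar> ^ k * norm ((vderiv ^^ n) f t) \<le> schwartz_seminorm k n f"
proof -
  obtain B where "\<And>t. \<bar>t\<bar> ^ k * norm ((vderiv ^^ n) f t) \<le> B"
    using assms unfolding schwartz_def by blast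
  then show ?thesis unfolding schwartz_seminorm_def
    by (intro cSUP_upper) (auto intro!: bdd_aboveI2)
qed

lemma schwartz_seminorm_upper0:
  "f \<in> schwartz \<Longrightarrow> \<bar>t\<bar> ^ k * norm (f t) \<le> schwartz_seminorm k 0 f"
  using schwartz_seminorm_upper[of f t k 0] by simp

lemma schwartz_seminorm_upper00: "f \<in> schwartz \<Longrightarrow> norm (f t) \<le> schwartz_seminorm 0 0 f"
  using schwartz_seminorm_upper[of f t 0 0] by simp

lemma schwartz_seminorm_least:
  "(\<And>t. \<bar>t\<bar> ^ k * norm ((vderiv ^^ n) f t) \<le> B) \<Longrightarrow> schwartz_seminorm k n f \<le> B"
  unfolding schwartz_seminorm_def by (intro cSUP_least) auto

lemma schwartz_seminorm_nonneg: "f \<in> schwartz \<Longrightarrow> 0 \<le> schwartz_seminorm k n f"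
  by (rule order_trans[OF _ schwartz_seminorm_upper[of f 0]]) simp_all

lemma schwartz_seminorm_vderiv: "schwartz_seminorm k n (vderiv f) = schwartz_seminorm k (Suc n) f"
  unfolding schwartz_seminorm_def by (simp add: funpow_swap1)

text \<open>Seminorm bounds are derived by coinduction: a set of families whose derivatives are
  sums of two members, and whose members decay rapidly, consists of Schwartz families. The index
  \<open>N\<close> of the weight makes room for bounds by a growing number of seminorms.\<close>

definition differentiates ::
  "'i set \<Rightarrow> 'j set \<Rightarrow> ('j \<Rightarrow> 'i \<Rightarrow> real \<Rightarrow> complex) \<Rightarrow> 'j \<Rightarrow> bool" where
  "differentiates I J \<Theta> j \<longleftrightarrow>
     (\<exists>k\<in>J. \<forall>i\<in>I. \<forall>t. (\<Theta> j i has_vector_derivative \<Theta> k i t) (at t)) \<or>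
     (\<exists>k\<in>J. \<exists>l\<in>J. \<forall>i\<in>I. \<forall>t. (\<Theta> j i has_vector_derivative (\<Theta> k i t + \<Theta> l i t)) (at t))"

locale weight =
  fixes I :: "'i set" and w :: "nat \<Rightarrow> 'i \<Rightarrow> real"
  assumes weight_nonneg: "i \<in> I \<Longrightarrow> 0 \<le> w N i"
    and weight_Suc: "i \<in> I \<Longrightarrow> w N i \<le> w (Suc N) i"
begin

lemma weight_mono: "i \<in> I \<Longrightarrow> M \<le> N \<Longrightarrow> w M i \<le> w N i"
  by (rule lift_Suc_mono_le[of "\<lambda>N. w N i"]) (auto intro: weight_Suc)

text \<open>\<open>C\<close> and \<open>N\<close> may depend on the seminorm but not on the index:
  boundedness in Schwartz space relative to a weight.\<close>

definition bounded_family :: "('i \<Rightarrow> real \<Rightarrow> complex) \<Rightarrow> bool" where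
  "bounded_family \<Phi> \<longleftrightarrow> (\<forall>i\<in>I. \<Phi> i \<in> schwartz) \<and>
     (\<forall>k n. \<exists>C N. \<forall>i\<in>I. schwartz_seminorm k n (\<Phi> i) \<le> C * w N i)"

text \<open>The part of \<open>bounded_family\<close> without derivatives, which is all that has to
  be estimated by hand in a coinduction.\<close>

definition decaying_family :: "('i \<Rightarrow> real \<Rightarrow> complex) \<Rightarrow> bool" where
  "decaying_family \<Phi> \<longleftrightarrow> (\<forall>k. \<exists>C N. \<forall>i\<in>I. \<forall>t. \<bar>t\<bar> ^ k * norm (\<Phi> i t) \<le> C * w N i)"

lemma sum_weight_le:
  assumes "i \<in> I" shows "C1 * w N1 i + C2 * w N2 i \<le> (\<bar>C1\<bar> + \<bar>C2\<bar>) * w (max N1 N2) i"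
proof -
  have "C1 * w N1 i \<le> \<bar>C1\<bar> * w (max N1 N2) i" "C2 * w N2 i \<le> \<bar>C2\<bar> * w (max N1 N2) i"
    using assms by (auto intro!: mult_mono weight_mono weight_nonneg)
  then show ?thesis by (simp add: distrib_right)
qed

lemma decaying_family_add:
  assumes "decaying_family \<Phi>" "decaying_family \<Psi>"
  shows "decaying_family (\<lambda>i t. \<Phi> i t + \<Psi> i t)"
  unfolding decaying_family_def
proof
  fix k
  obtain C1 N1 C2 N2 where
    1: "\<forall>i\<in>I. \<forall>t. \<bar>t\<bar> ^ k * norm (\<Phi> i t) \<le> C1 * w N1 i" and
    2: "\<forall>i\<in>I. \<forall>t. \<bar>t\<bar> ^ k * norm (\<Psi> i t) \<le> C2 * w N2 i"
    using assms unfolding decaying_family_def by meson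
  have "\<bar>t\<bar> ^ k * norm (\<Phi> i t + \<Psi> i t) \<le> (\<bar>C1\<bar> + \<bar>C2\<bar>) * w (max N1 N2) i" if "i \<in> I" for i t
  proof -
    have "\<bar>t\<bar> ^ k * norm (\<Phi> i t + \<Psi> i t) \<le> \<bar>t\<bar> ^ k * norm (\<Phi> i t) + \<bar>t\<bar> ^ k * norm (\<Psi> i t)"
      by (metis abs_ge_zero distrib_left mult_left_mono norm_triangle_ineq zero_le_power)
    also have "\<dots> \<le> C1 * w N1 i + C2 * w N2 i" using 1 2 that by (intro add_mono) auto
    also note sum_weight_le[OF that]
    finally show ?thesis .
  qed
  then show "\<exists>C N. \<forall>i\<in>I. \<forall>t. \<bar>t\<bar> ^ k * norm (\<Phi> i t + \<Psi> i t) \<le> C * w N i" by blast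
qed

text \<open>The product rule can double the number of terms at every derivative, so higher
  derivatives of a member are finite sums of members rather than members.\<close>

inductive_set add_closure :: "('i \<Rightarrow> real \<Rightarrow> complex) set \<Rightarrow> ('i \<Rightarrow> real \<Rightarrow> complex) set" for K where
  zero: "(\<lambda>i t. 0) \<in> add_closure K"
| base: "\<Phi> \<in> K \<Longrightarrow> \<Phi> \<in> add_closure K"
| add: "\<Phi> \<in> add_closure K \<Longrightarrow> \<Psi> \<in> add_closure K \<Longrightarrow> (\<lambda>i t. \<Phi> i t + \<Psi> i t) \<in> add_closure K"

text \<open>Seminorm \<open>(k, n)\<close> measures decay of order \<open>k\<close> of the
  \<open>n\<close>-th derivative. By induction on \<open>n\<close> that derivative lies in the
  additive closure of the given families, all of whose elements decay.\<close>

lemma bounded_family_coinduct: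
  fixes \<Theta> :: "'j \<Rightarrow> 'i \<Rightarrow> real \<Rightarrow> complex"
  assumes "j \<in> J"
    and decay: "\<And>j. j \<in> J \<Longrightarrow> decaying_family (\<Theta> j)"
    and deriv: "\<And>j. j \<in> J \<Longrightarrow> differentiates I J \<Theta> j"
  shows "bounded_family (\<Theta> j)"
proof -
  define K where "K = \<Theta> ` J"
  define \<Phi> where "\<Phi> = \<Theta> j"
  have dec: "decaying_family \<Psi>" if "\<Psi> \<in> add_closure K" for \<Psi>
    using that
  proof induction
    case zero
    show ?case unfolding decaying_family_def by (auto intro!: exI[of _ 0])
  qed (auto simp: K_def intro: decay decaying_family_add)
  have der: "\<exists>\<Psi>'\<in>add_closure K. \<forall>i\<in>I. \<forall>t. (\<Psi> i has_vector_derivative \<Psi>' i t) (at t)"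
    if "\<Psi> \<in> add_closure K" for \<Psi>
    using that
  proof induction
    case zero
    show ?case by (rule bexI[of _ "\<lambda>i t. 0"]) (auto intro: add_closure.zero)
  next
    case (base \<Psi>)
    then obtain j where j: "j \<in> J" "\<Psi> = \<Theta> j" unfolding K_def by blast
    have in_closure: "\<Theta> k \<in> add_closure K" if "k \<in> J" for k
      using that unfolding K_def by (intro add_closure.base imageI)
    from deriv[OF j(1)] show ?case
      unfolding differentiates_def
    proof (elim disjE bexE)
      fix k assume "k \<in> J" "\<forall>i\<in>I. \<forall>t. (\<Theta> j i has_vector_derivative \<Theta> k i t) (at t)"
      then show ?thesis using in_closure j by (intro bexI[of _ "\<Theta> k"]) auto
    next
      fix k l assume "k \<in> J" "l \<in> J"
        "\<forall>i\<in>I. \<forall>t. (\<Theta> j i has_vector_derivative (\<Theta> k i t + \<Theta> l i t)) (at t)"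
      then show ?thesis using in_closure j
        by (intro bexI[of _ "\<lambda>i t. \<Theta> k i t + \<Theta> l i t"]) (auto intro: add_closure.add)
    qed
  next
    case (add \<Phi> \<Psi>)
    then obtain \<Phi>' \<Psi>' where 1: "\<Phi>' \<in> add_closure K" "\<Psi>' \<in> add_closure K"
      "\<forall>i\<in>I. \<forall>t. (\<Phi> i has_vector_derivative \<Phi>' i t) (at t)"
      "\<forall>i\<in>I. \<forall>t. (\<Psi> i has_vector_derivative \<Psi>' i t) (at t)" by blast
    show ?case
    proof (rule bexI[of _ "\<lambda>i t. \<Phi>' i t + \<Psi>' i t"], intro ballI allI)
      show "((\<lambda>t. \<Phi> i t + \<Psi> i t) has_vector_derivative \<Phi>' i t + \<Psi>' i t) (at t)" if "i \<in> I" for i t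
        using 1 that by (intro has_vector_derivative_add) auto
      show "(\<lambda>i t. \<Phi>' i t + \<Psi>' i t) \<in> add_closure K" using 1 by (auto intro: add_closure.add)
    qed
  qed
  have pow: "\<exists>\<Psi>\<in>add_closure K. \<forall>i\<in>I. (vderiv ^^ n) (\<Phi> i) = \<Psi> i" for n
  proof (induction n)
    case 0
    show ?case using assms(1) by (auto simp: K_def \<Phi>_def intro: add_closure.base)
  next
    case (Suc n)
    then obtain \<Psi> where 1: "\<Psi> \<in> add_closure K" "\<forall>i\<in>I. (vderiv ^^ n) (\<Phi> i) = \<Psi> i" by blast
    from der[OF 1(1)] obtain \<Psi>' where 2: "\<Psi>' \<in> add_closure K"
      "\<forall>i\<in>I. \<forall>t. (\<Psi> i has_vector_derivative \<Psi>' i t) (at t)" by blast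
    have "(vderiv ^^ Suc n) (\<Phi> i) = \<Psi>' i" if "i \<in> I" for i
      using 1 2 that by (auto intro!: vderiv_eqI)
    with 2(1) show ?case by blast
  qed
  have bd: "\<exists>C N. \<forall>i\<in>I. \<forall>t. \<bar>t\<bar> ^ k * norm ((vderiv ^^ n) (\<Phi> i) t) \<le> C * w N i" for k n
  proof -
    from pow[of n] obtain \<Psi> where 1: "\<Psi> \<in> add_closure K" "\<forall>i\<in>I. (vderiv ^^ n) (\<Phi> i) = \<Psi> i" by blast
    from dec[OF 1(1)] obtain C N where "\<forall>i\<in>I. \<forall>t. \<bar>t\<bar> ^ k * norm (\<Psi> i t) \<le> C * w N i"
      unfolding decaying_family_def by blast
    with 1(2) show ?thesis by (intro exI[of _ C] exI[of _ N]) auto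
  qed
  have "\<Phi> i \<in> schwartz" if "i \<in> I" for i
    unfolding schwartz_def
  proof (clarify, intro conjI allI)
    fix n t
    from pow[of n] obtain \<Psi> where 1: "\<Psi> \<in> add_closure K" "\<forall>i\<in>I. (vderiv ^^ n) (\<Phi> i) = \<Psi> i" by blast
    from der[OF 1(1)] obtain \<Psi>' where 2: "\<forall>i\<in>I. \<forall>t. (\<Psi> i has_vector_derivative \<Psi>' i t) (at t)" by blast
    have "((vderiv ^^ n) (\<Phi> i) has_vector_derivative \<Psi>' i t) (at t)"
      using 1(2) 2 that by auto
    then show "(vderiv ^^ n) (\<Phi> i) differentiable (at t)"
      by (rule differentiableI_vector)
  next
    fix k n
    show "\<exists>B. \<forall>t. \<bar>t\<bar> ^ k * norm ((vderiv ^^ n) (\<Phi> i) t) \<le> B" using bd[of k n] that by blast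
  qed
  moreover have "\<exists>C N. \<forall>i\<in>I. schwartz_seminorm k n (\<Phi> i) \<le> C * w N i" for k n
    using bd[of k n] by (meson schwartz_seminorm_least)
  ultimately have "bounded_family \<Phi>" unfolding bounded_family_def by blast
  then show ?thesis by (simp add: \<Phi>_def)
qed

lemma bounded_family_schwartz: "bounded_family \<Phi> \<Longrightarrow> i \<in> I \<Longrightarrow> \<Phi> i \<in> schwartz"
  unfolding bounded_family_def by blast

lemma bounded_family_decay:
  assumes "bounded_family \<Phi>" shows "decaying_family \<Phi>"
  unfolding decaying_family_def
proof
  fix k
  obtain C N where "\<forall>i\<in>I. schwartz_seminorm k 0 (\<Phi> i) \<le> C * w N i"
    using assms unfolding bounded_family_def by blast
  then show "\<exists>C N. \<forall>i\<in>I. \<forall>t. \<bar>t\<bar> ^ k * norm (\<Phi> i t) \<le> C * w N i"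
    by (meson assms bounded_family_schwartz order_trans schwartz_seminorm_upper0)
qed

lemma bounded_family_vderiv:
  assumes "bounded_family \<Phi>" shows "bounded_family (\<lambda>i. vderiv (\<Phi> i))"
  using assms unfolding bounded_family_def by (auto simp: schwartz_vderiv schwartz_seminorm_vderiv)

text \<open>The coinduction is indexed by all pairs of bounded families; the derivative of the sum
  belongs to the pair of derivatives.\<close>

lemma bounded_family_add:
  assumes "bounded_family \<Phi>" "bounded_family \<Psi>"
  shows "bounded_family (\<lambda>i t. \<Phi> i t + \<Psi> i t)"
proof -
  let ?J = "Collect bounded_family \<times> Collect bounded_family"
  let ?\<Theta> = "\<lambda>(\<Phi>, \<Psi>) i t. \<Phi> i t + \<Psi> i t"
  have "bounded_family (?\<Theta> (\<Phi>, \<Psi>))"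
  proof (rule bounded_family_coinduct[where J = ?J and \<Theta> = ?\<Theta>])
    show "(\<Phi>, \<Psi>) \<in> ?J" using assms by simp
    fix j assume "j \<in> ?J"
    then obtain \<Phi> \<Psi> where j: "j = (\<Phi>, \<Psi>)" and *: "bounded_family \<Phi>" "bounded_family \<Psi>" by auto
    show "decaying_family (?\<Theta> j)"
      using * unfolding j by (simp add: decaying_family_add bounded_family_decay)
    have "(?\<Theta> j i has_vector_derivative ?\<Theta> (\<lambda>i. vderiv (\<Phi> i), \<lambda>i. vderiv (\<Psi> i)) i t) (at t)" if "i \<in> I" for i t
      unfolding j using * that
      by (auto intro!: has_vector_derivative_add schwartz_has_derivative intro: bounded_family_schwartz)
    moreover have "(\<lambda>i. vderiv (\<Phi> i), \<lambda>i. vderiv (\<Psi> i)) \<in> ?J" using * by (simp add: bounded_family_vderiv)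
    ultimately show "differentiates I ?J ?\<Theta> j"
      unfolding differentiates_def
      by blast
  qed
  then show ?thesis by simp
qed

lemma decaying_family_scale:
  assumes "decaying_family \<Phi>" and "\<And>i t. i \<in> I \<Longrightarrow> norm (\<Psi> i t) \<le> B * norm (\<Phi> i t)" "0 \<le> B"
  shows "decaying_family \<Psi>"
  unfolding decaying_family_def
proof
  fix k
  obtain C N where 1: "\<forall>i\<in>I. \<forall>t. \<bar>t\<bar> ^ k * norm (\<Phi> i t) \<le> C * w N i"
    using assms unfolding decaying_family_def by meson
  have "\<bar>t\<bar> ^ k * norm (\<Psi> i t) \<le> (B * C) * w N i" if "i \<in> I" for i t
  proof -
    have "\<bar>t\<bar> ^ k * norm (\<Psi> i t) \<le> \<bar>t\<bar> ^ k * (B * norm (\<Phi> i t))"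
      using assms(2)[OF that] by (intro mult_left_mono) auto
    also have "\<dots> = B * (\<bar>t\<bar> ^ k * norm (\<Phi> i t))" by simp
    also have "\<dots> \<le> B * (C * w N i)" using 1 that assms(3) by (intro mult_left_mono) auto
    finally show ?thesis by simp
  qed
  then show "\<exists>C N. \<forall>i\<in>I. \<forall>t. \<bar>t\<bar> ^ k * norm (\<Psi> i t) \<le> C * w N i" by blast
qed

lemma bounded_family_scale:
  assumes "bounded_family \<Phi>"
  shows "bounded_family (\<lambda>i t. z * \<Phi> i t)"
proof (rule bounded_family_coinduct[where J = "Collect bounded_family" and \<Theta> = "\<lambda>\<Phi> i t. z * \<Phi> i t"])
  show "\<Phi> \<in> Collect bounded_family" using assms by simp
  fix \<Phi> assume "\<Phi> \<in> Collect bounded_family"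
  then have *: "bounded_family \<Phi>" by simp
  show "decaying_family (\<lambda>i t. z * \<Phi> i t)"
    by (rule decaying_family_scale[OF bounded_family_decay[OF *], of _ "norm z"]) (auto simp: norm_mult)
  have "((\<lambda>t. z * \<Phi> i t) has_vector_derivative z * vderiv (\<Phi> i) t) (at t)" if "i \<in> I" for i t
    using * that
    by (auto intro!: has_vector_derivative_mult_right schwartz_has_derivative intro: bounded_family_schwartz)
  then show "differentiates I (Collect bounded_family) (\<lambda>\<Phi> i t. z * \<Phi> i t) \<Phi>"
      unfolding differentiates_def
    using bounded_family_vderiv[OF *] by (intro disjI1 bexI[of _ "\<lambda>i. vderiv (\<Phi> i)"]) auto
qed

lemma decaying_family_mult_id:
  assumes "decaying_family \<Phi>" shows "decaying_family (\<lambda>i t. of_real t * \<Phi> i t)"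
  unfolding decaying_family_def
proof
  fix k
  obtain C N where 1: "\<forall>i\<in>I. \<forall>t. \<bar>t\<bar> ^ Suc k * norm (\<Phi> i t) \<le> C * w N i"
    using assms unfolding decaying_family_def by meson
  then show "\<exists>C N. \<forall>i\<in>I. \<forall>t. \<bar>t\<bar> ^ k * norm (of_real t * \<Phi> i t) \<le> C * w N i"
    by (auto simp: norm_mult mult_ac)
qed

text \<open>Differentiating \<open>t * \<Phi> i t\<close> produces a term with the factor
  \<open>t\<close> and one without; the flag keeps both kinds in one coinduction set.\<close>

lemma bounded_family_mult_id:
  assumes "bounded_family \<Phi>"
  shows "bounded_family (\<lambda>i t. of_real t * \<Phi> i t)"
proof -
  let ?J = "(UNIV :: bool set) \<times> Collect bounded_family"
  let ?\<Theta> = "\<lambda>(b, \<Phi>) i t. if b then of_real t * \<Phi> i t else \<Phi> i t"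
  have "bounded_family (?\<Theta> (True, \<Phi>))"
  proof (rule bounded_family_coinduct[where J = ?J and \<Theta> = ?\<Theta>])
    show "(True, \<Phi>) \<in> ?J" using assms by simp
    fix j assume "j \<in> ?J"
    then obtain b \<Phi> where j: "j = (b, \<Phi>)" and *: "bounded_family \<Phi>" by auto
    have **: "bounded_family (\<lambda>i. vderiv (\<Phi> i))" using * by (rule bounded_family_vderiv)
    show "decaying_family (?\<Theta> j)"
      using * unfolding j by (cases b) (auto intro: decaying_family_mult_id bounded_family_decay)
    have d: "(\<Phi> i has_vector_derivative vderiv (\<Phi> i) t) (at t)" if "i \<in> I" for i t
      using * that by (intro schwartz_has_derivative bounded_family_schwartz)
    show "differentiates I ?J ?\<Theta> j"
    proof (cases b)
      case True
      then show ?thesis unfolding j differentiates_def using * ** d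
        by (intro disjI2 bexI[of _ "(True, \<lambda>i. vderiv (\<Phi> i))"] bexI[of _ "(False, \<Phi>)"])
           (auto intro!: derivative_eq_intros d)
    next
      case False
      then show ?thesis unfolding j differentiates_def using ** d
        by (intro disjI1 bexI[of _ "(False, \<lambda>i. vderiv (\<Phi> i))"]) auto
    qed
  qed
  then show ?thesis by simp
qed

end

section \<open>Operators on Schwartz space and tempered distributions\<close>

context weight
begin

text \<open>Powers of \<open>1 + |t|\<close> behave well under translations. The factor
  \<open>2 ^ k\<close> comes from \<open>1 + |t| \<le> 2 * max 1 |t|\<close>.\<close>

lemma decaying_family_shift:
  assumes "decaying_family \<Phi>"
  shows "\<exists>C N. 0 \<le> C \<and> (\<forall>i\<in>I. \<forall>t. (1 + \<bar>t\<bar>) ^ k * norm (\<Phi> i t) \<le> C * w N i)"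
proof -
  obtain C1 N1 C2 N2 where
    1: "\<forall>i\<in>I. \<forall>t. \<bar>t\<bar> ^ 0 * norm (\<Phi> i t) \<le> C1 * w N1 i" and
    2: "\<forall>i\<in>I. \<forall>t. \<bar>t\<bar> ^ k * norm (\<Phi> i t) \<le> C2 * w N2 i"
    using assms unfolding decaying_family_def by meson
  have "(1 + \<bar>t\<bar>) ^ k * norm (\<Phi> i t) \<le> (2 ^ k * (\<bar>C1\<bar> + \<bar>C2\<bar>)) * w (max N1 N2) i" if "i \<in> I" for i t
  proof -
    have "(1 + \<bar>t\<bar>) ^ k \<le> (2 * max 1 \<bar>t\<bar>) ^ k" by (intro power_mono) auto
    also have "\<dots> \<le> 2 ^ k * (1 + \<bar>t\<bar> ^ k)"
      by (auto simp: power_mult_distrib max_def)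
    finally have "(1 + \<bar>t\<bar>) ^ k * norm (\<Phi> i t) \<le> 2 ^ k * (1 + \<bar>t\<bar> ^ k) * norm (\<Phi> i t)"
      by (rule mult_right_mono) simp
    also have "\<dots> = 2 ^ k * (\<bar>t\<bar> ^ 0 * norm (\<Phi> i t) + \<bar>t\<bar> ^ k * norm (\<Phi> i t))"
      by (simp add: algebra_simps)
    also have "\<dots> \<le> 2 ^ k * (C1 * w N1 i + C2 * w N2 i)"
      using 1 2 that by (intro mult_left_mono add_mono) auto
    also have "\<dots> \<le> 2 ^ k * ((\<bar>C1\<bar> + \<bar>C2\<bar>) * w (max N1 N2) i)"
      by (intro mult_left_mono sum_weight_le that) auto
    finally show ?thesis by (simp add: mult_ac)
  qed
  then show ?thesis
    by (intro exI[of _ "2 ^ k * (\<bar>C1\<bar> + \<bar>C2\<bar>)"] exI[of _ "max N1 N2"]) auto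
qed

text \<open>Decay transfers because \<open>|t|\<close> is at most \<open>(1 + |c|) / |s|\<close>
  times \<open>1 + |s * t + c|\<close>. The factor \<open>s\<close> of the derivative is put into
  the family, so that all bounded families form the coinduction set.\<close>

lemma bounded_family_affine:
  assumes "bounded_family \<Phi>" and "s \<noteq> 0"
  shows "bounded_family (\<lambda>i t. \<Phi> i (s * t + c))"
proof (rule bounded_family_coinduct[where J = "Collect bounded_family" and \<Theta> = "\<lambda>\<Phi> i t. \<Phi> i (s * t + c)"])
  show "\<Phi> \<in> Collect bounded_family" using assms by simp
  fix \<Phi> assume "\<Phi> \<in> Collect bounded_family"
  then have *: "bounded_family \<Phi>" by simp
  show "decaying_family (\<lambda>i t. \<Phi> i (s * t + c))"
    unfolding decaying_family_def
  proof
    fix k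
    obtain C N where 1: "0 \<le> C" "\<forall>i\<in>I. \<forall>t. (1 + \<bar>t\<bar>) ^ k * norm (\<Phi> i t) \<le> C * w N i"
      using decaying_family_shift[OF bounded_family_decay[OF *]] by blast
    have "\<bar>t\<bar> ^ k * norm (\<Phi> i (s * t + c)) \<le> (((1 + \<bar>c\<bar>) / \<bar>s\<bar>) ^ k * C) * w N i" if "i \<in> I" for i t
    proof -
      have "\<bar>s * t\<bar> \<le> \<bar>s * t + c\<bar> + \<bar>c\<bar>" by linarith
      also have "\<dots> \<le> (1 + \<bar>c\<bar>) * (1 + \<bar>s * t + c\<bar>)" by (simp add: algebra_simps)
      finally have "\<bar>t\<bar> \<le> (1 + \<bar>c\<bar>) / \<bar>s\<bar> * (1 + \<bar>s * t + c\<bar>)"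
        using assms(2) by (simp add: abs_mult field_simps)
      then have "\<bar>t\<bar> ^ k \<le> ((1 + \<bar>c\<bar>) / \<bar>s\<bar> * (1 + \<bar>s * t + c\<bar>)) ^ k" by (intro power_mono) auto
      then have "\<bar>t\<bar> ^ k * norm (\<Phi> i (s * t + c)) \<le>
          ((1 + \<bar>c\<bar>) / \<bar>s\<bar>) ^ k * ((1 + \<bar>s * t + c\<bar>) ^ k * norm (\<Phi> i (s * t + c)))"
        by (subst mult.assoc[symmetric], subst power_mult_distrib[symmetric]) (rule mult_right_mono, simp_all)
      also have "\<dots> \<le> ((1 + \<bar>c\<bar>) / \<bar>s\<bar>) ^ k * (C * w N i)"
        using 1 that by (intro mult_left_mono) auto
      finally show ?thesis by (simp add: mult_ac)
    qed
    then show "\<exists>C N. \<forall>i\<in>I. \<forall>t. \<bar>t\<bar> ^ k * norm (\<Phi> i (s * t + c)) \<le> C * w N i" by blast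
  qed
  have "((\<lambda>t. \<Phi> i (s * t + c)) has_vector_derivative s * vderiv (\<Phi> i) (s * t + c)) (at t)" if "i \<in> I" for i t
  proof -
    have "((\<lambda>t. s * t + c) has_vector_derivative s) (at t)"
      by (auto intro!: derivative_eq_intros simp: has_real_derivative_iff_has_vector_derivative[symmetric])
    from vector_diff_chain_at[OF this schwartz_has_derivative[OF bounded_family_schwartz[OF * that]]]
    show ?thesis by (simp add: o_def scaleR_conv_of_real)
  qed
  then show "differentiates I (Collect bounded_family) (\<lambda>\<Phi> i t. \<Phi> i (s * t + c)) \<Phi>"
      unfolding differentiates_def
    using bounded_family_scale[OF bounded_family_vderiv[OF *], of s]
    by (intro disjI1 bexI[of _ "\<lambda>i t. of_real s * vderiv (\<Phi> i) t"]) auto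
qed

lemma bounded_family_cnj:
  assumes "bounded_family \<Phi>"
  shows "bounded_family (\<lambda>i t. cnj (\<Phi> i t))"
proof (rule bounded_family_coinduct[where J = "Collect bounded_family" and \<Theta> = "\<lambda>\<Phi> i t. cnj (\<Phi> i t)"])
  show "\<Phi> \<in> Collect bounded_family" using assms by simp
  fix \<Phi> assume "\<Phi> \<in> Collect bounded_family"
  then have *: "bounded_family \<Phi>" by simp
  show "decaying_family (\<lambda>i t. cnj (\<Phi> i t))"
    by (rule decaying_family_scale[OF bounded_family_decay[OF *], of _ 1]) auto
  have "((\<lambda>t. cnj (\<Phi> i t)) has_vector_derivative cnj (vderiv (\<Phi> i) t)) (at t)" if "i \<in> I" for i t
    using * that
    by (intro has_vector_derivative_cnj schwartz_has_derivative bounded_family_schwartz)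
  then show "differentiates I (Collect bounded_family) (\<lambda>\<Phi> i t. cnj (\<Phi> i t)) \<Phi>"
      unfolding differentiates_def
    using bounded_family_vderiv[OF *] by (intro disjI1 bexI[of _ "\<lambda>i. vderiv (\<Phi> i)"]) auto
qed

text \<open>The logarithmic derivative of a chirp or a modulation is a polynomial of degree at most
  one, so the derivative of \<open>u t * \<Phi> i t\<close> is again \<open>u t\<close> times a
  bounded family.\<close>

lemma bounded_family_mult_unimodular:
  fixes u :: "real \<Rightarrow> complex" and \<alpha> \<beta> :: complex
  assumes "bounded_family \<Phi>" and u: "\<And>t. norm (u t) = 1"
    and du: "\<And>t. (u has_vector_derivative (\<alpha> + \<beta> * t) * u t) (at t)"
  shows "bounded_family (\<lambda>i t. u t * \<Phi> i t)"
proof (rule bounded_family_coinduct[where J = "Collect bounded_family" and \<Theta> = "\<lambda>\<Phi> i t. u t * \<Phi> i t"])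
  show "\<Phi> \<in> Collect bounded_family" using assms by simp
  fix \<Phi> assume "\<Phi> \<in> Collect bounded_family"
  then have *: "bounded_family \<Phi>" by simp
  show "decaying_family (\<lambda>i t. u t * \<Phi> i t)"
    by (rule decaying_family_scale[OF bounded_family_decay[OF *], of _ 1]) (auto simp: norm_mult u)
  let ?\<Psi> = "\<lambda>i t. vderiv (\<Phi> i) t + (\<alpha> * \<Phi> i t + \<beta> * (of_real t * \<Phi> i t))"
  have "bounded_family ?\<Psi>"
    by (intro bounded_family_add bounded_family_scale bounded_family_mult_id bounded_family_vderiv *)
  moreover have "((\<lambda>t. u t * \<Phi> i t) has_vector_derivative u t * ?\<Psi> i t) (at t)" if "i \<in> I" for i t
    using has_vector_derivative_mult[OF du schwartz_has_derivative[OF bounded_family_schwartz[OF * that]]]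
    by (rule has_vector_derivative_eq_rhs) (simp add: algebra_simps)
  ultimately show "differentiates I (Collect bounded_family) (\<lambda>\<Phi> i t. u t * \<Phi> i t) \<Phi>"
      unfolding differentiates_def
    by (intro disjI1 bexI[of _ ?\<Psi>]) auto
qed

end

lemma has_vector_derivative_cis:
  assumes "(p has_real_derivative p') (at t)"
  shows "((\<lambda>t. cis (p t)) has_vector_derivative \<i> * p' * cis (p t)) (at t)"
proof -
  have p: "((\<lambda>t. complex_of_real (p t)) has_vector_derivative of_real p') (at t)"
    using assms by (intro has_vector_derivative_of_real) (simp add: has_real_derivative_iff_has_vector_derivative)
  have "((\<lambda>z. exp (\<i> * z)) has_field_derivative \<i> * exp (\<i> * of_real (p t))) (at (of_real (p t)))"
    by (auto intro!: derivative_eq_intros)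
  from field_vector_diff_chain_at[OF p this] show ?thesis
    by (simp add: cis_conv_exp o_def mult_ac)
qed

context weight
begin

lemma bounded_family_chirp:
  assumes "bounded_family \<Phi>" shows "bounded_family (\<lambda>i. chirp s (\<Phi> i))"
  unfolding chirp_def
proof (rule bounded_family_mult_unimodular[OF assms, where \<alpha> = 0 and \<beta> = "\<i> * of_real (2 * pi * s)"])
  show "((\<lambda>t. cis (pi * s * t\<^sup>2)) has_vector_derivative
     (0 + \<i> * of_real (2 * pi * s) * of_real t) * cis (pi * s * t\<^sup>2)) (at t)" for t
    by (rule has_vector_derivative_eq_rhs[OF has_vector_derivative_cis])
       (auto intro!: derivative_eq_intros simp: algebra_simps)
qed simp

lemma bounded_family_modulation:
  assumes "bounded_family \<Phi>" shows "bounded_family (\<lambda>i. modulation s (\<Phi> i))"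
  unfolding modulation_def
proof (rule bounded_family_mult_unimodular[OF assms, where \<alpha> = "\<i> * of_real (2 * pi * s)" and \<beta> = 0])
  show "((\<lambda>t. cis (2 * pi * s * t)) has_vector_derivative
     (\<i> * of_real (2 * pi * s) + 0 * of_real t) * cis (2 * pi * s * t)) (at t)" for t
    by (rule has_vector_derivative_eq_rhs[OF has_vector_derivative_cis])
       (auto intro!: derivative_eq_intros simp: algebra_simps)
qed simp

lemma bounded_family_dilation:
  assumes "bounded_family \<Phi>" "s \<noteq> 0" shows "bounded_family (\<lambda>i. dilation s (\<Phi> i))"
  using bounded_family_scale[OF bounded_family_affine[OF assms(1), of "1 / s" 0], of "complex_of_real (\<bar>s\<bar> powr (-1/2))"]
    assms(2)
  unfolding dilation_def by simp

end

section \<open>Operators and single functions as bounded families\<close>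

definition seminorm_sum :: "nat \<Rightarrow> (real \<Rightarrow> complex) \<Rightarrow> real" where
  "seminorm_sum N \<phi> = (\<Sum>k\<le>N. \<Sum>n\<le>N. schwartz_seminorm k n \<phi>)"

text \<open>Indexed by Schwartz space itself, with the sums from the definition of
  \<open>tempered\<close> as weights, a bounded family is a map into Schwartz space satisfying the
  continuity estimate of an operator.\<close>

interpretation op: weight schwartz seminorm_sum
proof
  fix N \<phi> assume *: "\<phi> \<in> schwartz"
  show "0 \<le> seminorm_sum N \<phi>"
    unfolding seminorm_sum_def using * by (intro sum_nonneg schwartz_seminorm_nonneg)
  have "seminorm_sum N \<phi> \<le> (\<Sum>k\<le>N. \<Sum>n\<le>Suc N. schwartz_seminorm k n \<phi>)"
    unfolding seminorm_sum_def using * by (intro sum_mono) (simp add: schwartz_seminorm_nonneg)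
  also have "\<dots> \<le> seminorm_sum (Suc N) \<phi>"
    unfolding seminorm_sum_def using * by (simp add: schwartz_seminorm_nonneg sum_nonneg del: sum.cl_ivl_Suc)
  finally show "seminorm_sum N \<phi> \<le> seminorm_sum (Suc N) \<phi>" .
qed

text \<open>Starting point for operators: the closure rules applied to the identity family give
  continuity of chirp, modulation, dilation and Fourier transform.\<close>

lemma bounded_operator_id: "op.bounded_family (\<lambda>\<phi>. \<phi>)"
  unfolding op.bounded_family_def
proof (intro conjI allI)
  fix k n
  have "schwartz_seminorm k n \<phi> \<le> 1 * seminorm_sum (max k n) \<phi>" if "\<phi> \<in> schwartz" for \<phi>
  proof -
    have "schwartz_seminorm k n \<phi> \<le> (\<Sum>n\<le>max k n. schwartz_seminorm k n \<phi>)"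
      using that by (intro member_le_sum) (auto intro: schwartz_seminorm_nonneg)
    also have "\<dots> \<le> seminorm_sum (max k n) \<phi>"
      unfolding seminorm_sum_def using that
      by (intro member_le_sum[where f = "\<lambda>k. \<Sum>n\<le>max _ n. schwartz_seminorm k n \<phi>"])
         (auto intro!: sum_nonneg schwartz_seminorm_nonneg)
    finally show ?thesis by simp
  qed
  then show "\<exists>C N. \<forall>\<phi>\<in>schwartz. schwartz_seminorm k n \<phi> \<le> C * seminorm_sum N \<phi>" by blast
qed blast

text \<open>A one-point index set with weight 1 recovers membership in Schwartz space, so every
  closure rule for families is also one for single functions.\<close>

interpretation const: weight "UNIV :: unit set" "\<lambda>_ _. 1"
  by standard auto

lemma schwartz_iff_bounded_family: "f \<in> schwartz \<longleftrightarrow> const.bounded_family (\<lambda>_. f)"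
  unfolding const.bounded_family_def by auto

lemma schwartz_add: "f \<in> schwartz \<Longrightarrow> g \<in> schwartz \<Longrightarrow> (\<lambda>t. f t + g t) \<in> schwartz"
  unfolding schwartz_iff_bounded_family by (rule const.bounded_family_add)

lemma schwartz_scale: "f \<in> schwartz \<Longrightarrow> (\<lambda>t. z * f t) \<in> schwartz"
  unfolding schwartz_iff_bounded_family by (rule const.bounded_family_scale)

lemma schwartz_affine: "f \<in> schwartz \<Longrightarrow> s \<noteq> 0 \<Longrightarrow> (\<lambda>t. f (s * t + c)) \<in> schwartz"
  unfolding schwartz_iff_bounded_family by (rule const.bounded_family_affine)

lemma schwartz_translate: "f \<in> schwartz \<Longrightarrow> (\<lambda>t. f (t - x)) \<in> schwartz"
  using schwartz_affine[of f 1 "- x"] by simp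

lemma schwartz_cnj: "f \<in> schwartz \<Longrightarrow> (\<lambda>t. cnj (f t)) \<in> schwartz"
  unfolding schwartz_iff_bounded_family by (rule const.bounded_family_cnj)

lemma schwartz_chirp: "f \<in> schwartz \<Longrightarrow> chirp s f \<in> schwartz"
  unfolding schwartz_iff_bounded_family by (rule const.bounded_family_chirp)

lemma schwartz_modulation: "f \<in> schwartz \<Longrightarrow> modulation s f \<in> schwartz"
  unfolding schwartz_iff_bounded_family by (rule const.bounded_family_modulation)

lemma schwartz_dilation: "f \<in> schwartz \<Longrightarrow> s \<noteq> 0 \<Longrightarrow> dilation s f \<in> schwartz"
  unfolding schwartz_iff_bounded_family by (rule const.bounded_family_dilation)

lemma schwartz_mult_id: "f \<in> schwartz \<Longrightarrow> (\<lambda>t. of_real t * f t) \<in> schwartz"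
  unfolding schwartz_iff_bounded_family by (rule const.bounded_family_mult_id)

lemma schwartz_decay:
  assumes "f \<in> schwartz"
  obtains C where "0 \<le> C" "\<And>t. (1 + \<bar>t\<bar>) ^ k * norm (f t) \<le> C"
proof -
  have "const.decaying_family (\<lambda>_. f)"
    using assms unfolding schwartz_iff_bounded_family by (rule const.bounded_family_decay)
  from const.decaying_family_shift[OF this, of k] that show ?thesis by auto
qed

lemma (in weight) bounded_family_seminorm_sum:
  assumes "bounded_family \<Phi>"
  shows "\<exists>C N'. \<forall>i\<in>I. seminorm_sum N (\<Phi> i) \<le> C * w N' i"
proof -
  \<comment> \<open>Applied to the outer and once more to the inner sum of
    \<open>seminorm_sum\<close>.\<close>
  have *: "\<exists>C N'. \<forall>i\<in>I. (\<Sum>a\<in>A. f a i) \<le> C * w N' i"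
    if "finite A" "\<And>a. \<exists>C N'. \<forall>i\<in>I. f a i \<le> C * w N' i" for A :: "nat set" and f :: "nat \<Rightarrow> 'i \<Rightarrow> real"
    using that
  proof induction
    case empty
    show ?case by (auto intro!: exI[of _ 0])
  next
    case (insert a A)
    obtain C1 N1 C2 N2 where 1: "\<forall>i\<in>I. (\<Sum>a\<in>A. f a i) \<le> C1 * w N1 i" "\<forall>i\<in>I. f a i \<le> C2 * w N2 i"
      using insert.IH insert.prems by meson
    have "(\<Sum>a\<in>insert a A. f a i) \<le> (\<bar>C2\<bar> + \<bar>C1\<bar>) * w (max N2 N1) i" if "i \<in> I" for i
      using insert.hyps that 1 sum_weight_le[OF that, of C2 N2 C1 N1] by fastforce
    then show ?case by blast
  qed
  show ?thesis unfolding seminorm_sum_def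
    using assms unfolding bounded_family_def by (intro * finite_atMost) blast
qed

section \<open>Estimates for tempered distributions\<close>

lemma temperedE:
  assumes "T \<in> tempered"
  obtains B N where "0 \<le> B" "\<And>\<phi>. \<phi> \<in> schwartz \<Longrightarrow> norm (T \<phi>) \<le> B * seminorm_sum N \<phi>"
proof -
  obtain B N where *: "\<forall>\<phi>\<in>schwartz. norm (T \<phi>) \<le> B * seminorm_sum N \<phi>"
    using assms unfolding tempered_def seminorm_sum_def by blast
  have "norm (T \<phi>) \<le> \<bar>B\<bar> * seminorm_sum N \<phi>" if "\<phi> \<in> schwartz" for \<phi>
    using * that op.weight_nonneg[OF that, of N]
    by (meson abs_ge_self mult_right_mono order_trans)
  then show ?thesis using that[of "\<bar>B\<bar>" N] by simp
qed

lemma tempered_add: "T \<in> tempered \<Longrightarrow> \<phi> \<in> schwartz \<Longrightarrow> \<psi> \<in> schwartz \<Longrightarrow> T (\<lambda>t. \<phi> t + \<psi> t) = T \<phi> + T \<psi>"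
  unfolding tempered_def by blast

lemma tempered_scale: "T \<in> tempered \<Longrightarrow> \<phi> \<in> schwartz \<Longrightarrow> T (\<lambda>t. z * \<phi> t) = z * T \<phi>"
  unfolding tempered_def by blast

lemma tempered_diff:
  assumes "T \<in> tempered" "\<phi> \<in> schwartz" "\<psi> \<in> schwartz"
  shows "T (\<lambda>t. \<phi> t - \<psi> t) = T \<phi> - T \<psi>"
  using tempered_add[OF assms(1,2) schwartz_scale[OF assms(3)], of "-1"] tempered_scale[OF assms(1,3), of "-1"]
  by simp

text \<open>The only form in which continuity of \<open>T\<close> is exploited: a uniform seminorm
  bound becomes a bound on numbers with the same weights.\<close>

lemma (in weight) tempered_bounded_family:
  assumes "T \<in> tempered" "bounded_family \<Phi>"
  obtains C N where "0 \<le> C" "\<And>i. i \<in> I \<Longrightarrow> norm (T (\<Phi> i)) \<le> C * w N i"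
proof -
  obtain B M where B: "0 \<le> B" "\<And>\<phi>. \<phi> \<in> schwartz \<Longrightarrow> norm (T \<phi>) \<le> B * seminorm_sum M \<phi>"
    using temperedE[OF assms(1)] by blast
  obtain C N where C: "\<forall>i\<in>I. seminorm_sum M (\<Phi> i) \<le> C * w N i"
    using bounded_family_seminorm_sum[OF assms(2)] by blast
  have "norm (T (\<Phi> i)) \<le> (B * \<bar>C\<bar>) * w N i" if "i \<in> I" for i
  proof -
    have "norm (T (\<Phi> i)) \<le> B * seminorm_sum M (\<Phi> i)"
      using B bounded_family_schwartz[OF assms(2) that] by blast
    also have "\<dots> \<le> B * (C * w N i)" using B C that by (intro mult_left_mono) auto
    also have "\<dots> \<le> B * (\<bar>C\<bar> * w N i)"
      using B that weight_nonneg[OF that] by (intro mult_left_mono mult_right_mono) auto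
    finally show ?thesis by (simp add: mult_ac)
  qed
  then show ?thesis using that[of "B * \<bar>C\<bar>" N] B(1) by simp
qed

lemma tempered_transpose:
  assumes T: "T \<in> tempered" and P: "op.bounded_family P"
    and add: "\<And>\<phi> \<psi>. \<phi> \<in> schwartz \<Longrightarrow> \<psi> \<in> schwartz \<Longrightarrow> P (\<lambda>t. \<phi> t + \<psi> t) = (\<lambda>t. P \<phi> t + P \<psi> t)"
    and scale: "\<And>z \<phi>. \<phi> \<in> schwartz \<Longrightarrow> P (\<lambda>t. z * \<phi> t) = (\<lambda>t. z * P \<phi> t)"
  shows "dist_transpose P T \<in> tempered"
proof -
  have *: "P \<phi> \<in> schwartz" if "\<phi> \<in> schwartz" for \<phi>
    using op.bounded_family_schwartz[OF P that] .
  obtain C N where "\<And>\<phi>. \<phi> \<in> schwartz \<Longrightarrow> norm (T (P \<phi>)) \<le> C * seminorm_sum N \<phi>"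
    using op.tempered_bounded_family[OF T P] by blast
  then show ?thesis
    unfolding tempered_def dist_transpose_def
    by (auto simp: schwartz_add schwartz_scale add scale tempered_add[OF T] tempered_scale[OF T] *
        seminorm_sum_def)
qed

section \<open>The Fourier transform of Schwartz functions\<close>

lemma borel_measurable_cis [measurable]: "cis \<in> borel_measurable borel"
  by (intro borel_measurable_continuous_onI continuous_intros)

lemma integral_vector_derivative_UNIV:
  fixes F f :: "real \<Rightarrow> complex"
  assumes "\<And>t. (F has_vector_derivative f t) (at t)" and "continuous_on UNIV f" and "integrable lborel f"
    and "(F \<longlongrightarrow> A) at_bot" and "(F \<longlongrightarrow> B) at_top"
  shows "(\<integral>t. f t \<partial>lborel) = B - A"
proof -
  have "(LBINT t=-\<infinity>..\<infinity>. f t) = B - A"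
    using assms
    by (intro interval_integral_FTC_integrable[where F = F])
       (auto simp: ereal_tendsto_simps set_integrable_def continuous_on_eq_continuous_at)
  then show ?thesis
    by (simp add: interval_lebesgue_integral_def set_lebesgue_integral_def)
qed

lemma
  shows integrable_inverse_one_plus_square: "integrable lborel (\<lambda>x::real. 1 / (1 + x\<^sup>2))"
    and integral_inverse_one_plus_square: "(\<integral>x. 1 / (1 + x\<^sup>2) \<partial>lborel) = pi"
  using integrable_inverse_1_plus_square LBINT_inverse_1_plus_square
  by (auto simp: set_integrable_def interval_lebesgue_integral_def set_lebesgue_integral_def divide_inverse)

lemma one_plus_square_le: "1 + x\<^sup>2 \<le> (1 + \<bar>x\<bar>)\<^sup>2" for x :: real
  by (simp add: power2_sum)

lemma one_plus_square_pos: "0 < 1 + x\<^sup>2" for x :: real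
  by (simp add: add_pos_nonneg)

lemma one_plus_square_nonneg: "0 \<le> 1 + x\<^sup>2" for x :: real
  by simp

lemma decay_imp_le:
  fixes f :: "real \<Rightarrow> complex"
  assumes "(1 + \<bar>t\<bar>) ^ 2 * norm (f t) \<le> C"
  shows "norm (f t) \<le> C * (1 / (1 + t\<^sup>2))"
proof -
  have "(1 + t\<^sup>2) * norm (f t) \<le> (1 + \<bar>t\<bar>) ^ 2 * norm (f t)"
    by (intro mult_right_mono one_plus_square_le) auto
  with assms have "(1 + t\<^sup>2) * norm (f t) \<le> C" by linarith
  then show ?thesis using one_plus_square_pos[of t] by (simp add: field_simps)
qed

text \<open>Comparison with \<open>1 / (1 + t^2)\<close>, whose integral is the constant
  \<open>pi\<close>.\<close>

lemma integrable_decay: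
  fixes f :: "real \<Rightarrow> complex"
  assumes [measurable]: "f \<in> borel_measurable borel" and "\<And>t. (1 + \<bar>t\<bar>) ^ 2 * norm (f t) \<le> C"
  shows "integrable lborel f" and "norm (\<integral>t. f t \<partial>lborel) \<le> C * pi"
proof -
  have le: "norm (f t) \<le> C * (1 / (1 + t\<^sup>2))" for t
    using assms(2) by (rule decay_imp_le)
  have int: "integrable lborel (\<lambda>t::real. C * (1 / (1 + t\<^sup>2)))"
    using integrable_inverse_one_plus_square by (rule integrable_mult_right)
  show f: "integrable lborel f"
  proof (rule Bochner_Integration.integrable_bound[OF int])
    show "AE t in lborel. norm (f t) \<le> norm (C * (1 / (1 + t\<^sup>2)))"
      using le by (intro AE_I2) (metis abs_ge_self order_trans real_norm_def)
  qed simp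
  have "norm (\<integral>t. f t \<partial>lborel) \<le> (\<integral>t. C * (1 / (1 + t\<^sup>2)) \<partial>lborel)"
    using le f int by (intro Bochner_Integration.integral_norm_bound_integral)
  also have "\<dots> = C * pi"
    by (subst integral_mult_right_zero) (simp only: integral_inverse_one_plus_square)
  finally show "norm (\<integral>t. f t \<partial>lborel) \<le> C * pi" .
qed

lemma schwartz_integrable:
  assumes "f \<in> schwartz" shows "integrable lborel f"
proof -
  obtain C where "\<And>t. (1 + \<bar>t\<bar>) ^ 2 * norm (f t) \<le> C" using schwartz_decay[OF assms] by blast
  then show ?thesis using schwartz_measurable[OF assms] by (intro integrable_decay)
qed

text \<open>A second-order error determines the derivative. The restriction to distance 1 matters
  where quadratic bounds hold only on bounded sets.\<close>

lemma has_vector_derivative_quadratic: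
  fixes f :: "real \<Rightarrow> complex"
  assumes "\<And>s. \<bar>s - t\<bar> \<le> 1 \<Longrightarrow> norm (f s - f t - (s - t) *\<^sub>R D) \<le> C * (s - t)\<^sup>2"
  shows "(f has_vector_derivative D) (at t)"
  unfolding has_vector_derivative_def has_derivative_within
proof (intro conjI bounded_linear_scaleR_left)
  have "((\<lambda>s. \<bar>C\<bar> * \<bar>s - t\<bar>) \<longlongrightarrow> 0) (at t)"
    by (auto intro!: tendsto_eq_intros)
  moreover have "\<forall>\<^sub>F s in at t. norm ((1 / norm (s - t)) *\<^sub>R (f s - (f t + (s - t) *\<^sub>R D))) \<le> \<bar>C\<bar> * \<bar>s - t\<bar>"
    unfolding eventually_at
  proof (intro exI[of _ 1] conjI ballI impI)
    fix s assume s: "s \<noteq> t \<and> dist s t < 1"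
    then have "norm (f s - f t - (s - t) *\<^sub>R D) \<le> C * (s - t)\<^sup>2"
      by (intro assms) (simp add: dist_real_def)
    also have "\<dots> \<le> \<bar>C\<bar> * \<bar>s - t\<bar> * \<bar>s - t\<bar>"
      by (simp add: power2_eq_square mult.assoc abs_mult_self_eq mult_right_mono)
    finally show "norm ((1 / norm (s - t)) *\<^sub>R (f s - (f t + (s - t) *\<^sub>R D))) \<le> \<bar>C\<bar> * \<bar>s - t\<bar>"
      using s by (simp add: divide_le_eq diff_diff_eq)
  qed simp
  ultimately show "((\<lambda>s. (1 / norm (s - t)) *\<^sub>R (f s - (f t + (s - t) *\<^sub>R D))) \<longlongrightarrow> 0) (at t)"
    by (rule Lim_null_comparison[rotated])
qed

text \<open>Differentiation under the integral sign: with an integrable factor in front, the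
  quadratic error stays quadratic after integration, and no limit is exchanged with the
  integral.\<close>

lemma has_vector_derivative_integral_quadratic:
  fixes G :: "real \<Rightarrow> 'a::euclidean_space \<Rightarrow> complex"
  assumes G: "\<And>s. integrable M (G s)" and G': "integrable M G'" and w: "integrable M w"
    and le: "\<And>s y. y \<in> space M \<Longrightarrow> norm (G s y - G t y - (s - t) *\<^sub>R G' y) \<le> w y * (s - t)\<^sup>2"
  shows "((\<lambda>s. \<integral>y. G s y \<partial>M) has_vector_derivative (\<integral>y. G' y \<partial>M)) (at t)"
proof (rule has_vector_derivative_quadratic)
  fix s
  have "(\<integral>y. G s y \<partial>M) - (\<integral>y. G t y \<partial>M) - (s - t) *\<^sub>R (\<integral>y. G' y \<partial>M) =
      (\<integral>y. G s y - G t y - (s - t) *\<^sub>R G' y \<partial>M)"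
    using G G' by simp
  also have "norm \<dots> \<le> (\<integral>y. w y * (s - t)\<^sup>2 \<partial>M)"
    by (intro Bochner_Integration.integral_norm_bound_integral Bochner_Integration.integrable_diff
        integrable_scaleR_right integrable_mult_left G G' w le)
  also have "\<dots> = (\<integral>y. w y \<partial>M) * (s - t)\<^sup>2" by simp
  finally show "norm ((\<integral>y. G s y \<partial>M) - (\<integral>y. G t y \<partial>M) - (s - t) *\<^sub>R (\<integral>y. G' y \<partial>M)) \<le>
      (\<integral>y. w y \<partial>M) * (s - t)\<^sup>2" .
qed

lemma schwartz_lipschitz:
  assumes "f \<in> schwartz"
  shows "norm (f s - f t) \<le> schwartz_seminorm 0 1 f * \<bar>s - t\<bar>"
proof -
  have "norm (f s - f t) \<le> schwartz_seminorm 0 1 f * norm (s - t)"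
  proof (rule differentiable_bound[where S = UNIV and f' = "\<lambda>x h. h *\<^sub>R vderiv f x"])
    fix x show "(f has_derivative (\<lambda>h. h *\<^sub>R vderiv f x)) (at x within UNIV)"
      using schwartz_has_derivative[OF assms] unfolding has_vector_derivative_def by simp
    show "onorm (\<lambda>h. h *\<^sub>R vderiv f x) \<le> schwartz_seminorm 0 1 f"
      using schwartz_seminorm_upper[OF assms, of x 0 1] schwartz_seminorm_nonneg[OF assms, of 0 1]
      by (intro onorm_bound) (auto simp: mult.commute[of _ "\<bar>_\<bar>"] intro: mult_left_mono)
  qed auto
  then show ?thesis by simp
qed

text \<open>Along the segment the derivative varies by at most the second seminorm times its length,
  which bounds the deviation from the linearisation.\<close>

lemma schwartz_taylor:
  assumes "f \<in> schwartz"
  shows "norm (f s - f t - (s - t) *\<^sub>R vderiv f t) \<le> schwartz_seminorm 0 2 f * (s - t)\<^sup>2"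
proof -
  have "norm (f s - f t - (s - t) *\<^sub>R vderiv f t) \<le> norm (s - t) * (schwartz_seminorm 0 2 f * \<bar>s - t\<bar>)"
  proof (rule vector_differentiable_bound_linearization[where S = "closed_segment t s"])
    fix x assume x: "x \<in> closed_segment t s"
    show "(f has_vector_derivative vderiv f x) (at x within closed_segment t s)"
      using schwartz_has_derivative[OF assms] has_vector_derivative_at_within by blast
    have "norm (vderiv f x - vderiv f t) \<le> schwartz_seminorm 0 1 (vderiv f) * \<bar>x - t\<bar>"
      using assms by (intro schwartz_lipschitz schwartz_vderiv)
    also have "\<dots> \<le> schwartz_seminorm 0 1 (vderiv f) * \<bar>s - t\<bar>"
      using x assms by (intro mult_left_mono schwartz_seminorm_nonneg schwartz_vderiv)
        (auto simp: closed_segment_eq_real_ivl split: if_splits)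
    finally show "norm (vderiv f x - vderiv f t) \<le> schwartz_seminorm 0 2 f * \<bar>s - t\<bar>"
      by (simp add: schwartz_seminorm_vderiv numeral_2_eq_2)
  qed auto
  then show ?thesis by (simp add: power2_eq_square mult_ac abs_mult_self_eq)
qed

lemma norm_cis_diff_le: "norm (cis a - cis b) \<le> \<bar>a - b\<bar>"
proof -
  have "cis a - cis b = cis b * (iexp (a - b) - 1)"
    by (simp add: cis_conv_exp algebra_simps flip: exp_add)
  then show ?thesis using iexp_approx1[of "a - b" 0] by (simp add: norm_mult)
qed

lemma norm_cis_taylor_le: "norm (cis a - cis b - \<i> * of_real (a - b) * cis b) \<le> (a - b)\<^sup>2"
proof -
  have "cis a - cis b - \<i> * of_real (a - b) * cis b = cis b * (iexp (a - b) - (1 + \<i> * of_real (a - b)))"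
    by (simp add: cis_conv_exp algebra_simps flip: exp_add)
  then have "norm (cis a - cis b - \<i> * of_real (a - b) * cis b) \<le> \<bar>a - b\<bar>^2 / 2"
    using iexp_approx1[of "a - b" 1] by (simp add: norm_mult power2_eq_square)
  also have "\<dots> \<le> (a - b)\<^sup>2" by simp
  finally show ?thesis .
qed

lemma schwartz_mult_cis: "f \<in> schwartz \<Longrightarrow> (\<lambda>t. f t * cis (2 * pi * s * t)) \<in> schwartz"
  using schwartz_modulation[of f s] unfolding modulation_def by (simp add: mult.commute)

lemma schwartz_mult_cis_neg: "f \<in> schwartz \<Longrightarrow> (\<lambda>t. f t * cis (- 2 * pi * s * t)) \<in> schwartz"
  using schwartz_mult_cis[of f "- s"] by simp

text \<open>The second-order error of the exponential is at most
  \<open>(2 pi t)^2 (s - \<xi>)^2\<close>, and \<open>t^2 f(t)\<close> is still a Schwartz function,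
  hence integrable.\<close>

lemma fourier_has_derivative:
  assumes f: "f \<in> schwartz"
  shows "(fourier f has_vector_derivative fourier (\<lambda>t. (- 2 * pi * \<i>) * (of_real t * f t)) \<xi>) (at \<xi>)"
  unfolding fourier_def
proof (rule has_vector_derivative_integral_quadratic)
  let ?f = "\<lambda>t. (- 2 * pi * \<i>) * (of_real t * f t)"
  have f': "?f \<in> schwartz" using f by (intro schwartz_scale schwartz_mult_id)
  show "integrable lborel (\<lambda>t. f t * cis (- 2 * pi * s * t))" for s
    using f by (intro schwartz_integrable schwartz_mult_cis_neg)
  show "integrable lborel (\<lambda>t. ?f t * cis (- 2 * pi * \<xi> * t))"
    using f' by (rule schwartz_integrable[OF schwartz_mult_cis_neg])
  have "(\<lambda>t. (2 * pi)\<^sup>2 * (of_real t * (of_real t * f t))) \<in> schwartz"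
    using f by (intro schwartz_scale schwartz_mult_id)
  from schwartz_integrable[OF this]
  show "integrable lborel (\<lambda>t. norm ((2 * pi)\<^sup>2 * (of_real t * (of_real t * f t))))"
    by (rule integrable_norm)
  fix s t
  have "norm (f t * cis (- 2 * pi * s * t) - f t * cis (- 2 * pi * \<xi> * t)
        - (s - \<xi>) *\<^sub>R (?f t * cis (- 2 * pi * \<xi> * t))) =
      norm (f t) * norm (cis (- 2 * pi * s * t) - cis (- 2 * pi * \<xi> * t)
        - \<i> * of_real ((- 2 * pi * s * t) - (- 2 * pi * \<xi> * t)) * cis (- 2 * pi * \<xi> * t))"
    unfolding norm_mult[symmetric] by (rule arg_cong[of _ _ norm]) (simp add: algebra_simps scaleR_conv_of_real)
  also have "\<dots> \<le> norm (f t) * ((- 2 * pi * s * t) - (- 2 * pi * \<xi> * t))\<^sup>2"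
    by (intro mult_left_mono norm_cis_taylor_le) auto
  also have "\<dots> = (2 * pi)\<^sup>2 * (\<bar>t\<bar> * \<bar>t\<bar> * norm (f t)) * (s - \<xi>)\<^sup>2"
    by (simp add: abs_mult_self_eq power2_eq_square algebra_simps)
  also have "\<dots> = norm ((2 * pi)\<^sup>2 * (of_real t * (of_real t * f t))) * (s - \<xi>)\<^sup>2"
    by (simp add: norm_mult norm_power mult.assoc)
  finally show "norm (f t * cis (- 2 * pi * s * t) - f t * cis (- 2 * pi * \<xi> * t)
        - (s - \<xi>) *\<^sub>R (?f t * cis (- 2 * pi * \<xi> * t)))
      \<le> norm ((2 * pi)\<^sup>2 * (of_real t * (of_real t * f t))) * (s - \<xi>)\<^sup>2" .
qed

lemma schwartz_tendsto_0:
  assumes "f \<in> schwartz"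
  shows "(f \<longlongrightarrow> 0) at_top" "(f \<longlongrightarrow> 0) at_bot"
proof -
  obtain C where C: "\<And>t. (1 + \<bar>t\<bar>) ^ 2 * norm (f t) \<le> C" using schwartz_decay[OF assms] by blast
  have le: "norm (f t) \<le> C * (1 / (1 + t\<^sup>2))" for t
    using C by (rule decay_imp_le)
  have *: "((\<lambda>t::real. C * (1 / (1 + t\<^sup>2))) \<longlongrightarrow> 0) at_top" "((\<lambda>t::real. C * (1 / (1 + t\<^sup>2))) \<longlongrightarrow> 0) at_bot"
    by real_asymp+
  show "(f \<longlongrightarrow> 0) at_top" "(f \<longlongrightarrow> 0) at_bot"
    using *[THEN Lim_null_comparison[OF always_eventually[OF allI[OF le]]]] .
qed

text \<open>Integration by parts: the product of \<open>f\<close> with the exponential is Schwartz,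
  so its derivative integrates to zero.\<close>

lemma fourier_vderiv:
  assumes f: "f \<in> schwartz"
  shows "fourier (vderiv f) \<xi> = (2 * pi * \<i> * \<xi>) * fourier f \<xi>"
proof -
  let ?e = "\<lambda>t. cis (- 2 * pi * \<xi> * t)"
  let ?F = "\<lambda>t. f t * ?e t"
  have F: "?F \<in> schwartz" using f by (rule schwartz_mult_cis_neg)
  have de: "(?e has_vector_derivative (- 2 * pi * \<i> * \<xi>) * ?e t) (at t)" for t
    by (rule has_vector_derivative_eq_rhs[OF has_vector_derivative_cis])
       (auto intro!: derivative_eq_intros simp: algebra_simps)
  have dF: "(?F has_vector_derivative vderiv f t * ?e t - (2 * pi * \<i> * \<xi>) * (f t * ?e t)) (at t)" for t
    using has_vector_derivative_mult[OF schwartz_has_derivative[OF f] de]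
    by (rule has_vector_derivative_eq_rhs) (simp add: algebra_simps)
  have vF: "vderiv ?F = (\<lambda>t. vderiv f t * ?e t - (2 * pi * \<i> * \<xi>) * (f t * ?e t))"
    using dF by (rule vderiv_eqI)
  have "(\<integral>t. vderiv ?F t \<partial>lborel) = 0 - 0"
    using F by (intro integral_vector_derivative_UNIV[where F = ?F] schwartz_has_derivative schwartz_tendsto_0
        schwartz_continuous schwartz_integrable schwartz_vderiv)
  then have "(\<integral>t. vderiv f t * ?e t \<partial>lborel) - (\<integral>t. (2 * pi * \<i> * \<xi>) * (f t * ?e t) \<partial>lborel) = 0"
    unfolding vF using f schwartz_integrable[OF F] schwartz_integrable[OF schwartz_mult_cis_neg[OF schwartz_vderiv[OF f]]]
    by (subst Bochner_Integration.integral_diff[symmetric]) auto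
  then show ?thesis unfolding fourier_def by simp
qed

lemma fourier_funpow_vderiv:
  assumes "f \<in> schwartz"
  shows "fourier ((vderiv ^^ k) f) \<xi> = (2 * pi * \<i> * \<xi>) ^ k * fourier f \<xi>"
  by (induction k) (simp_all add: fourier_vderiv schwartz_funpow_vderiv assms mult.assoc)

lemma norm_fourier_le:
  assumes "f \<in> borel_measurable borel" and "\<And>t. (1 + \<bar>t\<bar>) ^ 2 * norm (f t) \<le> C"
  shows "norm (fourier f \<xi>) \<le> C * pi"
  unfolding fourier_def
proof (rule integrable_decay)
  have [measurable]: "f \<in> borel_measurable borel" by fact
  show "(\<lambda>t. f t * cis (- 2 * pi * \<xi> * t)) \<in> borel_measurable borel" by measurable
qed (use assms in \<open>simp add: norm_mult\<close>)

lemma fourier_add: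
  assumes "f \<in> schwartz" "g \<in> schwartz"
  shows "fourier (\<lambda>t. f t + g t) = (\<lambda>\<xi>. fourier f \<xi> + fourier g \<xi>)"
proof
  fix \<xi>
  show "fourier (\<lambda>t. f t + g t) \<xi> = fourier f \<xi> + fourier g \<xi>"
    unfolding fourier_def distrib_right using assms
    by (intro Bochner_Integration.integral_add schwartz_integrable schwartz_mult_cis_neg)
qed

lemma fourier_scale: "fourier (\<lambda>t. z * f t) = (\<lambda>\<xi>. z * fourier f \<xi>)"
  unfolding fourier_def mult.assoc by simp

context weight
begin

text \<open>Multiplication of the transform by \<open>\<xi> ^ k\<close> corresponds to the
  \<open>k\<close>-th derivative up to a factor of modulus \<open>(2 pi)^k\<close>, which is at
  least 1; a derivative of the transform corresponds to multiplication by \<open>t\<close>. Both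
  operations keep families bounded.\<close>

lemma bounded_family_fourier:
  assumes "bounded_family \<Phi>"
  shows "bounded_family (\<lambda>i. fourier (\<Phi> i))"
proof (rule bounded_family_coinduct[where J = "Collect bounded_family" and \<Theta> = "\<lambda>\<Phi> i. fourier (\<Phi> i)"])
  show "\<Phi> \<in> Collect bounded_family" using assms by simp
  fix \<Phi> assume "\<Phi> \<in> Collect bounded_family"
  then have *: "bounded_family \<Phi>" by simp
  show "decaying_family (\<lambda>i. fourier (\<Phi> i))"
    unfolding decaying_family_def
  proof
    fix k
    have k: "bounded_family (\<lambda>i. (vderiv ^^ k) (\<Phi> i))"
      using * by (induction k) (auto intro: bounded_family_vderiv)
    obtain C N where 1: "0 \<le> C" "\<forall>i\<in>I. \<forall>t. (1 + \<bar>t\<bar>) ^ 2 * norm ((vderiv ^^ k) (\<Phi> i) t) \<le> C * w N i"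
      using decaying_family_shift[OF bounded_family_decay[OF k]] by blast
    have "\<bar>\<xi>\<bar> ^ k * norm (fourier (\<Phi> i) \<xi>) \<le> (C * pi) * w N i" if i: "i \<in> I" for i \<xi>
    proof -
      have m: "(vderiv ^^ k) (\<Phi> i) \<in> borel_measurable borel"
        using bounded_family_schwartz[OF k i] by (rule schwartz_measurable)
      have "norm (fourier ((vderiv ^^ k) (\<Phi> i)) \<xi>) \<le> (C * w N i) * pi"
        using 1 i m by (intro norm_fourier_le) auto
      then have "(2 * pi) ^ k * (\<bar>\<xi>\<bar> ^ k * norm (fourier (\<Phi> i) \<xi>)) \<le> (C * pi) * w N i"
        using fourier_funpow_vderiv[OF bounded_family_schwartz[OF * i], of k \<xi>]
        by (simp add: norm_mult norm_power power_mult_distrib mult_ac)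
      moreover have "1 * (\<bar>\<xi>\<bar> ^ k * norm (fourier (\<Phi> i) \<xi>)) \<le> (2 * pi) ^ k * (\<bar>\<xi>\<bar> ^ k * norm (fourier (\<Phi> i) \<xi>))"
        using pi_gt3 by (intro mult_right_mono one_le_power) auto
      ultimately show ?thesis by linarith
    qed
    then show "\<exists>C N. \<forall>i\<in>I. \<forall>t. \<bar>t\<bar> ^ k * norm (fourier (\<Phi> i) t) \<le> C * w N i" by blast
  qed
  have "bounded_family (\<lambda>i t. (- 2 * pi * \<i>) * (of_real t * \<Phi> i t))"
    using * by (intro bounded_family_scale bounded_family_mult_id)
  then show "differentiates I (Collect bounded_family) (\<lambda>\<Phi> i. fourier (\<Phi> i)) \<Phi>"
      unfolding differentiates_def
    using fourier_has_derivative[OF bounded_family_schwartz[OF *]]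
    by (intro disjI1 bexI[of _ "\<lambda>i t. (- 2 * pi * \<i>) * (of_real t * \<Phi> i t)"]) auto
qed

end

lemma schwartz_fourier: "f \<in> schwartz \<Longrightarrow> fourier f \<in> schwartz"
  unfolding schwartz_iff_bounded_family by (rule const.bounded_family_fourier)

lemma fourier_translate: "fourier (\<lambda>t. f (t - x)) \<xi> = cis (- 2 * pi * \<xi> * x) * fourier f \<xi>"
proof -
  have "fourier (\<lambda>t. f (t - x)) \<xi> = (\<integral>t. f t * cis (- 2 * pi * \<xi> * (x + t)) \<partial>lborel)"
    unfolding fourier_def by (subst lborel_integral_real_affine[of 1 _ x]) auto
  also have "\<dots> = (\<integral>t. cis (- 2 * pi * \<xi> * x) * (f t * cis (- 2 * pi * \<xi> * t)) \<partial>lborel)"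
    by (intro Bochner_Integration.integral_cong refl) (simp add: cis_mult algebra_simps)
  finally show ?thesis unfolding fourier_def by simp
qed

lemma fourier_mult_cis: "fourier (\<lambda>t. f t * cis (- 2 * pi * \<omega> * t)) \<xi> = fourier f (\<xi> + \<omega>)"
  unfolding fourier_def
  by (intro Bochner_Integration.integral_cong refl) (simp add: mult.assoc cis_mult algebra_simps)

section \<open>Fourier inversion\<close>

lemma integrable_pair_bound:
  fixes F :: "real \<times> real \<Rightarrow> complex"
  assumes F [measurable]: "F \<in> borel_measurable (lborel \<Otimes>\<^sub>M lborel)"
    and le: "\<And>u v. norm (F (u, v)) \<le> a u * b v"
    and a: "integrable lborel a" "\<And>u. 0 \<le> a u" and b: "integrable lborel b" "\<And>v. 0 \<le> b v"
  shows "integrable (lborel \<Otimes>\<^sub>M lborel) F"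
  unfolding integrable_iff_bounded
proof
  have [measurable]: "a \<in> borel_measurable borel" "b \<in> borel_measurable borel"
    using borel_measurable_integrable[OF a(1)] borel_measurable_integrable[OF b(1)] by simp_all
  have "(\<integral>\<^sup>+p. norm (F p) \<partial>(lborel \<Otimes>\<^sub>M lborel)) = (\<integral>\<^sup>+u. (\<integral>\<^sup>+v. norm (F (u, v)) \<partial>lborel) \<partial>lborel)"
    by (subst lborel.nn_integral_fst[symmetric]) auto
  also have "\<dots> \<le> (\<integral>\<^sup>+u. (\<integral>\<^sup>+v. ennreal (a u) * ennreal (b v) \<partial>lborel) \<partial>lborel)"
    using le a(2) b(2) by (intro nn_integral_mono) (simp add: ennreal_leI flip: ennreal_mult)
  also have "\<dots> = (\<integral>\<^sup>+u. ennreal (a u) \<partial>lborel) * (\<integral>\<^sup>+v. ennreal (b v) \<partial>lborel)"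
    by (simp add: nn_integral_cmult nn_integral_multc)
  also have "\<dots> < \<infinity>"
    using a b by (simp add: nn_integral_eq_integral ennreal_mult_less_top)
  finally show "(\<integral>\<^sup>+p. norm (F p) \<partial>(lborel \<Otimes>\<^sub>M lborel)) < \<infinity>" .
qed simp

text \<open>Gaussian summation. The factor \<open>exp (-(\<epsilon> \<xi>)^2 / 2)\<close> makes
  Fubini applicable, and its Fourier transform turns the inversion integral into an average of
  \<open>f\<close> over a normal law that concentrates at \<open>t\<close> as \<epsilon> tends to
  0.\<close>

lemma fourier_inversion:
  assumes f: "f \<in> schwartz"
  shows "(\<integral>\<xi>. fourier f \<xi> * cis (2 * pi * \<xi> * t) \<partial>lborel) = f t"
proof -
  define n where "n = std_normal_density"
  have n_meas [measurable]: "n \<in> borel_measurable borel" unfolding n_def by simp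
  have n_nonneg: "0 \<le> n x" for x unfolding n_def by (simp add: normal_density_nonneg)
  have n_int: "integrable lborel n" unfolding n_def by (rule integrable_normal_density) simp
  have n_int1: "(\<integral>x. n x \<partial>lborel) = 1" unfolding n_def by (rule integral_normal_density) simp
  have n_eq: "n x = exp (- (x\<^sup>2) / 2) / sqrt (2 * pi)" for x
    unfolding n_def std_normal_density_def by simp
  \<comment> \<open>The characteristic function of the normal law is \<open>exp (- u^2 / 2)\<close>,
    the density itself up to \<open>sqrt (2 pi)\<close>.\<close>
  have char: "(\<integral>v. n v *\<^sub>R cis (u * v) \<partial>lborel) = of_real (sqrt (2 * pi) * n u)" for u
  proof -
    have "char std_normal_distribution u = (\<integral>v. n v *\<^sub>R cis (u * v) \<partial>lborel)"
      unfolding char_def n_def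
      by (subst integral_density) (auto simp: normal_density_nonneg cis_conv_exp)
    then show ?thesis unfolding char_std_normal_distribution by (simp add: n_eq)
  qed
  have fm [measurable]: "f \<in> borel_measurable borel" using f by (rule schwartz_measurable)
  have Ff: "fourier f \<in> schwartz" using f by (rule schwartz_fourier)
  have Fm [measurable]: "fourier f \<in> borel_measurable borel" using Ff by (rule schwartz_measurable)
  \<comment> \<open>Chosen so that \<open>c * n x = exp (- x^2 / 2)\<close>, which is 1 at
    0.\<close>
  define c where "c = sqrt (2 * pi)"
  have c: "c > 0" unfolding c_def by simp
  obtain B where B: "\<And>t. norm (f t) \<le> B" using schwartz_seminorm_upper00[OF f] by blast
  have main: "(\<integral>\<xi>. (fourier f \<xi> * cis (2 * pi * \<xi> * t)) * (c * n (\<epsilon> * \<xi>)) \<partial>lborel)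
      = (\<integral>u. n u *\<^sub>R f (t - \<epsilon> / (2 * pi) * u) \<partial>lborel)" if \<epsilon>: "\<epsilon> > 0" for \<epsilon>
  proof -
    \<comment> \<open>With \<open>s = t - ?a * u\<close> the phase \<open>2 pi \<xi> (t - s)\<close>
      becomes \<open>u * (\<epsilon> * \<xi>)\<close>, which is \<open>u * v\<close> after
      substituting \<open>v = \<epsilon> * \<xi>\<close>.\<close>
    let ?a = "\<epsilon> / (2 * pi)"
    have a: "?a > 0" using \<epsilon> by simp
    let ?g = "\<lambda>u. f (t - ?a * u)"
    have g: "integrable lborel ?g"
    proof -
      have "integrable lborel (\<lambda>u. f (t + (- ?a) * u))"
        using a by (intro lborel_integrable_real_affine schwartz_integrable f) linarith
      then show ?thesis by simp
    qed
    have 1: "fourier f \<xi> * cis (2 * pi * \<xi> * t) = ?a *\<^sub>R (\<integral>u. ?g u * cis (u * (\<epsilon> * \<xi>)) \<partial>lborel)" for \<xi>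
    proof -
      have "fourier f \<xi> * cis (2 * pi * \<xi> * t) = (\<integral>s. f s * cis (2 * pi * \<xi> * (t - s)) \<partial>lborel)"
        unfolding fourier_def
        by (subst integral_mult_left_zero[symmetric], intro Bochner_Integration.integral_cong refl)
           (simp add: mult.assoc cis_mult algebra_simps)
      also have "\<dots> = ?a *\<^sub>R (\<integral>u. ?g u * cis (2 * pi * \<xi> * (?a * u)) \<partial>lborel)"
        using \<epsilon> by (subst lborel_integral_real_affine[of "- ?a" _ t]) auto
      also have "\<dots> = ?a *\<^sub>R (\<integral>u. ?g u * cis (u * (\<epsilon> * \<xi>)) \<partial>lborel)"
        by (intro arg_cong[where f = "scaleR ?a"] Bochner_Integration.integral_cong refl) (simp add: field_simps)
      finally show ?thesis .
    qed
    have prod: "integrable (lborel \<Otimes>\<^sub>M lborel) (\<lambda>(u, v). n v *\<^sub>R (?g u * cis (u * v)))"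
    proof (rule integrable_pair_bound)
      show "norm (case (u, v) of (u, v) \<Rightarrow> n v *\<^sub>R (?g u * cis (u * v))) \<le> norm (?g u) * n v" for u v
        using n_nonneg by (simp add: norm_mult mult.commute)
      show "integrable lborel (\<lambda>u. norm (?g u))" using g by (rule integrable_norm)
    qed (use n_int n_nonneg in auto)
    have "(\<integral>\<xi>. (fourier f \<xi> * cis (2 * pi * \<xi> * t)) * (c * n (\<epsilon> * \<xi>)) \<partial>lborel)
       = (\<integral>\<xi>. (c * ?a) *\<^sub>R (\<integral>u. n (\<epsilon> * \<xi>) *\<^sub>R (?g u * cis (u * (\<epsilon> * \<xi>))) \<partial>lborel) \<partial>lborel)"
      unfolding 1 by (simp add: scaleR_conv_of_real mult_ac)
    also have "\<dots> = (c * ?a) *\<^sub>R (\<integral>\<xi>. (\<integral>u. n (\<epsilon> * \<xi>) *\<^sub>R (?g u * cis (u * (\<epsilon> * \<xi>))) \<partial>lborel) \<partial>lborel)"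
      by (rule integral_scaleR_right)
    finally have 2: "(\<integral>\<xi>. (fourier f \<xi> * cis (2 * pi * \<xi> * t)) * (c * n (\<epsilon> * \<xi>)) \<partial>lborel)
       = (c * ?a) *\<^sub>R (\<integral>\<xi>. (\<integral>u. n (\<epsilon> * \<xi>) *\<^sub>R (?g u * cis (u * (\<epsilon> * \<xi>))) \<partial>lborel) \<partial>lborel)" .
    have 3: "(\<integral>\<xi>. (\<integral>u. n (\<epsilon> * \<xi>) *\<^sub>R (?g u * cis (u * (\<epsilon> * \<xi>))) \<partial>lborel) \<partial>lborel)
       = (1 / \<epsilon>) *\<^sub>R (\<integral>v. (\<integral>u. n v *\<^sub>R (?g u * cis (u * v)) \<partial>lborel) \<partial>lborel)"
      using \<epsilon> by (subst lborel_integral_real_affine[of "1 / \<epsilon>" _ 0]) auto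
    have "(\<integral>v. (\<integral>u. n v *\<^sub>R (?g u * cis (u * v)) \<partial>lborel) \<partial>lborel)
       = (\<integral>u. (\<integral>v. n v *\<^sub>R (?g u * cis (u * v)) \<partial>lborel) \<partial>lborel)"
      using prod by (rule lborel_pair.Fubini_integral)
    also have "\<dots> = (\<integral>u. c *\<^sub>R (n u *\<^sub>R ?g u) \<partial>lborel)"
    proof (intro Bochner_Integration.integral_cong refl)
      fix u
      have "(\<integral>v. n v *\<^sub>R (?g u * cis (u * v)) \<partial>lborel) = ?g u * (\<integral>v. n v *\<^sub>R cis (u * v) \<partial>lborel)"
        by (subst integral_mult_right_zero[symmetric]) (simp add: scaleR_conv_of_real mult_ac)
      then show "(\<integral>v. n v *\<^sub>R (?g u * cis (u * v)) \<partial>lborel) = c *\<^sub>R (n u *\<^sub>R ?g u)"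
        unfolding char c_def by (simp add: scaleR_conv_of_real mult_ac)
    qed
    also have "\<dots> = c *\<^sub>R (\<integral>u. n u *\<^sub>R ?g u \<partial>lborel)" by (rule integral_scaleR_right)
    finally have 4: "(\<integral>v. (\<integral>u. n v *\<^sub>R (?g u * cis (u * v)) \<partial>lborel) \<partial>lborel) =
      c *\<^sub>R (\<integral>u. n u *\<^sub>R ?g u \<partial>lborel)" .
    \<comment> \<open>The Jacobians and the two factors \<open>c\<close> cancel because
      \<open>c^2 = 2 pi\<close>.\<close>
    have "(c * ?a) *\<^sub>R (1 / \<epsilon>) *\<^sub>R c *\<^sub>R z = z" for z :: complex
      using \<epsilon> by (simp add: c_def real_sqrt_mult_self flip: real_sqrt_mult)
    then show ?thesis unfolding 2 3 4 .
  qed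
  define \<epsilon> :: "nat \<Rightarrow> real" where "\<epsilon> = (\<lambda>k. 1 / real (Suc k))"
  have \<epsilon>: "\<epsilon> k > 0" for k unfolding \<epsilon>_def by simp
  have \<epsilon>0: "\<epsilon> \<longlonglongrightarrow> 0" unfolding \<epsilon>_def by real_asymp
  have "(\<lambda>k. \<integral>\<xi>. (fourier f \<xi> * cis (2 * pi * \<xi> * t)) * (c * n (\<epsilon> k * \<xi>)) \<partial>lborel)
      \<longlonglongrightarrow> (\<integral>\<xi>. fourier f \<xi> * cis (2 * pi * \<xi> * t) \<partial>lborel)"
  proof (rule integral_dominated_convergence[where w = "\<lambda>\<xi>. norm (fourier f \<xi>)"])
    show "integrable lborel (\<lambda>\<xi>. norm (fourier f \<xi>))"
      using schwartz_integrable[OF Ff] by (rule integrable_norm)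
    have cn: "c * n x = exp (- (x\<^sup>2) / 2)" for x unfolding n_eq c_def by simp
    show "AE \<xi> in lborel. (\<lambda>k. (fourier f \<xi> * cis (2 * pi * \<xi> * t)) * (c * n (\<epsilon> k * \<xi>)))
        \<longlonglongrightarrow> fourier f \<xi> * cis (2 * pi * \<xi> * t)"
    proof (rule AE_I2)
      fix \<xi>
      have "(\<lambda>k. exp (- ((\<epsilon> k * \<xi>)\<^sup>2) / 2)) \<longlonglongrightarrow> exp (- ((0 * \<xi>)\<^sup>2) / 2)"
        by (intro tendsto_intros \<epsilon>0) simp
      then have "(\<lambda>k. complex_of_real (c * n (\<epsilon> k * \<xi>))) \<longlonglongrightarrow> of_real 1"
        unfolding cn by (intro tendsto_of_real) simp
      from tendsto_mult_left[OF this, of "fourier f \<xi> * cis (2 * pi * \<xi> * t)"]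
      show "(\<lambda>k. (fourier f \<xi> * cis (2 * pi * \<xi> * t)) * (c * n (\<epsilon> k * \<xi>)))
        \<longlonglongrightarrow> fourier f \<xi> * cis (2 * pi * \<xi> * t)" by simp
    qed
    show "AE \<xi> in lborel. norm ((fourier f \<xi> * cis (2 * pi * \<xi> * t)) * (c * n (\<epsilon> k * \<xi>)))
        \<le> norm (fourier f \<xi>)" for k
    proof (rule AE_I2)
      fix \<xi>
      have "norm (complex_of_real (c * n (\<epsilon> k * \<xi>))) \<le> 1"
        unfolding cn by simp
      then show "norm ((fourier f \<xi> * cis (2 * pi * \<xi> * t)) * (c * n (\<epsilon> k * \<xi>))) \<le> norm (fourier f \<xi>)"
        unfolding norm_mult by (simp add: mult_left_le)
    qed
  qed measurable
  moreover have "(\<lambda>k. \<integral>u. n u *\<^sub>R f (t - \<epsilon> k / (2 * pi) * u) \<partial>lborel) \<longlonglongrightarrow> (\<integral>u. n u *\<^sub>R f t \<partial>lborel)"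
  proof (rule integral_dominated_convergence[where w = "\<lambda>u. n u * B"])
    show "integrable lborel (\<lambda>u. n u * B)" using n_int by simp
    show "AE u in lborel. norm (n u *\<^sub>R f (t - \<epsilon> k / (2 * pi) * u)) \<le> n u * B" for k
      using n_nonneg B by (auto intro!: mult_left_mono)
    show "AE u in lborel. (\<lambda>k. n u *\<^sub>R f (t - \<epsilon> k / (2 * pi) * u)) \<longlonglongrightarrow> n u *\<^sub>R f t"
    proof (rule AE_I2)
      fix u
      have "(\<lambda>k. t - \<epsilon> k / (2 * pi) * u) \<longlonglongrightarrow> t - 0 / (2 * pi) * u"
        by (intro tendsto_intros \<epsilon>0) simp
      moreover have "isCont f t"
        using schwartz_continuous[OF f, of UNIV] by (simp add: continuous_on_eq_continuous_at)
      ultimately show "(\<lambda>k. n u *\<^sub>R f (t - \<epsilon> k / (2 * pi) * u)) \<longlonglongrightarrow> n u *\<^sub>R f t"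
        by (intro tendsto_intros) (auto intro: isCont_tendsto_compose)
    qed
  qed measurable
  ultimately have "(\<integral>\<xi>. fourier f \<xi> * cis (2 * pi * \<xi> * t) \<partial>lborel) = (\<integral>u. n u *\<^sub>R f t \<partial>lborel)"
    unfolding main[OF \<epsilon>] by (rule LIMSEQ_unique)
  also have "\<dots> = f t" using n_int n_int1 by simp
  finally show ?thesis .
qed

section \<open>Integration of Schwartz-valued curves\<close>

abbreviation decay_weight :: "nat \<Rightarrow> nat \<Rightarrow> real \<Rightarrow> real" where
  "decay_weight M N y \<equiv> 1 / (1 + y\<^sup>2) ^ M"

abbreviation box :: "real \<Rightarrow> (real \<times> real) set" where
  "box R \<equiv> {-R..R} \<times> {-R..R}"

abbreviation distance_weight :: "nat \<Rightarrow> real \<times> real \<Rightarrow> real" where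
  "distance_weight N p \<equiv> \<bar>fst p - snd p\<bar>"

interpretation decay: weight UNIV "decay_weight M" for M
  by standard (auto simp: one_plus_square_nonneg)

interpretation lip: weight "box R" distance_weight for R
  by standard auto

text \<open>Decay like \<open>1 / (1 + y^2)\<close> in every seminorm gives integrability; a local
  Lipschitz bound in every seminorm gives measurability and the quadrature error. Both properties
  survive \<open>vderiv\<close>.\<close>

definition schwartz_curve :: "(real \<Rightarrow> real \<Rightarrow> complex) \<Rightarrow> bool" where
  "schwartz_curve \<Phi> \<longleftrightarrow> decay.bounded_family 1 \<Phi> \<and>
     (\<forall>R. lip.bounded_family R (\<lambda>p t. \<Phi> (fst p) t - \<Phi> (snd p) t))"

lemma schwartz_curve_schwartz: "schwartz_curve \<Phi> \<Longrightarrow> \<Phi> y \<in> schwartz"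
  unfolding schwartz_curve_def by (blast intro: decay.bounded_family_schwartz)

lemma schwartz_curve_vderiv:
  assumes "schwartz_curve \<Phi>"
  shows "schwartz_curve (\<lambda>y. vderiv (\<Phi> y))"
proof -
  have *: "\<Phi> y \<in> schwartz" for y using assms by (rule schwartz_curve_schwartz)
  have "vderiv (\<lambda>t. \<Phi> y t - \<Phi> y' t) = (\<lambda>t. vderiv (\<Phi> y) t - vderiv (\<Phi> y') t)" for y y'
    by (intro vderiv_eqI has_vector_derivative_diff schwartz_has_derivative *)
  then show ?thesis
    using assms decay.bounded_family_vderiv[of 1 \<Phi>]
      lip.bounded_family_vderiv[of _ "\<lambda>p t. \<Phi> (fst p) t - \<Phi> (snd p) t"]
    unfolding schwartz_curve_def by auto
qed

lemma locally_lipschitz_continuous: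
  fixes f :: "real \<Rightarrow> complex"
  assumes "\<And>R. \<exists>C. \<forall>y\<in>{-R..R}. \<forall>y'\<in>{-R..R}. norm (f y - f y') \<le> C * \<bar>y - y'\<bar>"
  shows "continuous_on UNIV f"
  unfolding continuous_on_eq_continuous_at[OF open_UNIV]
proof
  fix y
  obtain C where C: "\<forall>u\<in>{-(\<bar>y\<bar>+1)..\<bar>y\<bar>+1}. \<forall>y'\<in>{-(\<bar>y\<bar>+1)..\<bar>y\<bar>+1}. norm (f u - f y') \<le> C * \<bar>u - y'\<bar>"
    using assms by blast
  have "((\<lambda>u. C * \<bar>u - y\<bar>) \<longlongrightarrow> 0) (at y)"
    by (auto intro!: tendsto_eq_intros)
  moreover have "\<forall>\<^sub>F u in at y. norm (f u - f y) \<le> C * \<bar>u - y\<bar>"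
    unfolding eventually_at
  proof (intro exI[of _ 1] conjI ballI impI)
    fix u assume "u \<noteq> y \<and> dist u y < 1"
    then have "u \<in> {-(\<bar>y\<bar>+1)..\<bar>y\<bar>+1}" by (auto simp: dist_real_def)
    moreover have "y \<in> {-(\<bar>y\<bar>+1)..\<bar>y\<bar>+1}" by auto
    ultimately show "norm (f u - f y) \<le> C * \<bar>u - y\<bar>" using C by blast
  qed simp
  ultimately have "((\<lambda>u. f u - f y) \<longlongrightarrow> 0) (at y)"
    by (rule Lim_null_comparison[rotated])
  then show "isCont f y" unfolding isCont_def by (simp add: LIM_zero_iff)
qed

lemma schwartz_curve_bounds:
  assumes "schwartz_curve \<Phi>"
  shows "\<exists>C\<ge>0. \<forall>y t. \<bar>t\<bar> ^ k * norm (\<Phi> y t) \<le> C * (1 / (1 + y\<^sup>2))"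
    and "\<exists>C\<ge>0. \<forall>y\<in>{-R..R}. \<forall>y'\<in>{-R..R}. \<forall>t. \<bar>t\<bar> ^ k * norm (\<Phi> y t - \<Phi> y' t) \<le> C * \<bar>y - y'\<bar>"
proof -
  have "decay.decaying_family 1 \<Phi>"
    using assms unfolding schwartz_curve_def by (intro decay.bounded_family_decay) blast
  then obtain C where "\<forall>y\<in>UNIV. \<forall>t. \<bar>t\<bar> ^ k * norm (\<Phi> y t) \<le> C * (1 / (1 + y\<^sup>2) ^ 1)"
    unfolding decay.decaying_family_def by blast
  then have C: "\<bar>t\<bar> ^ k * norm (\<Phi> y t) \<le> C * (1 / (1 + y\<^sup>2))" for y t
    unfolding power_one_right by blast
  have "\<bar>t\<bar> ^ k * norm (\<Phi> y t) \<le> \<bar>C\<bar> * (1 / (1 + y\<^sup>2))" for y t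
    by (rule order_trans[OF C]) (intro mult_right_mono, auto)
  then show "\<exists>C\<ge>0. \<forall>y t. \<bar>t\<bar> ^ k * norm (\<Phi> y t) \<le> C * (1 / (1 + y\<^sup>2))"
    by (intro exI[of _ "\<bar>C\<bar>"]) auto
  obtain D where D: "\<forall>p\<in>box R. \<forall>t. \<bar>t\<bar> ^ k * norm (\<Phi> (fst p) t - \<Phi> (snd p) t) \<le> D * \<bar>fst p - snd p\<bar>"
    using lip.bounded_family_decay[of R "\<lambda>p t. \<Phi> (fst p) t - \<Phi> (snd p) t"] assms
    unfolding schwartz_curve_def lip.decaying_family_def by blast
  have "\<bar>t\<bar> ^ k * norm (\<Phi> y t - \<Phi> y' t) \<le> \<bar>D\<bar> * \<bar>y - y'\<bar>" if "y \<in> {-R..R}" "y' \<in> {-R..R}" for y y' t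
  proof -
    have "\<bar>t\<bar> ^ k * norm (\<Phi> y t - \<Phi> y' t) \<le> D * \<bar>y - y'\<bar>"
      using D[rule_format, of "(y, y')" t] that by simp
    also have "\<dots> \<le> \<bar>D\<bar> * \<bar>y - y'\<bar>" by (intro mult_right_mono) auto
    finally show ?thesis .
  qed
  then show "\<exists>C\<ge>0. \<forall>y\<in>{-R..R}. \<forall>y'\<in>{-R..R}. \<forall>t. \<bar>t\<bar> ^ k * norm (\<Phi> y t - \<Phi> y' t) \<le> C * \<bar>y - y'\<bar>"
    by (intro exI[of _ "\<bar>D\<bar>"]) auto
qed

lemma schwartz_curve_continuous:
  assumes "schwartz_curve \<Phi>" shows "continuous_on UNIV (\<lambda>y. \<Phi> y t)"
  using schwartz_curve_bounds(2)[OF assms, of _ 0] by (intro locally_lipschitz_continuous) fastforce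

lemma schwartz_curve_measurable:
  "schwartz_curve \<Phi> \<Longrightarrow> (\<lambda>y. \<Phi> y t) \<in> borel_measurable borel"
  by (intro borel_measurable_continuous_onI schwartz_curve_continuous)

lemma schwartz_curve_integrable:
  assumes "schwartz_curve \<Phi>" shows "integrable lborel (\<lambda>y. \<Phi> y t)"
proof -
  obtain C where C: "0 \<le> C" "\<And>y. norm (\<Phi> y t) \<le> C * (1 / (1 + y\<^sup>2))"
    using schwartz_curve_bounds(1)[OF assms, of 0] by fastforce
  show ?thesis
  proof (rule Bochner_Integration.integrable_bound)
    show "integrable lborel (\<lambda>y::real. C * (1 / (1 + y\<^sup>2)))"
      using integrable_inverse_one_plus_square by (rule integrable_mult_right)
    show "AE y in lborel. norm (\<Phi> y t) \<le> norm (C * (1 / (1 + y\<^sup>2)))"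
      using C(2) by (intro AE_I2) (metis abs_ge_self order_trans real_norm_def)
  qed (use schwartz_curve_measurable[OF assms] in simp)
qed

text \<open>The weights are chosen so that the integral of a curve over a set is controlled by the
  measure of the set, and its deviation from a rectangle rule is of second order in the length.\<close>

abbreviation mass_weight :: "nat \<Rightarrow> real set \<Rightarrow> real" where
  "mass_weight N A \<equiv> (\<integral>y. indicator A y *\<^sub>R (1 / (1 + y\<^sup>2)) \<partial>lborel)"

interpretation mass: weight "sets borel" mass_weight
  by standard (auto intro!: Bochner_Integration.integral_nonneg)

text \<open>Formed pointwise in \<open>t\<close>. Keeping the set as index lets the measure of the
  set serve as weight.\<close>

definition curve_integral :: "(real \<Rightarrow> real \<Rightarrow> complex) \<Rightarrow> real set \<Rightarrow> real \<Rightarrow> complex" where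
  "curve_integral \<Phi> A t = (\<integral>y. indicator A y *\<^sub>R \<Phi> y t \<partial>lborel)"

text \<open>The Taylor remainder of \<open>\<Phi> y\<close> is controlled by its second seminorm,
  which is integrable in \<open>y\<close>.\<close>

lemma curve_integral_has_derivative:
  assumes \<Phi>: "schwartz_curve \<Phi>" and [measurable]: "A \<in> sets borel"
  shows "(curve_integral \<Phi> A has_vector_derivative curve_integral (\<lambda>y. vderiv (\<Phi> y)) A t) (at t)"
proof -
  obtain C where "\<forall>y\<in>UNIV. schwartz_seminorm 0 2 (\<Phi> y) \<le> C * (1 / (1 + y\<^sup>2) ^ 1)"
    using \<Phi> unfolding schwartz_curve_def decay.bounded_family_def by blast
  then have C: "schwartz_seminorm 0 2 (\<Phi> y) \<le> C * (1 / (1 + y\<^sup>2))" for y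
    unfolding power_one_right by blast
  show ?thesis
    unfolding curve_integral_def
  proof (rule has_vector_derivative_integral_quadratic)
    have \<Phi>y: "\<Phi> y \<in> schwartz" for y using \<Phi> by (rule schwartz_curve_schwartz)
    show "integrable lborel (\<lambda>y. indicator A y *\<^sub>R \<Phi> y s)" for s
      using schwartz_curve_integrable[OF \<Phi>] by (intro integrable_mult_indicator) auto
    show "integrable lborel (\<lambda>y. indicator A y *\<^sub>R vderiv (\<Phi> y) t)"
      using schwartz_curve_integrable[OF schwartz_curve_vderiv[OF \<Phi>]]
      by (intro integrable_mult_indicator) auto
    show "integrable lborel (\<lambda>y::real. C * (1 / (1 + y\<^sup>2)))"
      using integrable_inverse_one_plus_square by (rule integrable_mult_right)
    fix s y
    have "norm (indicator A y *\<^sub>R \<Phi> y s - indicator A y *\<^sub>R \<Phi> y t - (s - t) *\<^sub>R indicator A y *\<^sub>R vderiv (\<Phi> y) t)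
       \<le> norm (\<Phi> y s - \<Phi> y t - (s - t) *\<^sub>R vderiv (\<Phi> y) t)"
      by (auto simp: indicator_def)
    also have "\<dots> \<le> schwartz_seminorm 0 2 (\<Phi> y) * (s - t)\<^sup>2" using \<Phi>y by (rule schwartz_taylor)
    also have "\<dots> \<le> C * (1 / (1 + y\<^sup>2)) * (s - t)\<^sup>2" using C by (intro mult_right_mono) auto
    finally show "norm (indicator A y *\<^sub>R \<Phi> y s - indicator A y *\<^sub>R \<Phi> y t - (s - t) *\<^sub>R indicator A y *\<^sub>R vderiv (\<Phi> y) t)
       \<le> C * (1 / (1 + y\<^sup>2)) * (s - t)\<^sup>2" .
  qed
qed

text \<open>Differentiation in \<open>t\<close> leads to the integral of the derived curve, so the
  coinduction runs over all Schwartz curves. In consequence \<open>T\<close> of a tail integral is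
  small.\<close>

lemma bounded_family_curve_integral:
  assumes "schwartz_curve \<Phi>"
  shows "mass.bounded_family (curve_integral \<Phi>)"
proof (rule mass.bounded_family_coinduct[where J = "Collect schwartz_curve" and \<Theta> = curve_integral])
  show "\<Phi> \<in> Collect schwartz_curve" using assms by simp
  fix \<Phi> assume "\<Phi> \<in> Collect schwartz_curve"
  then have \<Phi>: "schwartz_curve \<Phi>" by simp
  show "mass.decaying_family (curve_integral \<Phi>)"
    unfolding mass.decaying_family_def
  proof
    fix k
    obtain C where C: "0 \<le> C" "\<And>y t. \<bar>t\<bar> ^ k * norm (\<Phi> y t) \<le> C * (1 / (1 + y\<^sup>2))"
      using schwartz_curve_bounds(1)[OF \<Phi>, of k] by blast
    have "\<bar>t\<bar> ^ k * norm (curve_integral \<Phi> A t) \<le> C * mass_weight N A" if [measurable]: "A \<in> sets borel" for A t and N :: nat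
    proof -
      have "\<bar>t\<bar> ^ k * norm (curve_integral \<Phi> A t) = norm (\<integral>y. \<bar>t\<bar> ^ k *\<^sub>R indicator A y *\<^sub>R \<Phi> y t \<partial>lborel)"
        unfolding curve_integral_def by (subst integral_scaleR_right) simp
      also have "\<dots> \<le> (\<integral>y. C * (indicator A y *\<^sub>R (1 / (1 + y\<^sup>2))) \<partial>lborel)"
      proof (rule Bochner_Integration.integral_norm_bound_integral)
        show "integrable lborel (\<lambda>y. \<bar>t\<bar> ^ k *\<^sub>R indicator A y *\<^sub>R \<Phi> y t)"
          by (intro integrable_scaleR_right integrable_mult_indicator schwartz_curve_integrable \<Phi>) simp
        show "integrable lborel (\<lambda>y. C * (indicator A y *\<^sub>R (1 / (1 + y\<^sup>2))))"
          by (intro integrable_mult_right integrable_mult_indicator integrable_inverse_one_plus_square) simp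
        show "norm (\<bar>t\<bar> ^ k *\<^sub>R indicator A y *\<^sub>R \<Phi> y t) \<le> C * (indicator A y *\<^sub>R (1 / (1 + y\<^sup>2)))" for y
          using C(2)[of t y] by (auto simp: indicator_def)
      qed
      also have "\<dots> = C * mass_weight N A" by (rule integral_mult_right_zero)
      finally show ?thesis .
    qed
    then show "\<exists>C N. \<forall>A\<in>sets borel. \<forall>t. \<bar>t\<bar> ^ k * norm (curve_integral \<Phi> A t) \<le> C * mass_weight N A" by blast
  qed
  show "differentiates (sets borel) (Collect schwartz_curve) curve_integral \<Phi>"
      unfolding differentiates_def
    using curve_integral_has_derivative[OF \<Phi>] schwartz_curve_vderiv[OF \<Phi>]
    by (intro disjI1 bexI[of _ "\<lambda>y. vderiv (\<Phi> y)"]) auto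
qed

text \<open>Allowing any sample point in the interval covers both one-sided difference quotients,
  where the sample sits at the left or at the right end.\<close>

abbreviation triples :: "real \<Rightarrow> (real \<times> real \<times> real) set" where
  "triples R \<equiv> {(a, b, c). -R \<le> a \<and> a \<le> c \<and> c \<le> b \<and> b \<le> R}"

abbreviation square_weight :: "nat \<Rightarrow> real \<times> real \<times> real \<Rightarrow> real" where
  "square_weight N \<equiv> \<lambda>(a, b, c). (b - a)\<^sup>2"

interpretation rect: weight "triples R" square_weight for R
  by standard auto

definition rectangle_error :: "(real \<Rightarrow> real \<Rightarrow> complex) \<Rightarrow> real \<times> real \<times> real \<Rightarrow> real \<Rightarrow> complex" where
  "rectangle_error \<Phi> = (\<lambda>(a, b, c) t. curve_integral \<Phi> {a<..b} t - of_real (b - a) * \<Phi> c t)"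

lemma rectangle_error_eq:
  assumes "schwartz_curve \<Phi>" "a \<le> b"
  shows "rectangle_error \<Phi> (a, b, c) t = (\<integral>y. indicator {a<..b} y *\<^sub>R (\<Phi> y t - \<Phi> c t) \<partial>lborel)"
proof -
  have "(\<integral>y. indicator {a<..b} y *\<^sub>R (\<Phi> y t - \<Phi> c t) \<partial>lborel) =
      curve_integral \<Phi> {a<..b} t - (\<integral>y. indicator {a<..b} y *\<^sub>R \<Phi> c t \<partial>lborel)"
    unfolding curve_integral_def scaleR_right_diff_distrib
  proof (rule Bochner_Integration.integral_diff)
    show "integrable lborel (\<lambda>y. indicator {a<..b} y *\<^sub>R \<Phi> y t)"
      by (intro integrable_mult_indicator schwartz_curve_integrable assms) simp
  qed (use assms(2) in simp)
  also have "(\<integral>y. indicator {a<..b} y *\<^sub>R \<Phi> c t \<partial>lborel) = (b - a) *\<^sub>R \<Phi> c t"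
    using assms(2) by simp
  finally show ?thesis by (simp add: rectangle_error_def scaleR_conv_of_real)
qed

text \<open>On the interval the curve differs from its value at \<open>c\<close> by at most a
  constant times \<open>b - a\<close>; integration contributes the second factor
  \<open>b - a\<close>.\<close>

lemma bounded_family_rectangle_error:
  assumes "schwartz_curve \<Phi>"
  shows "rect.bounded_family R (rectangle_error \<Phi>)"
proof (rule rect.bounded_family_coinduct[where J = "Collect schwartz_curve" and \<Theta> = rectangle_error])
  show "\<Phi> \<in> Collect schwartz_curve" using assms by simp
  fix \<Phi> assume "\<Phi> \<in> Collect schwartz_curve"
  then have \<Phi>: "schwartz_curve \<Phi>" by simp
  show "rect.decaying_family R (rectangle_error \<Phi>)"
    unfolding rect.decaying_family_def
  proof
    fix k
    obtain C where C: "0 \<le> C" "\<And>y y' t. y \<in> {-R..R} \<Longrightarrow> y' \<in> {-R..R} \<Longrightarrow> \<bar>t\<bar> ^ k * norm (\<Phi> y t - \<Phi> y' t) \<le> C * \<bar>y - y'\<bar>"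
      using schwartz_curve_bounds(2)[OF \<Phi>, of R k] by blast
    have "\<bar>t\<bar> ^ k * norm (rectangle_error \<Phi> (a, b, c) t) \<le> C * (b - a)\<^sup>2"
      if "-R \<le> a" "a \<le> c" "c \<le> b" "b \<le> R" for a b c t
    proof -
      have ab: "a \<le> b" using that by simp
      have "\<bar>t\<bar> ^ k * norm (rectangle_error \<Phi> (a, b, c) t) =
          norm (\<integral>y. \<bar>t\<bar> ^ k *\<^sub>R indicator {a<..b} y *\<^sub>R (\<Phi> y t - \<Phi> c t) \<partial>lborel)"
        unfolding rectangle_error_eq[OF \<Phi> ab] by (subst integral_scaleR_right) simp
      also have "\<dots> \<le> (\<integral>y. indicator {a<..b} y *\<^sub>R (C * (b - a)) \<partial>lborel)"
      proof (rule Bochner_Integration.integral_norm_bound_integral)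
        have "integrable lborel (\<lambda>y. indicator {a<..b} y *\<^sub>R \<Phi> y t - indicator {a<..b} y *\<^sub>R \<Phi> c t)"
        proof (rule Bochner_Integration.integrable_diff)
          show "integrable lborel (\<lambda>y. indicator {a<..b} y *\<^sub>R \<Phi> y t)"
            by (intro integrable_mult_indicator schwartz_curve_integrable \<Phi>) simp
        qed (use ab in simp)
        then show "integrable lborel (\<lambda>y. \<bar>t\<bar> ^ k *\<^sub>R indicator {a<..b} y *\<^sub>R (\<Phi> y t - \<Phi> c t))"
          unfolding scaleR_right_diff_distrib[of "indicator _ _"] by (rule integrable_scaleR_right)
        show "integrable lborel (\<lambda>y. indicator {a<..b} y *\<^sub>R (C * (b - a)))"
          using ab by simp
        fix y
        show "norm (\<bar>t\<bar> ^ k *\<^sub>R indicator {a<..b} y *\<^sub>R (\<Phi> y t - \<Phi> c t)) \<le> indicator {a<..b} y *\<^sub>R (C * (b - a))"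
        proof (cases "y \<in> {a<..b}")
          case True
          then have "\<bar>t\<bar> ^ k * norm (\<Phi> y t - \<Phi> c t) \<le> C * \<bar>y - c\<bar>" using that by (intro C) auto
          also have "\<dots> \<le> C * (b - a)" using C(1) True that by (intro mult_left_mono) auto
          finally show ?thesis using True by simp
        qed simp
      qed
      also have "\<dots> = C * (b - a)\<^sup>2" using ab by (simp add: power2_eq_square)
      finally show ?thesis .
    qed
    then show "\<exists>C N. \<forall>p\<in>triples R. \<forall>t. \<bar>t\<bar> ^ k * norm (rectangle_error \<Phi> p t) \<le> C * square_weight N p"
      by (intro exI[of _ C]) auto
  qed
  have "(rectangle_error \<Phi> p has_vector_derivative rectangle_error (\<lambda>y. vderiv (\<Phi> y)) p t) (at t)" for p t
    unfolding rectangle_error_def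
    by (cases p) (auto intro!: has_vector_derivative_diff curve_integral_has_derivative[OF \<Phi>]
      has_vector_derivative_mult_right schwartz_has_derivative schwartz_curve_schwartz[OF \<Phi>])
  then show "differentiates (triples R) (Collect schwartz_curve) rectangle_error \<Phi>"
      unfolding differentiates_def
    using schwartz_curve_vderiv[OF \<Phi>]
    by (intro disjI1 bexI[of _ "\<lambda>y. vderiv (\<Phi> y)"]) auto
qed

lemma curve_integral_split:
  assumes "schwartz_curve \<Phi>" and [measurable]: "A \<in> sets borel" "B \<in> sets borel" and "A \<inter> B = {}"
  shows "curve_integral \<Phi> (A \<union> B) = (\<lambda>t. curve_integral \<Phi> A t + curve_integral \<Phi> B t)"
proof
  fix t
  show "curve_integral \<Phi> (A \<union> B) t = curve_integral \<Phi> A t + curve_integral \<Phi> B t"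
    unfolding curve_integral_def
  proof (subst Bochner_Integration.integral_add[symmetric])
    show "integrable lborel (\<lambda>y. indicator A y *\<^sub>R \<Phi> y t)" "integrable lborel (\<lambda>y. indicator B y *\<^sub>R \<Phi> y t)"
      by (intro integrable_mult_indicator schwartz_curve_integrable assms(1); simp)+
    show "(\<integral>y. indicator (A \<union> B) y *\<^sub>R \<Phi> y t \<partial>lborel) =
        (\<integral>y. indicator A y *\<^sub>R \<Phi> y t + indicator B y *\<^sub>R \<Phi> y t \<partial>lborel)"
      using assms(4) by (intro Bochner_Integration.integral_cong refl) (auto simp: indicator_def)
  qed
qed

lemma mass_weight_tendsto_0:
  "((\<lambda>R. mass_weight N {R<..}) \<longlongrightarrow> 0) at_top" "((\<lambda>R. mass_weight N {..R}) \<longlongrightarrow> 0) at_bot"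
proof -
  have "((\<lambda>R. (\<integral>y. indicator (A R) y *\<^sub>R (1 / (1 + y\<^sup>2)) \<partial>lborel)) \<longlongrightarrow> (\<integral>y. (0::real) \<partial>(lborel :: real measure))) at_top"
    if A [measurable]: "\<And>R. A R \<in> sets borel" and ev: "\<And>y. \<forall>\<^sub>F R in at_top. y \<notin> A R" for A :: "real \<Rightarrow> real set"
  proof (rule integral_dominated_convergence_at_top[where w = "\<lambda>y. 1 / (1 + y\<^sup>2)"])
    show "AE y in lborel. ((\<lambda>R. indicator (A R) y *\<^sub>R (1 / (1 + y\<^sup>2))) \<longlongrightarrow> 0) at_top"
    proof (rule AE_I2)
      fix y :: real
      show "((\<lambda>R. indicator (A R) y *\<^sub>R (1 / (1 + y\<^sup>2))) \<longlongrightarrow> 0) at_top"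
        by (rule tendsto_eventually) (use ev[of y] in eventually_elim, simp)
    qed
    show "\<forall>\<^sub>F R in at_top. AE y in lborel. norm (indicator (A R) y *\<^sub>R (1 / (1 + y\<^sup>2))) \<le> 1 / (1 + y\<^sup>2)"
      by (intro always_eventually allI AE_I2) (auto simp: indicator_def)
  qed (auto intro: integrable_inverse_one_plus_square)
  note * = this
  show "((\<lambda>R. mass_weight N {R<..}) \<longlongrightarrow> 0) at_top"
    using *[of "\<lambda>R. {R<..}"] by (simp add: eventually_ge_at_top not_less)
  have "((\<lambda>R. mass_weight N {..- R}) \<longlongrightarrow> 0) at_top"
  proof -
    have "\<forall>\<^sub>F R in at_top. \<not> y \<le> - R" for y :: real
      using eventually_gt_at_top[of "- y"] by eventually_elim auto
    then show ?thesis using *[of "\<lambda>R. {..- R}"] by simp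
  qed
  then show "((\<lambda>R. mass_weight N {..R}) \<longlongrightarrow> 0) at_bot"
    unfolding filterlim_at_bot_mirror .
qed

text \<open>Stated for curves with local Lipschitz bounds alone because pure translates and
  modulates, the curves behind the short-time Fourier transform, do not decay in
  \<open>y\<close>.\<close>

lemma tempered_lipschitz_continuous:
  assumes T: "T \<in> tempered" and \<Phi>: "\<And>y. \<Phi> y \<in> schwartz"
    and lip: "\<And>R. lip.bounded_family R (\<lambda>p t. \<Phi> (fst p) t - \<Phi> (snd p) t)"
  shows "continuous_on UNIV (\<lambda>y. T (\<Phi> y))"
proof (rule locally_lipschitz_continuous)
  fix R
  obtain C N where "\<And>p. p \<in> box R \<Longrightarrow> norm (T (\<lambda>t. \<Phi> (fst p) t - \<Phi> (snd p) t)) \<le> C * distance_weight N p"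
    using lip.tempered_bounded_family[OF T lip] by blast
  then show "\<exists>C. \<forall>y\<in>{-R..R}. \<forall>y'\<in>{-R..R}. norm (T (\<Phi> y) - T (\<Phi> y')) \<le> C * \<bar>y - y'\<bar>"
    using tempered_diff[OF T \<Phi> \<Phi>] by (metis fst_conv snd_conv mem_Sigma_iff)
qed

text \<open>The primitive \<open>R \<mapsto> T (\<integral>\<^bsub>-\<infinity>\<^esub>\<^bsup>R\<^esup> \<Phi>)\<close> has derivative \<open>T (\<Phi> R)\<close>, so the fundamental theorem
  of calculus moves \<open>T\<close> under the integral sign.\<close>

lemma tempered_curve_integral:
  assumes T: "T \<in> tempered" and \<Phi>: "schwartz_curve \<Phi>"
  shows "T (\<lambda>t. \<integral>y. \<Phi> y t \<partial>lborel) = (\<integral>y. T (\<Phi> y) \<partial>lborel)"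
proof -
  let ?I = "curve_integral \<Phi>"
  have UNIV: "?I UNIV = (\<lambda>t. \<integral>y. \<Phi> y t \<partial>lborel)"
    unfolding curve_integral_def by auto
  have I: "?I A \<in> schwartz" if "A \<in> sets borel" for A
    using mass.bounded_family_schwartz[OF bounded_family_curve_integral[OF \<Phi>] that] .
  have \<Phi>y: "\<Phi> y \<in> schwartz" for y using \<Phi> by (rule schwartz_curve_schwartz)
  have split: "T (?I (A \<union> B)) = T (?I A) + T (?I B)"
    if "A \<in> sets borel" "B \<in> sets borel" "A \<inter> B = {}" for A B
    unfolding curve_integral_split[OF \<Phi> that] using I that by (intro tempered_add[OF T])
  obtain C where C: "\<And>A. A \<in> sets borel \<Longrightarrow> norm (T (?I A)) \<le> C * mass_weight 0 A"
    using mass.tempered_bounded_family[OF T bounded_family_curve_integral[OF \<Phi>]] by blast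
  have cont: "continuous_on UNIV (\<lambda>y. T (\<Phi> y))"
    using \<Phi> unfolding schwartz_curve_def by (intro tempered_lipschitz_continuous[OF T \<Phi>y]) blast
  have "decay.bounded_family 1 \<Phi>" using \<Phi> unfolding schwartz_curve_def by blast
  from decay.tempered_bounded_family[OF T this] obtain D where
    "\<And>y. y \<in> UNIV \<Longrightarrow> norm (T (\<Phi> y)) \<le> D * (1 / (1 + y\<^sup>2) ^ 1)" by blast
  then have D: "norm (T (\<Phi> y)) \<le> D * (1 / (1 + y\<^sup>2))" for y
    unfolding power_one_right by blast
  have int: "integrable lborel (\<lambda>y. T (\<Phi> y))"
  proof (rule Bochner_Integration.integrable_bound)
    show "integrable lborel (\<lambda>y::real. D * (1 / (1 + y\<^sup>2)))"
      using integrable_inverse_one_plus_square by (rule integrable_mult_right)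
    show "AE y in lborel. norm (T (\<Phi> y)) \<le> norm (D * (1 / (1 + y\<^sup>2)))"
      using D by (intro AE_I2) (metis abs_ge_self order_trans real_norm_def)
    show "(\<lambda>y. T (\<Phi> y)) \<in> borel_measurable lborel"
      using borel_measurable_continuous_onI[OF cont] by simp
  qed
  have "(\<integral>y. T (\<Phi> y) \<partial>lborel) = T (?I UNIV) - 0"
  proof (rule integral_vector_derivative_UNIV[OF _ cont int])
    fix R :: real
    \<comment> \<open>The interval from \<open>- ?K\<close> to \<open>?K\<close> contains all points
      within distance 1 of \<open>R\<close>, the range where the quadratic bound is needed.\<close>
    let ?K = "\<bar>R\<bar> + 1 :: real"
    obtain E where E: "\<And>p. p \<in> triples ?K \<Longrightarrow> norm (T (rectangle_error \<Phi> p)) \<le> E * square_weight 0 p"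
      using rect.tempered_bounded_family[OF T bounded_family_rectangle_error[OF \<Phi>]] by blast
    have step: "norm (T (?I {..b}) - T (?I {..a}) - of_real (b - a) * T (\<Phi> c)) \<le> E * (b - a)\<^sup>2"
      if "- ?K \<le> a" "a \<le> c" "c \<le> b" "b \<le> ?K" for a b c
    proof -
      have "{..b} = {..a} \<union> {a<..b}" using that by auto
      then have "T (?I {..b}) = T (?I {..a}) + T (?I {a<..b})"
        using split[of "{..a}" "{a<..b}"] by (simp add: disjoint_iff)
      moreover have "T (rectangle_error \<Phi> (a, b, c)) = T (?I {a<..b}) - of_real (b - a) * T (\<Phi> c)"
        unfolding rectangle_error_def prod.case
        using tempered_diff[OF T I schwartz_scale[OF \<Phi>y], of "{a<..b}" "of_real (b - a)" c]
          tempered_scale[OF T \<Phi>y, of "of_real (b - a)" c] by simp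
      ultimately have "T (?I {..b}) - T (?I {..a}) - of_real (b - a) * T (\<Phi> c) = T (rectangle_error \<Phi> (a, b, c))"
        by simp
      then show ?thesis using E[of "(a, b, c)"] that by simp
    qed
    show "((\<lambda>R. T (?I {..R})) has_vector_derivative T (\<Phi> R)) (at R)"
    proof (rule has_vector_derivative_quadratic)
      fix s assume s: "\<bar>s - R\<bar> \<le> 1"
      show "norm (T (?I {..s}) - T (?I {..R}) - (s - R) *\<^sub>R T (\<Phi> R)) \<le> E * (s - R)\<^sup>2"
      proof (cases "R \<le> s")
        case True
        then show ?thesis using step[of R R s] s by (simp add: scaleR_conv_of_real)
      next
        case False
        then have "norm (T (?I {..R}) - T (?I {..s}) - of_real (R - s) * T (\<Phi> R)) \<le> E * (R - s)\<^sup>2"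
          using step[of s R R] s by simp
        also have "norm (T (?I {..R}) - T (?I {..s}) - of_real (R - s) * T (\<Phi> R)) =
            norm (T (?I {..s}) - T (?I {..R}) - (s - R) *\<^sub>R T (\<Phi> R))"
          by (subst norm_minus_cancel[symmetric]) (simp add: scaleR_conv_of_real algebra_simps)
        finally show ?thesis by (simp add: power2_commute)
      qed
    qed
  next
    \<comment> \<open>At minus infinity the primitive is itself a small tail; at plus infinity it is
      the full integral minus the complementary tail.\<close>
    have "((\<lambda>R. C * mass_weight 0 {..R}) \<longlongrightarrow> 0) at_bot"
      using tendsto_mult_left[OF mass_weight_tendsto_0(2), of C] by simp
    then show "((\<lambda>R. T (?I {..R})) \<longlongrightarrow> 0) at_bot"
      by (rule Lim_null_comparison[rotated]) (intro always_eventually allI C, simp)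
    have "((\<lambda>R. C * mass_weight 0 {R<..}) \<longlongrightarrow> 0) at_top"
      using tendsto_mult_left[OF mass_weight_tendsto_0(1), of C] by simp
    then have "((\<lambda>R. T (?I {R<..})) \<longlongrightarrow> 0) at_top"
      by (rule Lim_null_comparison[rotated]) (intro always_eventually allI C, simp)
    then have "((\<lambda>R. T (?I UNIV) - T (?I {R<..})) \<longlongrightarrow> T (?I UNIV) - 0) at_top"
      by (intro tendsto_diff tendsto_const)
    moreover have "T (?I UNIV) - T (?I {R<..}) = T (?I {..R})" for R
    proof -
      have "{..R} \<union> {R<..} = UNIV" by auto
      with split[of "{..R}" "{R<..}"] show ?thesis by (simp add: disjoint_iff)
    qed
    ultimately show "((\<lambda>R. T (?I {..R})) \<longlongrightarrow> T (?I UNIV)) at_top" by simp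
  qed
  then show "T (\<lambda>t. \<integral>y. \<Phi> y t \<partial>lborel) = (\<integral>y. T (\<Phi> y) \<partial>lborel)"
    unfolding UNIV by simp
qed

section \<open>Translation and modulation curves\<close>

text \<open>A Peetre-type inequality; the right side minus the left side is exactly the sum of
  squares in the proof.\<close>

lemma one_plus_square_translate_le: "1 + y\<^sup>2 \<le> 2 * (1 + (t - y)\<^sup>2) * (1 + t\<^sup>2)" for y t :: real
proof -
  have "0 \<le> (y - 2 * t)\<^sup>2 + 2 * t\<^sup>2 * (t - y)\<^sup>2 + 1" by simp
  then show ?thesis by (simp add: power2_eq_square algebra_simps)
qed

lemma schwartz_decay_square:
  assumes "f \<in> schwartz"
  obtains C where "0 \<le> C" "\<And>t. (1 + t\<^sup>2) ^ M * (\<bar>t\<bar> ^ k * norm (f t)) \<le> C"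
proof -
  obtain C where C: "0 \<le> C" "\<And>t. (1 + \<bar>t\<bar>) ^ (2 * M + k) * norm (f t) \<le> C"
    using schwartz_decay[OF assms] by blast
  have "(1 + t\<^sup>2) ^ M * (\<bar>t\<bar> ^ k * norm (f t)) \<le> C" for t
  proof -
    have "(1 + t\<^sup>2) ^ M * \<bar>t\<bar> ^ k \<le> ((1 + \<bar>t\<bar>)\<^sup>2) ^ M * (1 + \<bar>t\<bar>) ^ k"
      by (intro mult_mono power_mono one_plus_square_le) auto
    also have "\<dots> = (1 + \<bar>t\<bar>) ^ (2 * M + k)" by (simp add: power_mult power_add)
    finally have "(1 + t\<^sup>2) ^ M * \<bar>t\<bar> ^ k * norm (f t) \<le> (1 + \<bar>t\<bar>) ^ (2 * M + k) * norm (f t)"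
      by (rule mult_right_mono) simp
    also have "\<dots> \<le> C" by (rule C)
    finally show ?thesis by (simp add: mult.assoc)
  qed
  with C(1) show ?thesis by (rule that)
qed

lemma has_vector_derivative_translate:
  assumes "f \<in> schwartz"
  shows "((\<lambda>t. f (t - y)) has_vector_derivative vderiv f (t - y)) (at t)"
proof -
  have "((\<lambda>t. t - y) has_vector_derivative 1) (at t)"
    by (auto intro!: derivative_eq_intros simp: has_real_derivative_iff_has_vector_derivative[symmetric])
  from vector_diff_chain_at[OF this schwartz_has_derivative[OF assms]]
  show ?thesis by (simp add: o_def)
qed

lemma has_vector_derivative_translate_mult:
  assumes "\<gamma> \<in> schwartz" "\<psi> \<in> schwartz"
  shows "((\<lambda>t. \<gamma> (t - y) * \<psi> t) has_vector_derivative
    (vderiv \<gamma> (t - y) * \<psi> t + \<gamma> (t - y) * vderiv \<psi> t)) (at t)"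
  by (rule has_vector_derivative_eq_rhs[OF has_vector_derivative_mult[OF
      has_vector_derivative_translate[OF assms(1)] schwartz_has_derivative[OF assms(2)]]]) simp

text \<open>A large \<open>y\<close> forces \<open>t\<close> to be far from \<open>y\<close> or far
  from 0, so one factor is small; the order \<open>M\<close> of the decay is arbitrary. The product
  rule yields two further pairs of Schwartz functions.\<close>

lemma bounded_family_translate_mult:
  assumes "\<gamma> \<in> schwartz" "\<psi> \<in> schwartz"
  shows "decay.bounded_family M (\<lambda>y t. \<gamma> (t - y) * \<psi> t)"
proof -
  let ?J = "schwartz \<times> schwartz"
  let ?\<Theta> = "\<lambda>j y t. fst j (t - y) * snd j t :: complex"
  have "decay.bounded_family M (?\<Theta> (\<gamma>, \<psi>))"
  proof (rule decay.bounded_family_coinduct[where J = ?J and \<Theta> = ?\<Theta>])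
    show "(\<gamma>, \<psi>) \<in> ?J" using assms by simp
    fix j assume "j \<in> ?J"
    then obtain \<gamma> \<psi> where j: "j = (\<gamma>, \<psi>)" and *: "\<gamma> \<in> schwartz" "\<psi> \<in> schwartz" by auto
    show "decay.decaying_family M (?\<Theta> j)"
      unfolding decay.decaying_family_def
    proof
      fix k
      obtain C where C: "0 \<le> C" "\<And>t. (1 + t\<^sup>2) ^ M * (\<bar>t\<bar> ^ 0 * norm (\<gamma> t)) \<le> C"
        using schwartz_decay_square[OF *(1)] by blast
      obtain D where D: "0 \<le> D" "\<And>t. (1 + t\<^sup>2) ^ M * (\<bar>t\<bar> ^ k * norm (\<psi> t)) \<le> D"
        using schwartz_decay_square[OF *(2)] by blast
      have "\<bar>t\<bar> ^ k * norm (?\<Theta> j y t) \<le> (2 ^ M * C * D) * (1 / (1 + y\<^sup>2) ^ M)" for y t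
      proof -
        have "(1 + y\<^sup>2) ^ M \<le> (2 * (1 + (t - y)\<^sup>2) * (1 + t\<^sup>2)) ^ M"
          by (intro power_mono one_plus_square_translate_le) simp
        also have "\<dots> = 2 ^ M * (1 + (t - y)\<^sup>2) ^ M * (1 + t\<^sup>2) ^ M"
          by (simp only: power_mult_distrib)
        finally have "(1 + y\<^sup>2) ^ M * (norm (\<gamma> (t - y)) * (\<bar>t\<bar> ^ k * norm (\<psi> t)))
           \<le> 2 ^ M * (1 + (t - y)\<^sup>2) ^ M * (1 + t\<^sup>2) ^ M * (norm (\<gamma> (t - y)) * (\<bar>t\<bar> ^ k * norm (\<psi> t)))"
          by (rule mult_right_mono) simp
        also have "\<dots> = 2 ^ M * (((1 + (t - y)\<^sup>2) ^ M * (\<bar>t - y\<bar> ^ 0 * norm (\<gamma> (t - y)))) *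
            ((1 + t\<^sup>2) ^ M * (\<bar>t\<bar> ^ k * norm (\<psi> t))))" by simp
        also have "\<dots> \<le> 2 ^ M * (C * D)"
          using C D by (intro mult_left_mono mult_mono) auto
        finally have "(1 + y\<^sup>2) ^ M * (\<bar>t\<bar> ^ k * norm (?\<Theta> j y t)) \<le> 2 ^ M * C * D"
          by (simp add: j norm_mult mult_ac)
        moreover have "0 < (1 + y\<^sup>2) ^ M" using one_plus_square_pos[of y] by simp
        ultimately show ?thesis by (simp add: field_simps)
      qed
      then show "\<exists>C N. \<forall>y\<in>UNIV. \<forall>t. \<bar>t\<bar> ^ k * norm (?\<Theta> j y t) \<le> C * decay_weight M N y" by blast
    qed
    have "(?\<Theta> j y has_vector_derivative (?\<Theta> (vderiv \<gamma>, \<psi>) y t + ?\<Theta> (\<gamma>, vderiv \<psi>) y t)) (at t)" for y t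
      unfolding j fst_conv snd_conv using * by (rule has_vector_derivative_translate_mult)
    then show "differentiates UNIV ?J ?\<Theta> j"
      unfolding differentiates_def
      using * schwartz_vderiv
      by (intro disjI2 bexI[of _ "(vderiv \<gamma>, \<psi>)"] bexI[of _ "(\<gamma>, vderiv \<psi>)"]) auto
  qed
  then show ?thesis by simp
qed

text \<open>The product is the member \<open>y = 0\<close> of the family just bounded.\<close>

lemma schwartz_mult:
  assumes "f \<in> schwartz" "g \<in> schwartz" shows "(\<lambda>t. f t * g t) \<in> schwartz"
  using decay.bounded_family_schwartz[OF bounded_family_translate_mult[OF assms, of 0], of 0] by simp

text \<open>Only the translated factor moves, with a seminorm as its Lipschitz constant; the fixed
  factor supplies the decay in \<open>t\<close>.\<close>

lemma lipschitz_family_translate_mult: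
  assumes "\<gamma> \<in> schwartz" "\<psi> \<in> schwartz"
  shows "lip.bounded_family R (\<lambda>p t. \<gamma> (t - fst p) * \<psi> t - \<gamma> (t - snd p) * \<psi> t)"
proof -
  let ?J = "schwartz \<times> schwartz"
  let ?\<Theta> = "\<lambda>j p t. fst j (t - fst p) * snd j t - fst j (t - snd p) * snd j t :: complex"
  have "lip.bounded_family R (?\<Theta> (\<gamma>, \<psi>))"
  proof (rule lip.bounded_family_coinduct[where J = ?J and \<Theta> = ?\<Theta>])
    show "(\<gamma>, \<psi>) \<in> ?J" using assms by simp
    fix j assume "j \<in> ?J"
    then obtain \<gamma> \<psi> where j: "j = (\<gamma>, \<psi>)" and *: "\<gamma> \<in> schwartz" "\<psi> \<in> schwartz" by auto
    show "lip.decaying_family R (?\<Theta> j)"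
      unfolding lip.decaying_family_def
    proof
      fix k
      have "\<bar>t\<bar> ^ k * norm (?\<Theta> j p t) \<le> (schwartz_seminorm 0 1 \<gamma> * schwartz_seminorm k 0 \<psi>) * \<bar>fst p - snd p\<bar>" for p t
      proof -
        have "\<bar>t\<bar> ^ k * norm (?\<Theta> j p t) = norm (\<gamma> (t - fst p) - \<gamma> (t - snd p)) * (\<bar>t\<bar> ^ k * norm (\<psi> t))"
          by (simp add: j norm_mult flip: left_diff_distrib)
        also have "\<dots> \<le> (schwartz_seminorm 0 1 \<gamma> * \<bar>fst p - snd p\<bar>) * schwartz_seminorm k 0 \<psi>"
          using schwartz_lipschitz[OF *(1), of "t - fst p" "t - snd p"] *
          by (intro mult_mono schwartz_seminorm_upper0 mult_nonneg_nonneg schwartz_seminorm_nonneg)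
             (auto simp: abs_minus_commute)
        finally show ?thesis by (simp add: mult_ac)
      qed
      then show "\<exists>C N. \<forall>p\<in>box R. \<forall>t. \<bar>t\<bar> ^ k * norm (?\<Theta> j p t) \<le> C * distance_weight N p" by blast
    qed
    have "(?\<Theta> j p has_vector_derivative (?\<Theta> (vderiv \<gamma>, \<psi>) p t + ?\<Theta> (\<gamma>, vderiv \<psi>) p t)) (at t)" for p t
      unfolding j fst_conv snd_conv
      using has_vector_derivative_diff[OF has_vector_derivative_translate_mult[OF *]
          has_vector_derivative_translate_mult[OF *]]
      by (rule has_vector_derivative_eq_rhs) (simp add: algebra_simps)
    then show "differentiates (box R) ?J ?\<Theta> j"
      unfolding differentiates_def
      using * schwartz_vderiv
      by (intro disjI2 bexI[of _ "(vderiv \<gamma>, \<psi>)"] bexI[of _ "(\<gamma>, vderiv \<psi>)"]) auto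
  qed
  then show ?thesis by simp
qed

lemma schwartz_curve_translate_mult:
  assumes "\<gamma> \<in> schwartz" "\<psi> \<in> schwartz"
  shows "schwartz_curve (\<lambda>y t. \<gamma> (t - y) * \<psi> t)"
  unfolding schwartz_curve_def
  using bounded_family_translate_mult[OF assms] lipschitz_family_translate_mult[OF assms] by blast

text \<open>For each \<open>t\<close> the factors \<open>\<gamma> (t - y)\<close> have the same
  integral over \<open>y\<close>, so integrating the curve returns a multiple of
  \<open>\<psi>\<close>.\<close>

lemma tempered_translate_mult_integral:
  assumes "T \<in> tempered" "\<gamma> \<in> schwartz" "\<psi> \<in> schwartz"
  shows "(\<integral>y. \<gamma> y \<partial>lborel) * T \<psi> = (\<integral>y. T (\<lambda>t. \<gamma> (t - y) * \<psi> t) \<partial>lborel)"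
proof -
  have "(\<integral>y. \<gamma> (t - y) \<partial>lborel) = (\<integral>y. \<gamma> y \<partial>lborel)" for t
    using lborel_integral_real_affine[of "-1" \<gamma> t] by simp
  then have "(\<lambda>t. \<integral>y. \<gamma> (t - y) * \<psi> t \<partial>lborel) = (\<lambda>t. (\<integral>y. \<gamma> y \<partial>lborel) * \<psi> t)"
    by simp
  then show ?thesis
    using tempered_curve_integral[OF assms(1) schwartz_curve_translate_mult[OF assms(2,3)]]
      tempered_scale[OF assms(1,3)] by simp
qed

text \<open>With no fixed factor present, decay in \<open>t\<close> comes from the derivative of
  \<open>\<gamma>\<close>: for \<open>|z| \<le> R\<close> the point \<open>t - z\<close> is large
  whenever \<open>t\<close> is. This costs \<open>(1 + |R|) ^ k\<close>.\<close>

lemma lipschitz_family_translate: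
  assumes "\<gamma> \<in> schwartz"
  shows "lip.bounded_family R (\<lambda>p t. \<gamma> (t - fst p) - \<gamma> (t - snd p))"
proof (rule lip.bounded_family_coinduct[where J = schwartz and \<Theta> = "\<lambda>\<gamma> p t. \<gamma> (t - fst p) - \<gamma> (t - snd p)"])
  show "\<gamma> \<in> schwartz" by fact
  fix \<gamma> :: "real \<Rightarrow> complex" assume \<gamma>: "\<gamma> \<in> schwartz"
  show "lip.decaying_family R (\<lambda>p t. \<gamma> (t - fst p) - \<gamma> (t - snd p))"
    unfolding lip.decaying_family_def
  proof
    fix k
    obtain C where C: "0 \<le> C" "\<And>t. (1 + \<bar>t\<bar>) ^ k * norm (vderiv \<gamma> t) \<le> C"
      using schwartz_decay[OF schwartz_vderiv[OF \<gamma>]] by blast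
    have "\<bar>t\<bar> ^ k * norm (\<gamma> (t - x) - \<gamma> (t - y)) \<le> ((1 + \<bar>R\<bar>) ^ k * C) * \<bar>x - y\<bar>"
      if x: "x \<in> {-R..R}" and y: "y \<in> {-R..R}" for x y t
    proof -
      have "norm (\<bar>t\<bar> ^ k *\<^sub>R \<gamma> (t - x) - \<bar>t\<bar> ^ k *\<^sub>R \<gamma> (t - y)) \<le> ((1 + \<bar>R\<bar>) ^ k * C) * norm (x - y)"
      proof (rule differentiable_bound[where S = "{-R..R}" and f' = "\<lambda>z h. h *\<^sub>R (\<bar>t\<bar> ^ k *\<^sub>R (- vderiv \<gamma> (t - z)))"])
        fix z assume z: "z \<in> {-R..R}"
        have "((\<lambda>z. t - z) has_vector_derivative -1) (at z)"
          by (auto intro!: derivative_eq_intros simp: has_real_derivative_iff_has_vector_derivative[symmetric])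
        from vector_diff_chain_at[OF this schwartz_has_derivative[OF \<gamma>]]
        have "((\<lambda>z. \<gamma> (t - z)) has_vector_derivative (- vderiv \<gamma> (t - z))) (at z)"
          by (simp add: o_def)
        from bounded_linear.has_vector_derivative[OF bounded_linear_scaleR_right[of "\<bar>t\<bar> ^ k"] this]
        show "((\<lambda>z. \<bar>t\<bar> ^ k *\<^sub>R \<gamma> (t - z)) has_derivative (\<lambda>h. h *\<^sub>R (\<bar>t\<bar> ^ k *\<^sub>R (- vderiv \<gamma> (t - z))))) (at z within {-R..R})"
          unfolding has_vector_derivative_def by (rule has_derivative_at_withinI)
        have "\<bar>t\<bar> \<le> \<bar>t - z\<bar> + \<bar>R\<bar>" using z by auto
        also have "\<dots> \<le> (1 + \<bar>R\<bar>) * (1 + \<bar>t - z\<bar>)" by (simp add: algebra_simps)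
        finally have "\<bar>t\<bar> ^ k \<le> ((1 + \<bar>R\<bar>) * (1 + \<bar>t - z\<bar>)) ^ k" by (intro power_mono) auto
        then have "\<bar>t\<bar> ^ k * norm (vderiv \<gamma> (t - z)) \<le> ((1 + \<bar>R\<bar>) * (1 + \<bar>t - z\<bar>)) ^ k * norm (vderiv \<gamma> (t - z))"
          by (rule mult_right_mono) simp
        also have "\<dots> = (1 + \<bar>R\<bar>) ^ k * ((1 + \<bar>t - z\<bar>) ^ k * norm (vderiv \<gamma> (t - z)))"
          by (simp add: power_mult_distrib)
        also have "\<dots> \<le> (1 + \<bar>R\<bar>) ^ k * C" using C by (intro mult_left_mono) auto
        finally have le: "\<bar>t\<bar> ^ k * norm (vderiv \<gamma> (t - z)) \<le> (1 + \<bar>R\<bar>) ^ k * C" .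
        show "onorm (\<lambda>h. h *\<^sub>R (\<bar>t\<bar> ^ k *\<^sub>R (- vderiv \<gamma> (t - z)))) \<le> (1 + \<bar>R\<bar>) ^ k * C"
          using mult_left_mono[OF le abs_ge_zero] C(1)
          by (intro onorm_bound) (auto simp: mult_ac abs_mult power_abs)
      qed (use x y in auto)
      then show ?thesis by (simp flip: scaleR_right_diff_distrib)
    qed
    then show "\<exists>C N. \<forall>p\<in>box R. \<forall>t. \<bar>t\<bar> ^ k * norm (\<gamma> (t - fst p) - \<gamma> (t - snd p)) \<le> C * distance_weight N p"
      by (intro exI[of _ "(1 + \<bar>R\<bar>) ^ k * C"]) (simp add: mem_Times_iff)
  qed
  have "((\<lambda>t. \<gamma> (t - fst p) - \<gamma> (t - snd p)) has_vector_derivative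
      (vderiv \<gamma> (t - fst p) - vderiv \<gamma> (t - snd p))) (at t)" for p t
    by (intro has_vector_derivative_diff has_vector_derivative_translate \<gamma>)
  then show "differentiates (box R) schwartz (\<lambda>\<gamma> p t. \<gamma> (t - fst p) - \<gamma> (t - snd p)) \<gamma>"
      unfolding differentiates_def
    using schwartz_vderiv[OF \<gamma>] by blast
qed

text \<open>Differentiating the exponential in \<open>t\<close> multiplies the coefficient by the
  frequency, so the class of coefficients must be stable under that. It contains the Schwartz
  functions and the constant 1.\<close>

definition locally_lipschitz :: "(real \<Rightarrow> complex) \<Rightarrow> bool" where
  "locally_lipschitz c \<longleftrightarrow> (\<forall>R. \<exists>C\<ge>0. \<forall>y\<in>{-R..R}. \<forall>y'\<in>{-R..R}.
     norm (c y) \<le> C \<and> norm (c y - c y') \<le> C * \<bar>y - y'\<bar>)"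

lemma locally_lipschitz_mult_id:
  assumes "locally_lipschitz c"
  shows "locally_lipschitz (\<lambda>y. z * of_real y * c y)"
  unfolding locally_lipschitz_def
proof
  fix R
  obtain C where C: "0 \<le> C" "\<And>y. y \<in> {-R..R} \<Longrightarrow> norm (c y) \<le> C"
    "\<And>y y'. y \<in> {-R..R} \<Longrightarrow> y' \<in> {-R..R} \<Longrightarrow> norm (c y - c y') \<le> C * \<bar>y - y'\<bar>"
    using assms unfolding locally_lipschitz_def by blast
  let ?D = "norm z * (1 + \<bar>R\<bar>) * C"
  have "norm (z * of_real y * c y) \<le> ?D \<and> norm (z * of_real y * c y - z * of_real y' * c y') \<le> ?D * \<bar>y - y'\<bar>"
    if y: "y \<in> {-R..R}" and y': "y' \<in> {-R..R}" for y y'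
  proof
    show "norm (z * of_real y * c y) \<le> ?D"
      unfolding norm_mult using y C by (intro mult_mono) auto
    have "z * of_real y * c y - z * of_real y' * c y' =
        z * (of_real (y - y') * c y + of_real y' * (c y - c y'))"
      by (simp add: algebra_simps)
    also have "norm \<dots> \<le> norm z * (\<bar>y - y'\<bar> * norm (c y) + \<bar>y'\<bar> * norm (c y - c y'))"
      unfolding norm_mult
      by (intro mult_left_mono norm_triangle_le add_mono) (simp_all only: norm_mult norm_of_real order_refl norm_ge_zero)
    also have "\<dots> \<le> norm z * (\<bar>y - y'\<bar> * C + \<bar>R\<bar> * (C * \<bar>y - y'\<bar>))"
      using C y y' by (intro mult_left_mono add_mono mult_mono) auto
    also have "\<dots> = ?D * \<bar>y - y'\<bar>" by (simp add: algebra_simps)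
    finally show "norm (z * of_real y * c y - z * of_real y' * c y') \<le> ?D * \<bar>y - y'\<bar>" .
  qed
  then show "\<exists>C\<ge>0. \<forall>y\<in>{-R..R}. \<forall>y'\<in>{-R..R}. norm (z * of_real y * c y) \<le> C \<and>
     norm (z * of_real y * c y - z * of_real y' * c y') \<le> C * \<bar>y - y'\<bar>"
    using C(1) by (intro exI[of _ ?D]) auto
qed

lemma schwartz_locally_lipschitz:
  assumes "c \<in> schwartz" shows "locally_lipschitz c"
  unfolding locally_lipschitz_def
proof
  fix R
  let ?C = "max (schwartz_seminorm 0 0 c) (schwartz_seminorm 0 1 c)"
  have "norm (c y - c y') \<le> ?C * \<bar>y - y'\<bar>" for y y'
    using schwartz_lipschitz[OF assms, of y y'] by (rule order_trans) (intro mult_right_mono, auto)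
  moreover have "norm (c y) \<le> ?C" for y
    using schwartz_seminorm_upper00[OF assms, of y] by simp
  ultimately show "\<exists>C\<ge>0. \<forall>y\<in>{-R..R}. \<forall>y'\<in>{-R..R}. norm (c y) \<le> C \<and> norm (c y - c y') \<le> C * \<bar>y - y'\<bar>"
    using schwartz_seminorm_nonneg[OF assms] by (intro exI[of _ ?C]) (auto simp: le_max_iff_disj)
qed

lemma has_vector_derivative_cis_mult:
  assumes "\<phi> \<in> schwartz"
  shows "((\<lambda>t. c * (cis (2 * pi * \<eta> * t) * \<phi> t)) has_vector_derivative
    ((2 * pi * \<i>) * of_real \<eta> * c) * (cis (2 * pi * \<eta> * t) * \<phi> t) + c * (cis (2 * pi * \<eta> * t) * vderiv \<phi> t)) (at t)"
proof -
  have "((\<lambda>t. cis (2 * pi * \<eta> * t)) has_vector_derivative \<i> * of_real (2 * pi * \<eta>) * cis (2 * pi * \<eta> * t)) (at t)"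
    by (rule has_vector_derivative_eq_rhs[OF has_vector_derivative_cis])
       (auto intro!: derivative_eq_intros)
  from has_vector_derivative_mult_right[OF has_vector_derivative_mult[OF this schwartz_has_derivative[OF assms]], of c]
  show ?thesis by (rule has_vector_derivative_eq_rhs) (simp add: algebra_simps)
qed

text \<open>Changing the frequency from \<open>y\<close> to \<open>y'\<close> changes the
  exponential by at most \<open>2 pi |y - y'| |t|\<close>; the extra power of \<open>t\<close> is
  paid for by the decay of \<open>\<phi>\<close>.\<close>

lemma lipschitz_family_cis_mult:
  assumes "locally_lipschitz c" "\<phi> \<in> schwartz"
  shows "lip.bounded_family R (\<lambda>p t. c (fst p) * (cis (2 * pi * fst p * t) * \<phi> t) - c (snd p) * (cis (2 * pi * snd p * t) * \<phi> t))"
proof -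
  let ?J = "Collect locally_lipschitz \<times> schwartz"
  let ?\<Theta> = "\<lambda>j p t. fst j (fst p) * (cis (2 * pi * fst p * t) * snd j t)
    - fst j (snd p) * (cis (2 * pi * snd p * t) * snd j t)"
  have "lip.bounded_family R (?\<Theta> (c, \<phi>))"
  proof (rule lip.bounded_family_coinduct[where J = ?J and \<Theta> = ?\<Theta>])
    show "(c, \<phi>) \<in> ?J" using assms by simp
    fix j assume "j \<in> ?J"
    then obtain c \<phi> where j: "j = (c, \<phi>)" and *: "locally_lipschitz c" "\<phi> \<in> schwartz" by auto
    show "lip.decaying_family R (?\<Theta> j)"
      unfolding lip.decaying_family_def
    proof
      fix k
      obtain C where C: "0 \<le> C" "\<And>y. y \<in> {-R..R} \<Longrightarrow> norm (c y) \<le> C"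
        "\<And>y y'. y \<in> {-R..R} \<Longrightarrow> y' \<in> {-R..R} \<Longrightarrow> norm (c y - c y') \<le> C * \<bar>y - y'\<bar>"
        using *(1) unfolding locally_lipschitz_def by blast
      obtain D where D: "0 \<le> D" "\<And>t. (1 + \<bar>t\<bar>) ^ Suc k * norm (\<phi> t) \<le> D"
        using schwartz_decay[OF *(2)] by blast
      have "\<bar>t\<bar> ^ k * norm (?\<Theta> j (y, y') t) \<le> (2 * pi * C * D) * \<bar>y - y'\<bar>"
        if y: "y \<in> {-R..R}" and y': "y' \<in> {-R..R}" for y y' t
      proof -
        have "?\<Theta> j (y, y') t = ((c y - c y') * cis (2 * pi * y * t)
            + c y' * (cis (2 * pi * y * t) - cis (2 * pi * y' * t))) * \<phi> t"
          by (simp add: j algebra_simps)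
        also have "norm \<dots> \<le> (norm (c y - c y') + norm (c y') * norm (cis (2 * pi * y * t) - cis (2 * pi * y' * t))) * norm (\<phi> t)"
          unfolding norm_mult by (intro mult_right_mono norm_triangle_le add_mono) (auto simp: norm_mult)
        also have "\<dots> \<le> (C * \<bar>y - y'\<bar> + C * \<bar>2 * pi * y * t - 2 * pi * y' * t\<bar>) * norm (\<phi> t)"
          using C y y' by (intro mult_right_mono add_mono mult_mono norm_cis_diff_le) auto
        also have "\<dots> = C * \<bar>y - y'\<bar> * ((1 + 2 * pi * \<bar>t\<bar>) * norm (\<phi> t))"
        proof -
          have "2 * pi * y * t - 2 * pi * y' * t = 2 * pi * (y - y') * t" by (simp add: algebra_simps)
          then have "\<bar>2 * pi * y * t - 2 * pi * y' * t\<bar> = 2 * pi * \<bar>y - y'\<bar> * \<bar>t\<bar>" by (simp only: abs_mult) simp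
          then show ?thesis by (simp only:) (simp add: distrib_left distrib_right mult_ac)
        qed
        also have "\<dots> \<le> C * \<bar>y - y'\<bar> * ((2 * pi * (1 + \<bar>t\<bar>)) * norm (\<phi> t))"
          using C(1) pi_gt3 by (intro mult_left_mono mult_right_mono) (auto simp: algebra_simps)
        finally have "\<bar>t\<bar> ^ k * norm (?\<Theta> j (y, y') t) \<le>
            (1 + \<bar>t\<bar>) ^ k * (C * \<bar>y - y'\<bar> * ((2 * pi * (1 + \<bar>t\<bar>)) * norm (\<phi> t)))"
          by (intro mult_mono power_mono) auto
        also have "\<dots> = 2 * pi * C * \<bar>y - y'\<bar> * ((1 + \<bar>t\<bar>) ^ Suc k * norm (\<phi> t))"
          by simp
        also have "\<dots> \<le> 2 * pi * C * \<bar>y - y'\<bar> * D"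
          using C(1) by (intro mult_left_mono D) auto
        finally show ?thesis by (simp add: mult_ac)
      qed
      then show "\<exists>C N. \<forall>p\<in>box R. \<forall>t. \<bar>t\<bar> ^ k * norm (?\<Theta> j p t) \<le> C * distance_weight N p"
        by (intro exI[of _ "2 * pi * C * D"]) auto
    qed
    let ?c = "\<lambda>y. (2 * pi * \<i>) * of_real y * c y"
    have "(?\<Theta> j p has_vector_derivative (?\<Theta> (?c, \<phi>) p t + ?\<Theta> (c, vderiv \<phi>) p t)) (at t)" for p t
      unfolding j fst_conv snd_conv
      using has_vector_derivative_diff[OF has_vector_derivative_cis_mult[OF *(2)]
          has_vector_derivative_cis_mult[OF *(2)]]
      by (rule has_vector_derivative_eq_rhs) (simp add: algebra_simps)
    then show "differentiates (box R) ?J ?\<Theta> j"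
      unfolding differentiates_def
      using * schwartz_vderiv locally_lipschitz_mult_id[OF *(1), of "2 * pi * \<i>"]
      by (intro disjI2 bexI[of _ "(?c, \<phi>)"] bexI[of _ "(c, vderiv \<phi>)"]) auto
  qed
  then show ?thesis by simp
qed

text \<open>Decay in the frequency comes from the coefficient alone. Derivatives in \<open>t\<close>
  multiply it by the frequency, and it remains Schwartz.\<close>

lemma bounded_family_cis_mult:
  assumes "c \<in> schwartz" "\<phi> \<in> schwartz"
  shows "decay.bounded_family 1 (\<lambda>\<eta> t. c \<eta> * (cis (2 * pi * \<eta> * t) * \<phi> t))"
proof -
  let ?J = "schwartz \<times> schwartz"
  let ?\<Theta> = "\<lambda>j \<eta> t. fst j \<eta> * (cis (2 * pi * \<eta> * t) * snd j t)"
  have "decay.bounded_family 1 (?\<Theta> (c, \<phi>))"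
  proof (rule decay.bounded_family_coinduct[where J = ?J and \<Theta> = ?\<Theta>])
    show "(c, \<phi>) \<in> ?J" using assms by simp
    fix j assume "j \<in> ?J"
    then obtain c \<phi> where j: "j = (c, \<phi>)" and *: "c \<in> schwartz" "\<phi> \<in> schwartz" by auto
    show "decay.decaying_family 1 (?\<Theta> j)"
      unfolding decay.decaying_family_def
    proof
      fix k
      obtain C where C: "0 \<le> C" "\<And>t. (1 + \<bar>t\<bar>)^2 * norm (c t) \<le> C"
        using schwartz_decay[OF *(1)] by blast
      have "\<bar>t\<bar> ^ k * norm (?\<Theta> j \<eta> t) \<le> (C * schwartz_seminorm k 0 \<phi>) * (1 / (1 + \<eta>\<^sup>2) ^ 1)" for \<eta> t
      proof -
        have "\<bar>t\<bar> ^ k * norm (?\<Theta> j \<eta> t) = norm (c \<eta>) * (\<bar>t\<bar> ^ k * norm (\<phi> t))"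
          by (simp add: j norm_mult)
        also have "\<dots> \<le> (C * (1 / (1 + \<eta>\<^sup>2))) * schwartz_seminorm k 0 \<phi>"
          using C(1) * by (intro mult_mono decay_imp_le C schwartz_seminorm_upper0) auto
        finally show ?thesis by simp
      qed
      then show "\<exists>C N. \<forall>y\<in>UNIV. \<forall>t. \<bar>t\<bar> ^ k * norm (?\<Theta> j y t) \<le> C * decay_weight 1 N y" by blast
    qed
    let ?c = "\<lambda>y. (2 * pi * \<i>) * (of_real y * c y)"
    have "(?\<Theta> j \<eta> has_vector_derivative (?\<Theta> (?c, \<phi>) \<eta> t + ?\<Theta> (c, vderiv \<phi>) \<eta> t)) (at t)" for \<eta> t
      unfolding j fst_conv snd_conv
      using has_vector_derivative_cis_mult[OF *(2), of "c \<eta>" \<eta> t] by (simp add: mult.assoc)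
    then show "differentiates UNIV ?J ?\<Theta> j"
      unfolding differentiates_def
      using * schwartz_vderiv schwartz_scale[OF schwartz_mult_id[OF *(1)], of "2 * pi * \<i>"]
      by (intro disjI2 bexI[of _ "(?c, \<phi>)"] bexI[of _ "(c, vderiv \<phi>)"]) auto
  qed
  then show ?thesis by simp
qed

lemma schwartz_cis_mult: "\<phi> \<in> schwartz \<Longrightarrow> (\<lambda>t. cis (2 * pi * \<eta> * t) * \<phi> t) \<in> schwartz"
  using schwartz_modulation[of \<phi> \<eta>] unfolding modulation_def .

text \<open>Fourier inversion expands the multiplier \<open>k\<close> into exponentials; since the
  transform of \<open>k\<close> is Schwartz, the resulting curve decays and is locally
  Lipschitz.\<close>

lemma tempered_mult_eq_integral:
  assumes "T \<in> tempered" "k \<in> schwartz" "\<phi> \<in> schwartz"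
  shows "T (\<lambda>t. k t * \<phi> t) = (\<integral>\<eta>. fourier k \<eta> * T (\<lambda>t. cis (2 * pi * \<eta> * t) * \<phi> t) \<partial>lborel)"
proof -
  let ?\<Phi> = "\<lambda>\<eta> t. fourier k \<eta> * (cis (2 * pi * \<eta> * t) * \<phi> t)"
  have F: "fourier k \<in> schwartz" using assms(2) by (rule schwartz_fourier)
  have "schwartz_curve ?\<Phi>"
    unfolding schwartz_curve_def
    using bounded_family_cis_mult[OF F assms(3)]
      lipschitz_family_cis_mult[OF schwartz_locally_lipschitz[OF F] assms(3)] by blast
  note tempered_curve_integral[OF assms(1) this]
  moreover have "(\<integral>\<eta>. ?\<Phi> \<eta> t \<partial>lborel) = k t * \<phi> t" for t
    using fourier_inversion[OF assms(2), of t]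
    by (simp flip: mult.assoc)
  ultimately show ?thesis
    using tempered_scale[OF assms(1) schwartz_cis_mult[OF assms(3)]] by simp
qed

section \<open>Short-time Fourier transforms and change of window\<close>

lemma tempered_dist_modulation: "T \<in> tempered \<Longrightarrow> dist_modulation s T \<in> tempered"
  unfolding dist_modulation_def
  by (rule tempered_transpose[OF _ op.bounded_family_modulation[OF bounded_operator_id]])
     (auto simp: modulation_def algebra_simps)

lemma tempered_dist_chirp: "T \<in> tempered \<Longrightarrow> dist_chirp s T \<in> tempered"
  unfolding dist_chirp_def
  by (rule tempered_transpose[OF _ op.bounded_family_chirp[OF bounded_operator_id]])
     (auto simp: chirp_def algebra_simps)

lemma tempered_dist_dilation: "T \<in> tempered \<Longrightarrow> s \<noteq> 0 \<Longrightarrow> dist_dilation s T \<in> tempered"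
  unfolding dist_dilation_def
  by (rule tempered_transpose[OF _ op.bounded_family_dilation[OF bounded_operator_id]])
     (auto simp: dilation_def algebra_simps)

lemma tempered_dist_fourier: "T \<in> tempered \<Longrightarrow> dist_fourier T \<in> tempered"
  unfolding dist_fourier_def
  by (rule tempered_transpose[OF _ op.bounded_family_fourier[OF bounded_operator_id]])
     (auto simp: fourier_add fourier_scale)

text \<open>Rounding the first variable down to multiples of \<open>1 / Suc n\<close> leaves
  countably many slices, each measurable in the second variable; continuity in the first gives
  pointwise convergence. Separate continuity is what the Lipschitz estimates provide.\<close>

lemma borel_measurable_separately_continuous:
  fixes f :: "real \<Rightarrow> real \<Rightarrow> complex"
  assumes "\<And>y. continuous_on UNIV (\<lambda>x. f x y)" and "\<And>x. continuous_on UNIV (f x)"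
  shows "(\<lambda>p. f (fst p) (snd p)) \<in> borel_measurable (borel \<Otimes>\<^sub>M borel)"
proof (rule borel_measurable_LIMSEQ_metric)
  have [measurable]: "f x \<in> borel_measurable borel" for x
    using assms(2) by (rule borel_measurable_continuous_onI)
  let ?u = "\<lambda>n p. f (real_of_int \<lfloor>real (Suc n) * fst p\<rfloor> / real (Suc n)) (snd p)"
  show "?u n \<in> borel_measurable (borel \<Otimes>\<^sub>M borel)" for n
    by (rule measurable_compose_countable[where f = "\<lambda>i p. f (real_of_int i / real (Suc n)) (snd p)"
          and g = "\<lambda>p. \<lfloor>real (Suc n) * fst p\<rfloor>"]) measurable
  fix p :: "real \<times> real"
  have "(\<lambda>n. real_of_int \<lfloor>real (Suc n) * fst p\<rfloor> / real (Suc n)) \<longlonglongrightarrow> fst p"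
  proof (rule real_tendsto_sandwich)
    have "real (Suc n) * fst p - 1 \<le> real_of_int \<lfloor>real (Suc n) * fst p\<rfloor>" for n by linarith
    then have "(real (Suc n) * fst p - 1) / real (Suc n) \<le> real_of_int \<lfloor>real (Suc n) * fst p\<rfloor> / real (Suc n)" for n
      by (intro divide_right_mono) auto
    then have "fst p - 1 / real (Suc n) \<le> real_of_int \<lfloor>real (Suc n) * fst p\<rfloor> / real (Suc n)" for n
      by (simp add: diff_divide_distrib)
    then show "\<forall>\<^sub>F n in sequentially. fst p - 1 / real (Suc n) \<le> real_of_int \<lfloor>real (Suc n) * fst p\<rfloor> / real (Suc n)"
      by simp
    have "real_of_int \<lfloor>real (Suc n) * fst p\<rfloor> / real (Suc n) \<le> real (Suc n) * fst p / real (Suc n)" for n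
      by (intro divide_right_mono) auto
    then show "\<forall>\<^sub>F n in sequentially. real_of_int \<lfloor>real (Suc n) * fst p\<rfloor> / real (Suc n) \<le> fst p"
      by simp
    show "(\<lambda>n. fst p - 1 / real (Suc n)) \<longlonglongrightarrow> fst p" by real_asymp
  qed simp
  moreover have "isCont (\<lambda>x. f x (snd p)) (fst p)"
    using assms(1) by (simp add: continuous_on_eq_continuous_at)
  ultimately show "(\<lambda>n. ?u n p) \<longlonglongrightarrow> f (fst p) (snd p)"
    by (rule isCont_tendsto_compose[rotated])
qed

section \<open>Measurability of the short-time Fourier transform\<close>

lemma schwartz_stft_atom:
  assumes "g \<in> schwartz"
  shows "(\<lambda>t. cnj (g (t - x)) * cis (- 2 * pi * \<omega> * t)) \<in> schwartz"
  by (rule schwartz_mult_cis_neg[OF schwartz_cnj[OF schwartz_translate[OF assms]]])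

lemma borel_measurable_stft:
  assumes T: "T \<in> tempered" and g: "g \<in> schwartz"
  shows "(\<lambda>p. stft g T (fst p) (snd p)) \<in> borel_measurable (borel \<Otimes>\<^sub>M borel)"
proof (rule borel_measurable_separately_continuous)
  fix \<omega>
  have cg: "(\<lambda>t. cnj (g t)) \<in> schwartz" using g by (rule schwartz_cnj)
  have cgx: "(\<lambda>t. cnj (g (t - x))) \<in> schwartz" for x using schwartz_translate[OF cg] .
  \<comment> \<open>Moving the fixed modulation onto \<open>T\<close> leaves a pure translate as
    test function.\<close>
  have "stft g T x \<omega> = dist_modulation (- \<omega>) T (\<lambda>t. cnj (g (t - x)))" for x
    unfolding stft_def dist_modulation_def dist_transpose_def modulation_def
    by (simp add: cgx mult.commute)
  moreover have "continuous_on UNIV (\<lambda>x. dist_modulation (- \<omega>) T (\<lambda>t. cnj (g (t - x))))"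
    by (rule tempered_lipschitz_continuous[OF tempered_dist_modulation[OF T] cgx lipschitz_family_translate[OF cg]])
  ultimately show "continuous_on UNIV (\<lambda>x. stft g T x \<omega>)" by simp
next
  fix x
  have cg: "(\<lambda>t. cnj (g (t - x))) \<in> schwartz" using schwartz_translate[OF schwartz_cnj[OF g]] .
  \<comment> \<open>With coefficient 1 the curve is a pure modulation; the sign of the frequency is
    adjusted by composing with \<open>- \<omega>\<close>.\<close>
  have "locally_lipschitz (\<lambda>_. 1)" unfolding locally_lipschitz_def by (auto intro!: exI[of _ 1])
  from lipschitz_family_cis_mult[OF this cg]
  have "continuous_on UNIV (\<lambda>\<eta>. T (\<lambda>t. 1 * (cis (2 * pi * \<eta> * t) * cnj (g (t - x)))))"
    by (intro tempered_lipschitz_continuous[OF T]) (simp_all add: schwartz_cis_mult[OF cg])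
  from continuous_on_compose2[OF this, of UNIV "\<lambda>\<omega>. - \<omega>"]
  show "continuous_on UNIV (stft g T x)"
    unfolding stft_def by (simp add: mult.commute continuous_on_minus continuous_on_id)
qed

lemma borel_measurable_stft_reflect:
  assumes "T \<in> tempered" "g \<in> schwartz"
  shows "(\<lambda>p. stft g T (fst p) (\<omega> - snd p)) \<in> borel_measurable (borel \<Otimes>\<^sub>M borel)"
    and "(\<lambda>\<eta>. stft g T y (\<omega> - \<eta>)) \<in> borel_measurable borel"
  using measurable_compose[of "\<lambda>p. (fst p, \<omega> - snd p)", OF _ borel_measurable_stft[OF assms]]
    measurable_compose[of "\<lambda>\<eta>. (y, \<omega> - \<eta>)", OF _ borel_measurable_stft[OF assms]] by simp_all

text \<open>If \<open>f\<close> is not integrable, the integral on the left is 0 by convention, so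
  iterated integrals can be estimated without settling integrability.\<close>

lemma norm_integral_le_nn_integral:
  fixes f :: "'a \<Rightarrow> complex"
  shows "ennreal (norm (\<integral>x. f x \<partial>M)) \<le> (\<integral>\<^sup>+x. norm (f x) \<partial>M)"
proof (cases "integrable M f")
  case True
  then show ?thesis by (rule integral_norm_bound_ennreal)
qed (simp add: not_integrable_integral_eq)

abbreviation kernel :: "nat \<Rightarrow> real \<Rightarrow> real \<Rightarrow> real" where
  "kernel M u \<eta> \<equiv> 1 / (1 + u\<^sup>2) ^ M * (1 / (1 + \<eta>\<^sup>2) ^ M)"

text \<open>Reconstruction of the window \<open>h\<close> from the time-frequency shifts of \<open>g\<close>: write
  \<open>h(t - x)\<close> as an average of \<open>\<bar>g(t - y)\<bar>\<^sup>2 h(t - x)\<close> over \<open>y\<close>, and expand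
  \<open>g(t - y) h(t - x)\<close> by Fourier inversion.\<close>

lemma stft_change_window:
  assumes T: "T \<in> tempered" and g: "g \<in> schwartz" "g \<noteq> (\<lambda>t. 0)" and h: "h \<in> schwartz"
  shows "\<exists>C\<ge>0. \<forall>x \<omega>. ennreal (norm (stft h T x \<omega>)) \<le> ennreal C *
    (\<integral>\<^sup>+y. (\<integral>\<^sup>+\<eta>. ennreal (norm (stft g T y (\<omega> - \<eta>)) * kernel M (y - x) \<eta>) \<partial>lborel) \<partial>lborel)"
proof -
  define \<gamma> where "\<gamma> = (\<lambda>t. cnj (g t) * g t)"
  have \<gamma>: "\<gamma> \<in> schwartz" unfolding \<gamma>_def using g by (intro schwartz_mult schwartz_cnj)
  define n where "n = (\<integral>t. \<gamma> t \<partial>lborel)"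
  \<comment> \<open>\<open>n\<close> is the squared L2 norm of \<open>g\<close>; if it vanished,
    \<open>g\<close> would vanish almost everywhere and by continuity everywhere.\<close>
  have "n \<noteq> 0"
  proof
    assume "n = 0"
    have eq: "\<gamma> t = of_real ((norm (g t))\<^sup>2)" for t
      unfolding \<gamma>_def by (metis complex_norm_square mult.commute of_real_power)
    have "integrable lborel (\<lambda>t. (norm (g t))\<^sup>2)"
      using schwartz_integrable[OF \<gamma>] unfolding eq complex_of_real_integrable_eq .
    moreover have "(\<integral>t. (norm (g t))\<^sup>2 \<partial>lborel) = 0"
      using \<open>n = 0\<close> unfolding n_def eq by (simp only: integral_complex_of_real of_real_eq_0_iff)
    ultimately have "AE t in lborel. (norm (g t))\<^sup>2 = 0"
      by (subst (asm) integral_nonneg_eq_0_iff_AE) auto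
    then have "AE t in lborel. t \<in> {t. g t = 0}" by simp
    moreover have "closed {t. g t = 0}"
      using schwartz_continuous[OF g(1)] by (intro closed_Collect_eq continuous_on_const)
    ultimately have "t \<in> {t. g t = 0}" for t
      by (intro mem_closed_if_AE_lebesgue AE_completion)
    then show False using g(2) by auto
  qed
  \<comment> \<open>The product decays in the offset \<open>u\<close>; the Fourier transform keeps
    this bound and adds decay in the frequency, so both variables of the kernel are controlled
    together.\<close>
  have F: "decay.bounded_family M (\<lambda>u. fourier (\<lambda>s. g (s - u) * cnj (h s)))"
    by (intro decay.bounded_family_fourier bounded_family_translate_mult g schwartz_cnj h)
  obtain C N where "0 \<le> C" "\<And>u \<eta>. (1 + \<bar>\<eta>\<bar>) ^ (2 * M) * norm (fourier (\<lambda>s. g (s - u) * cnj (h s)) \<eta>) \<le> C * decay_weight M N u"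
    using decay.decaying_family_shift[OF decay.bounded_family_decay[OF F], of "2 * M"] by blast
  note C = this
  \<comment> \<open>Translating both factors by \<open>x\<close> changes only the phase of the
    transform, hence the dependence on \<open>y - x\<close>. The order \<open>2 * M\<close> above
    yields \<open>M\<close> powers of \<open>1 + \<eta>^2\<close>.\<close>
  have K: "norm (fourier (\<lambda>t. g (t - y) * cnj (h (t - x))) \<eta>) \<le> C * kernel M (y - x) \<eta>" for x y \<eta>
  proof -
    have "fourier (\<lambda>t. g (t - y) * cnj (h (t - x))) \<eta> =
        cis (- 2 * pi * \<eta> * x) * fourier (\<lambda>s. g (s - (y - x)) * cnj (h s)) \<eta>"
      by (subst fourier_translate[symmetric]) simp
    then have "norm (fourier (\<lambda>t. g (t - y) * cnj (h (t - x))) \<eta>) = norm (fourier (\<lambda>s. g (s - (y - x)) * cnj (h s)) \<eta>)"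
      by (simp add: norm_mult)
    moreover have "(1 + \<eta>\<^sup>2) ^ M * norm (fourier (\<lambda>s. g (s - (y - x)) * cnj (h s)) \<eta>) \<le> C * (1 / (1 + (y - x)\<^sup>2) ^ M)"
    proof (rule order_trans[OF mult_right_mono C(2)])
      show "(1 + \<eta>\<^sup>2) ^ M \<le> (1 + \<bar>\<eta>\<bar>) ^ (2 * M)"
        unfolding power_mult by (intro power_mono one_plus_square_le) simp
    qed simp
    moreover have "0 < (1 + \<eta>\<^sup>2) ^ M" using one_plus_square_pos[of \<eta>] by simp
    ultimately have "norm (fourier (\<lambda>t. g (t - y) * cnj (h (t - x))) \<eta>) \<le> C * (1 / (1 + (y - x)\<^sup>2) ^ M) / (1 + \<eta>\<^sup>2) ^ M"
      by (simp only: pos_le_divide_eq mult.commute[of "norm _" "_ ^ _"])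
    then show ?thesis by simp
  qed
  have "ennreal (norm (stft h T x \<omega>)) \<le> ennreal (C / norm n) *
    (\<integral>\<^sup>+y. (\<integral>\<^sup>+\<eta>. ennreal (norm (stft g T y (\<omega> - \<eta>)) * kernel M (y - x) \<eta>) \<partial>lborel) \<partial>lborel)" for x \<omega>
  proof -
    let ?\<psi> = "\<lambda>t. cnj (h (t - x)) * cis (- 2 * pi * \<omega> * t)"
    let ?k = "\<lambda>y t. g (t - y) * cnj (h (t - x))"
    let ?\<phi> = "\<lambda>y t. cnj (g (t - y)) * cis (- 2 * pi * \<omega> * t)"
    have k: "?k y \<in> schwartz" for y
      by (intro schwartz_mult schwartz_cnj schwartz_translate g h)
    \<comment> \<open>One factor of \<open>\<gamma> (t - y)\<close> joins the conjugate of
      \<open>h\<close> as multiplier, the other forms an atom of the window \<open>g\<close>; the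
      frequency \<open>\<eta>\<close> of the multiplier moves this atom from \<open>\<omega>\<close>
      to \<open>\<omega> - \<eta>\<close>.\<close>
    have "T (\<lambda>t. \<gamma> (t - y) * ?\<psi> t) = (\<integral>\<eta>. fourier (?k y) \<eta> * stft g T y (\<omega> - \<eta>) \<partial>lborel)" for y
    proof -
      have "T (\<lambda>t. \<gamma> (t - y) * ?\<psi> t) = T (\<lambda>t. ?k y t * ?\<phi> y t)"
        unfolding \<gamma>_def by (simp add: mult_ac)
      also have "\<dots> = (\<integral>\<eta>. fourier (?k y) \<eta> * T (\<lambda>t. cis (2 * pi * \<eta> * t) * ?\<phi> y t) \<partial>lborel)"
        using T k schwartz_stft_atom[OF g(1)] by (rule tempered_mult_eq_integral)
      finally have 1: "T (\<lambda>t. \<gamma> (t - y) * ?\<psi> t) =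
          (\<integral>\<eta>. fourier (?k y) \<eta> * T (\<lambda>t. cis (2 * pi * \<eta> * t) * ?\<phi> y t) \<partial>lborel)" .
      have "cis (2 * pi * \<eta> * t) * ?\<phi> y t = cnj (g (t - y)) * cis (- 2 * pi * (\<omega> - \<eta>) * t)" for \<eta> t
      proof -
        have "cis (2 * pi * \<eta> * t) * ?\<phi> y t = cnj (g (t - y)) * cis (2 * pi * \<eta> * t + - 2 * pi * \<omega> * t)"
          by (simp only: cis_mult[symmetric] mult.left_commute)
        also have "2 * pi * \<eta> * t + - 2 * pi * \<omega> * t = - 2 * pi * (\<omega> - \<eta>) * t" by (simp add: algebra_simps)
        finally show ?thesis .
      qed
      then have "T (\<lambda>t. cis (2 * pi * \<eta> * t) * ?\<phi> y t) = stft g T y (\<omega> - \<eta>)" for \<eta>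
        unfolding stft_def by (simp only:)
      then show ?thesis unfolding 1 by simp
    qed
    then have "n * stft h T x \<omega> = (\<integral>y. (\<integral>\<eta>. fourier (?k y) \<eta> * stft g T y (\<omega> - \<eta>) \<partial>lborel) \<partial>lborel)"
      using tempered_translate_mult_integral[OF T \<gamma> schwartz_stft_atom[OF h, of x \<omega>]]
      unfolding n_def stft_def[of h] by simp
    from norm_integral_le_nn_integral[of lborel "\<lambda>y. \<integral>\<eta>. fourier (?k y) \<eta> * stft g T y (\<omega> - \<eta>) \<partial>lborel", folded this]
    have "ennreal (norm n * norm (stft h T x \<omega>)) \<le>
        (\<integral>\<^sup>+y. norm (\<integral>\<eta>. fourier (?k y) \<eta> * stft g T y (\<omega> - \<eta>) \<partial>lborel) \<partial>lborel)"
      by (simp only: norm_mult)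
    also have "\<dots> \<le> (\<integral>\<^sup>+y. (\<integral>\<^sup>+\<eta>. norm (fourier (?k y) \<eta> * stft g T y (\<omega> - \<eta>)) \<partial>lborel) \<partial>lborel)"
      by (intro nn_integral_mono norm_integral_le_nn_integral)
    also have "\<dots> \<le> (\<integral>\<^sup>+y. (\<integral>\<^sup>+\<eta>. ennreal C * ennreal (norm (stft g T y (\<omega> - \<eta>)) *
        kernel M (y - x) \<eta>) \<partial>lborel) \<partial>lborel)"
    proof (intro nn_integral_mono)
      fix y \<eta>
      have "norm (fourier (?k y) \<eta> * stft g T y (\<omega> - \<eta>)) \<le>
          (C * kernel M (y - x) \<eta>) * norm (stft g T y (\<omega> - \<eta>))"
        unfolding norm_mult by (intro mult_right_mono K) simp
      also have "\<dots> = C * (norm (stft g T y (\<omega> - \<eta>)) * kernel M (y - x) \<eta>)"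
        by (simp only: mult_ac)
      finally show "ennreal (norm (fourier (?k y) \<eta> * stft g T y (\<omega> - \<eta>))) \<le>
        ennreal C * ennreal (norm (stft g T y (\<omega> - \<eta>)) * kernel M (y - x) \<eta>)"
        using \<open>0 \<le> C\<close> by (subst ennreal_mult[symmetric]) (auto intro!: ennreal_leI simp: one_plus_square_nonneg)
    qed
    also have "\<dots> = ennreal C * (\<integral>\<^sup>+y. (\<integral>\<^sup>+\<eta>. ennreal (norm (stft g T y (\<omega> - \<eta>)) *
        kernel M (y - x) \<eta>) \<partial>lborel) \<partial>lborel)"
    proof -
      note borel_measurable_stft_reflect[OF T g(1), measurable]
      show ?thesis by (simp add: nn_integral_cmult)
    qed
    finally have "ennreal (norm n * norm (stft h T x \<omega>)) \<le> ennreal C * (\<integral>\<^sup>+y. (\<integral>\<^sup>+\<eta>. ennreal (norm (stft g T y (\<omega> - \<eta>)) *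
        kernel M (y - x) \<eta>) \<partial>lborel) \<partial>lborel)" (is "_ \<le> _ * ?I") .
    then have "ennreal (1 / norm n) * ennreal (norm n * norm (stft h T x \<omega>)) \<le> ennreal (1 / norm n) * (ennreal C * ?I)"
      by (rule mult_left_mono) simp
    moreover have "ennreal (1 / norm n) * ennreal (norm n * norm (stft h T x \<omega>)) = ennreal (norm (stft h T x \<omega>))"
      using \<open>n \<noteq> 0\<close> by (simp flip: ennreal_mult)
    moreover have "ennreal (1 / norm n) * (ennreal C * ?I) = ennreal (C / norm n) * ?I"
      using \<open>0 \<le> C\<close> by (simp add: mult.assoc[symmetric] flip: ennreal_mult)
    ultimately show ?thesis by simp
  qed
  then show ?thesis using \<open>0 \<le> C\<close> by (intro exI[of _ "C / norm n"]) auto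
qed

section \<open>Weighted convolution inequality\<close>

text \<open>Two-sided comparison serves both signs of the exponent: for negative \<open>s\<close>
  the second inequality is raised to the power \<open>- s\<close>.\<close>

lemma powr_le_of_comparable:
  fixes A B D s :: real
  assumes "0 < A" "0 < B" "0 < D" "A \<le> B * D" "B \<le> A * D"
  shows "A powr s \<le> B powr s * D powr \<bar>s\<bar>"
proof (cases "0 \<le> s")
  case True
  then have "A powr s \<le> (B * D) powr s" using assms by (intro powr_mono2) auto
  then show ?thesis using assms True by (simp add: powr_mult)
next
  case False
  then have "B powr (- s) \<le> (A * D) powr (- s)" using assms by (intro powr_mono2) auto
  then have "B powr (- s) \<le> A powr (- s) * D powr (- s)" using assms by (simp add: powr_mult)
  then have "B powr (- s) * (A powr s * B powr s) \<le> A powr (- s) * D powr (- s) * (A powr s * B powr s)"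
    by (rule mult_right_mono) simp
  moreover have "B powr (- s) * B powr s = 1" "A powr (- s) * A powr s = 1"
    using assms by (simp_all flip: powr_add)
  ultimately have "A powr s \<le> D powr (- s) * B powr s"
    by (metis (no_types, opaque_lifting) mult.assoc mult.commute mult_1)
  then show ?thesis using False by (simp add: mult.commute)
qed

section \<open>Comparison of polynomial weights\<close>

lemma one_plus_squares_pos: "0 < 1 + x\<^sup>2 + \<omega>\<^sup>2" for x \<omega> :: real
  by (simp add: add_pos_nonneg)

lemma poly_weight_pos: "0 < poly_weight l x \<omega>"
  unfolding poly_weight_def using one_plus_squares_pos[of x \<omega>] by simp

lemma poly_weight_comparable:
  assumes "1 + x\<^sup>2 + \<omega>\<^sup>2 \<le> (1 + y\<^sup>2 + \<eta>\<^sup>2) * D" "1 + y\<^sup>2 + \<eta>\<^sup>2 \<le> (1 + x\<^sup>2 + \<omega>\<^sup>2) * D"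
  shows "poly_weight l x \<omega> \<le> poly_weight l y \<eta> * D powr \<bar>l / 2\<bar>"
proof -
  have "0 < (1 + y\<^sup>2 + \<eta>\<^sup>2) * D"
    using one_plus_squares_pos[of x \<omega>] assms(1) by linarith
  then have "0 < D" using one_plus_squares_pos by (rule zero_less_mult_pos)
  then show ?thesis unfolding poly_weight_def using assms by (intro powr_le_of_comparable one_plus_squares_pos)
qed

lemma square_sum_le: "(u + v)\<^sup>2 \<le> 2 * u\<^sup>2 + 2 * v\<^sup>2" for u v :: real
  using zero_le_power2[of "u - v"] by (simp add: power2_eq_square algebra_simps)

text \<open>Peetre's inequality. Rounding \<open>|l / 2|\<close> up to an integer \<open>L\<close>
  makes the growth factor a polynomial that a kernel of integer order can absorb.\<close>

lemma poly_weight_submultiplicative: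
  fixes l :: real
  defines "L \<equiv> nat \<lceil>\<bar>l / 2\<bar>\<rceil>"
  shows "poly_weight l x \<omega> \<le> poly_weight l y \<theta> * (2 ^ L * (1 + (y - x)\<^sup>2) ^ L * (1 + (\<omega> - \<theta>)\<^sup>2) ^ L)"
proof -
  let ?D = "2 * ((1 + (y - x)\<^sup>2) * (1 + (\<omega> - \<theta>)\<^sup>2))"
  have p: "1 + (y - x)\<^sup>2 + (\<omega> - \<theta>)\<^sup>2 \<le> (1 + (y - x)\<^sup>2) * (1 + (\<omega> - \<theta>)\<^sup>2)"
    by (simp add: algebra_simps)
  have q: "1 \<le> (1 + (y - x)\<^sup>2) * (1 + (\<omega> - \<theta>)\<^sup>2)"
    using p by (smt (verit) zero_le_power2)
  \<comment> \<open>Depends on the two points only through squared differences, so it gives both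
    directions of the comparison.\<close>
  have key: "1 + a\<^sup>2 + b\<^sup>2 \<le> (1 + c\<^sup>2 + d\<^sup>2) * ?D"
    if "(a - c)\<^sup>2 = (y - x)\<^sup>2" "(b - d)\<^sup>2 = (\<omega> - \<theta>)\<^sup>2" for a b c d :: real
  proof -
    have "a\<^sup>2 \<le> 2 * c\<^sup>2 + 2 * (y - x)\<^sup>2" "b\<^sup>2 \<le> 2 * d\<^sup>2 + 2 * (\<omega> - \<theta>)\<^sup>2"
      using square_sum_le[of c "a - c"] square_sum_le[of d "b - d"] that by simp_all
    then have "1 + a\<^sup>2 + b\<^sup>2 \<le> 2 * (c\<^sup>2 + d\<^sup>2) + 2 * (1 + (y - x)\<^sup>2 + (\<omega> - \<theta>)\<^sup>2)" by simp
    also have "\<dots> \<le> (c\<^sup>2 + d\<^sup>2) * ?D + ?D"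
    proof (rule add_mono)
      have "(c\<^sup>2 + d\<^sup>2) * 2 \<le> (c\<^sup>2 + d\<^sup>2) * ?D" using q by (intro mult_left_mono) auto
      then show "2 * (c\<^sup>2 + d\<^sup>2) \<le> (c\<^sup>2 + d\<^sup>2) * ?D" by (simp add: mult.commute)
    qed (use p in simp)
    also have "\<dots> = (1 + c\<^sup>2 + d\<^sup>2) * ?D" by (simp add: distrib_right)
    finally show ?thesis .
  qed
  have "poly_weight l x \<omega> \<le> poly_weight l y \<theta> * ?D powr \<bar>l / 2\<bar>"
    by (intro poly_weight_comparable key) (simp_all add: power2_commute)
  also have "?D powr \<bar>l / 2\<bar> \<le> ?D powr real L"
    unfolding L_def using q by (intro powr_mono) linarith+
  also have "?D powr real L = 2 ^ L * (1 + (y - x)\<^sup>2) ^ L * (1 + (\<omega> - \<theta>)\<^sup>2) ^ L"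
    using q by (subst powr_realpow) (auto simp: power_mult_distrib)
  finally show ?thesis using poly_weight_pos[of l y \<theta>] by (simp add: mult_left_mono)
qed

text \<open>Convexity: the graph of the \<open>r\<close>-th power lies above its tangent at
  \<open>s\<close>. It is obtained from Young's inequality for
  \<open>s powr (1 - r) * a powr r\<close> and \<open>s\<close> with weights \<open>1 / r\<close>
  and \<open>1 - 1 / r\<close>, whose weighted geometric mean is \<open>a\<close>.\<close>

lemma powr_tangent_bound:
  fixes a s r :: real
  assumes "0 \<le> a" "0 < s" "1 \<le> r"
  shows "a \<le> 1 / r * s powr (1 - r) * a powr r + (1 - 1 / r) * s"
proof (cases "a = 0")
  case True
  then show ?thesis using assms by simp
next
  case False
  then have a: "0 < a" using assms by simp
  let ?A = "s powr (1 - r) * a powr r"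
  have "?A powr (1 / r) * s powr (1 - 1 / r) \<le> (1 / r) * ?A + (1 - 1 / r) * s"
    using assms a by (intro Youngs_inequality_0) auto
  moreover have "?A powr (1 / r) * s powr (1 - 1 / r) = a"
  proof -
    have "?A powr (1 / r) * s powr (1 - 1 / r) = a * (s powr ((1 - r) / r) * s powr (1 - 1 / r))"
      using assms a by (simp add: powr_mult powr_powr)
    also have "s powr ((1 - r) / r) * s powr (1 - 1 / r) = s powr ((1 - r) / r + (1 - 1 / r))"
      by (rule powr_add[symmetric])
    also have "(1 - r) / r + (1 - 1 / r) = 0" using assms by (simp add: field_simps)
    finally show ?thesis using assms by simp
  qed
  ultimately show ?thesis by (simp add: mult.assoc)
qed

text \<open>Jensen's inequality for \<open>t \<mapsto> t\<^sup>r\<close>, obtained by integrating the tangent line at the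
  optimal point \<open>v / (K W)\<close>.\<close>

lemma powr_nn_integral_le:
  fixes a w :: "'a \<Rightarrow> real"
  assumes [measurable]: "a \<in> borel_measurable M" "w \<in> borel_measurable M"
    and nonneg: "\<And>x. 0 \<le> a x" "\<And>x. 0 \<le> w x"
    and W: "(\<integral>\<^sup>+x. ennreal (w x) \<partial>M) = ennreal W" "0 < W" and K: "0 < K" and r: "1 \<le> r" and v: "0 \<le> v"
    and le: "ennreal v \<le> ennreal K * (\<integral>\<^sup>+x. ennreal (a x * w x) \<partial>M)"
  shows "ennreal (v powr r) \<le> ennreal (K * (K * W) powr (r - 1)) * (\<integral>\<^sup>+x. ennreal (a x powr r * w x) \<partial>M)"
    (is "_ \<le> _ * ?I")
\<comment> \<open>Here the claim is trivial: the left side is 0 or the right side is infinite.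
  Otherwise \<open>s\<close> below is positive and the computation takes place in the reals.\<close>
proof (cases "v = 0 \<or> ?I = \<infinity>")
  case True
  then show ?thesis using K W by (auto simp: ennreal_mult_top)
next
  case False
  then have v: "0 < v" and I: "?I < \<infinity>" using v by (auto simp: less_top)
  obtain J where J: "?I = ennreal J" "0 \<le> J" using I by (cases ?I) auto
  define s where "s = v / (K * W)"
  have s: "0 < s" unfolding s_def using v K W by simp
  let ?\<alpha> = "1 / r * s powr (1 - r)" and ?\<beta> = "(1 - 1 / r) * s"
  have \<alpha>\<beta>: "0 \<le> ?\<alpha>" "0 \<le> ?\<beta>" using r s by simp_all
  have nn: "0 \<le> ?\<alpha> * J + ?\<beta> * W"
    by (intro add_nonneg_nonneg mult_nonneg_nonneg[OF \<alpha>\<beta>(1) J(2)] mult_nonneg_nonneg[OF \<alpha>\<beta>(2) less_imp_le[OF W(2)]])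
  have "(\<integral>\<^sup>+x. ennreal (a x * w x) \<partial>M) \<le>
      (\<integral>\<^sup>+x. ennreal ?\<alpha> * ennreal (a x powr r * w x) + ennreal ?\<beta> * ennreal (w x) \<partial>M)"
  proof (rule nn_integral_mono)
    fix x
    have "a x * w x \<le> (?\<alpha> * a x powr r + ?\<beta>) * w x"
      using powr_tangent_bound[OF nonneg(1) s r] nonneg(2) by (intro mult_right_mono)
    also have "\<dots> = ?\<alpha> * (a x powr r * w x) + ?\<beta> * w x" by (simp only: distrib_right mult.assoc)
    finally have "ennreal (a x * w x) \<le> ennreal (?\<alpha> * (a x powr r * w x) + ?\<beta> * w x)" by (rule ennreal_leI)
    also have "\<dots> = ennreal ?\<alpha> * ennreal (a x powr r * w x) + ennreal ?\<beta> * ennreal (w x)"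
      using \<alpha>\<beta> nonneg by (simp only: ennreal_plus ennreal_mult mult_nonneg_nonneg powr_ge_zero)
    finally show "ennreal (a x * w x) \<le> ennreal ?\<alpha> * ennreal (a x powr r * w x) + ennreal ?\<beta> * ennreal (w x)" .
  qed
  also have "\<dots> = ennreal ?\<alpha> * ?I + ennreal ?\<beta> * ennreal W"
  proof (subst nn_integral_add)
    show "(\<integral>\<^sup>+x. ennreal ?\<alpha> * ennreal (a x powr r * w x) \<partial>M) + (\<integral>\<^sup>+x. ennreal ?\<beta> * ennreal (w x) \<partial>M) =
        ennreal ?\<alpha> * ?I + ennreal ?\<beta> * ennreal W"
      unfolding W(1)[symmetric] by (intro arg_cong2[where f = plus] nn_integral_cmult) measurable
  qed measurable
  also have "\<dots> = ennreal (?\<alpha> * J + ?\<beta> * W)"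
    unfolding J(1) using \<alpha>\<beta> J(2) W(2)
    by (simp only: ennreal_plus ennreal_mult mult_nonneg_nonneg less_imp_le)
  finally have "ennreal K * (\<integral>\<^sup>+x. ennreal (a x * w x) \<partial>M) \<le> ennreal K * ennreal (?\<alpha> * J + ?\<beta> * W)"
    by (rule mult_left_mono) simp
  with le have "ennreal v \<le> ennreal K * ennreal (?\<alpha> * J + ?\<beta> * W)" by (rule order_trans)
  also have "\<dots> = ennreal (K * (?\<alpha> * J + ?\<beta> * W))"
    using nn K by (intro ennreal_mult[symmetric]) simp_all
  finally have "v \<le> K * (?\<alpha> * J + ?\<beta> * W)"
    using mult_nonneg_nonneg[OF less_imp_le[OF K] nn] by (subst (asm) ennreal_le_iff)
  \<comment> \<open>Since \<open>s * (K * W) = v\<close>, the constant part of the tangent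
    contributes \<open>(1 - 1 / r) * v\<close>, which is absorbed on the left.\<close>
  also have "\<dots> = K * ?\<alpha> * J + (1 - 1 / r) * v"
    unfolding s_def using K W by (simp add: field_simps)
  finally have "1 / r * v \<le> 1 / r * (K * s powr (1 - r) * J)" by (simp add: algebra_simps)
  then have "v \<le> K * s powr (1 - r) * J" using r by (simp only: mult_le_cancel_left_pos divide_pos_pos zero_less_one less_le_trans[OF zero_less_one])
  \<comment> \<open>The factor \<open>s powr (r - 1)\<close> removes \<open>s\<close> from the
    right; with \<open>(K * W) powr (r - 1)\<close> it combines to \<open>v powr (r - 1)\<close> on
    the left.\<close>
  then have "v * s powr (r - 1) \<le> K * s powr (1 - r) * J * s powr (r - 1)"
    by (rule mult_right_mono) simp
  also have "\<dots> = K * J * (s powr (1 - r) * s powr (r - 1))" by (simp only: mult_ac)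
  also have "s powr (1 - r) * s powr (r - 1) = 1" using s by (simp flip: powr_add)
  finally have "v * s powr (r - 1) * (K * W) powr (r - 1) \<le> K * J * 1 * (K * W) powr (r - 1)"
    by (rule mult_right_mono) simp
  moreover have "v * s powr (r - 1) * (K * W) powr (r - 1) = v powr r"
  proof -
    have "s powr (r - 1) * (K * W) powr (r - 1) = (s * (K * W)) powr (r - 1)"
      using s K W by (simp add: powr_mult)
    also have "s * (K * W) = v" unfolding s_def using K W by simp
    finally show ?thesis using v by (simp add: mult.assoc powr_mult_base)
  qed
  ultimately have "v powr r \<le> (K * (K * W) powr (r - 1)) * J" by (simp add: mult_ac)
  then show ?thesis unfolding J(1) using K W J(2) by (subst ennreal_mult[symmetric]) (auto intro: ennreal_leI)
qed

section \<open>Convolution on the time-frequency plane\<close>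

lemma nn_integral_translate:
  fixes f :: "real \<Rightarrow> ennreal"
  assumes "f \<in> borel_measurable borel"
  shows "(\<integral>\<^sup>+x. f (x - c) \<partial>lborel) = (\<integral>\<^sup>+x. f x \<partial>lborel)" "(\<integral>\<^sup>+x. f (c - x) \<partial>lborel) = (\<integral>\<^sup>+x. f x \<partial>lborel)"
  using nn_integral_real_affine[OF assms, of 1 "- c"] nn_integral_real_affine[OF assms, of "-1" c] by simp_all

lemma nn_integral_swap:
  fixes H :: "real \<times> real \<Rightarrow> ennreal"
  assumes [measurable]: "H \<in> borel_measurable (borel \<Otimes>\<^sub>M borel)"
  shows "(\<integral>\<^sup>+\<omega>. (\<integral>\<^sup>+x. H (x, \<omega>) \<partial>lborel) \<partial>lborel) = (\<integral>\<^sup>+x. (\<integral>\<^sup>+\<omega>. H (x, \<omega>) \<partial>lborel) \<partial>lborel)"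
  by (rule lborel_pair.Fubini'[of "\<lambda>x \<omega>. H (x, \<omega>)"]) simp

text \<open>The kernel is a product, so Tonelli and translation invariance remove the time
  convolution and the frequency convolution \<open>?B\<close> separately, each leaving one factor
  \<open>?W\<close>. This is the L1 case of Young's inequality, with equality.\<close>

lemma nn_integral_double_convolution:
  fixes H :: "real \<times> real \<Rightarrow> ennreal" and k :: "real \<Rightarrow> ennreal"
  assumes [measurable]: "H \<in> borel_measurable (borel \<Otimes>\<^sub>M borel)" "k \<in> borel_measurable borel"
  shows "(\<integral>\<^sup>+\<omega>. (\<integral>\<^sup>+x. (\<integral>\<^sup>+y. (\<integral>\<^sup>+\<eta>. H (y, \<omega> - \<eta>) * (k (y - x) * k \<eta>) \<partial>lborel) \<partial>lborel) \<partial>lborel) \<partial>lborel) =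
    (\<integral>\<^sup>+x. k x \<partial>lborel) * (\<integral>\<^sup>+x. k x \<partial>lborel) * (\<integral>\<^sup>+\<omega>. (\<integral>\<^sup>+x. H (x, \<omega>) \<partial>lborel) \<partial>lborel)"
    (is "_ = ?W * ?W * _")
proof -
  let ?B = "\<lambda>(y, \<omega>). \<integral>\<^sup>+\<eta>. H (y, \<omega> - \<eta>) * k \<eta> \<partial>lborel"
  have [measurable]: "?B \<in> borel_measurable (borel \<Otimes>\<^sub>M borel)" by measurable
  have 1: "(\<integral>\<^sup>+\<eta>. H (y, \<omega> - \<eta>) * (k (y - x) * k \<eta>) \<partial>lborel) = ?B (y, \<omega>) * k (y - x)" for x y \<omega>
  proof -
    have "(\<integral>\<^sup>+\<eta>. H (y, \<omega> - \<eta>) * (k (y - x) * k \<eta>) \<partial>lborel) = (\<integral>\<^sup>+\<eta>. H (y, \<omega> - \<eta>) * k \<eta> * k (y - x) \<partial>lborel)"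
      by (intro nn_integral_cong) (simp only: mult_ac)
    also have "\<dots> = (\<integral>\<^sup>+\<eta>. H (y, \<omega> - \<eta>) * k \<eta> \<partial>lborel) * k (y - x)"
      by (rule nn_integral_multc) measurable
    finally show ?thesis by simp
  qed
  have 2: "(\<integral>\<^sup>+x. (\<integral>\<^sup>+y. ?B (y, \<omega>) * k (y - x) \<partial>lborel) \<partial>lborel) = ?W * (\<integral>\<^sup>+y. ?B (y, \<omega>) \<partial>lborel)" for \<omega>
  proof -
    have "(\<integral>\<^sup>+x. (\<integral>\<^sup>+y. ?B (y, \<omega>) * k (y - x) \<partial>lborel) \<partial>lborel) =
        (\<integral>\<^sup>+y. (\<integral>\<^sup>+x. ?B (y, \<omega>) * k (y - x) \<partial>lborel) \<partial>lborel)"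
      by (rule lborel_pair.Fubini') measurable
    also have "\<dots> = (\<integral>\<^sup>+y. ?B (y, \<omega>) * ?W \<partial>lborel)"
    proof (rule nn_integral_cong)
      fix y
      have "(\<integral>\<^sup>+x. ?B (y, \<omega>) * k (y - x) \<partial>lborel) = ?B (y, \<omega>) * (\<integral>\<^sup>+x. k (y - x) \<partial>lborel)"
        by (rule nn_integral_cmult) measurable
      also have "(\<integral>\<^sup>+x. k (y - x) \<partial>lborel) = ?W"
        by (rule nn_integral_translate(2)) measurable
      finally show "(\<integral>\<^sup>+x. ?B (y, \<omega>) * k (y - x) \<partial>lborel) = ?B (y, \<omega>) * ?W" .
    qed
    also have "\<dots> = (\<integral>\<^sup>+y. ?B (y, \<omega>) \<partial>lborel) * ?W"
      by (rule nn_integral_multc) measurable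
    finally show ?thesis by (simp only: mult.commute[of ?W])
  qed
  have 3: "(\<integral>\<^sup>+\<omega>. (\<integral>\<^sup>+y. ?B (y, \<omega>) \<partial>lborel) \<partial>lborel) = ?W * (\<integral>\<^sup>+\<omega>. (\<integral>\<^sup>+x. H (x, \<omega>) \<partial>lborel) \<partial>lborel)"
  proof -
    have "(\<integral>\<^sup>+\<omega>. (\<integral>\<^sup>+y. ?B (y, \<omega>) \<partial>lborel) \<partial>lborel) = (\<integral>\<^sup>+y. (\<integral>\<^sup>+\<omega>. ?B (y, \<omega>) \<partial>lborel) \<partial>lborel)"
      by (rule nn_integral_swap) measurable
    also have "\<dots> = (\<integral>\<^sup>+y. (\<integral>\<^sup>+\<eta>. (\<integral>\<^sup>+\<omega>. H (y, \<omega> - \<eta>) * k \<eta> \<partial>lborel) \<partial>lborel) \<partial>lborel)"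
    proof (rule nn_integral_cong)
      fix y
      show "(\<integral>\<^sup>+\<omega>. ?B (y, \<omega>) \<partial>lborel) = (\<integral>\<^sup>+\<eta>. (\<integral>\<^sup>+\<omega>. H (y, \<omega> - \<eta>) * k \<eta> \<partial>lborel) \<partial>lborel)"
        unfolding prod.case by (rule lborel_pair.Fubini') measurable
    qed
    also have "\<dots> = (\<integral>\<^sup>+y. (\<integral>\<^sup>+\<eta>. (\<integral>\<^sup>+\<omega>. H (y, \<omega>) \<partial>lborel) * k \<eta> \<partial>lborel) \<partial>lborel)"
    proof (intro nn_integral_cong)
      fix y \<eta>
      have "(\<integral>\<^sup>+\<omega>. H (y, \<omega> - \<eta>) * k \<eta> \<partial>lborel) = (\<integral>\<^sup>+\<omega>. H (y, \<omega> - \<eta>) \<partial>lborel) * k \<eta>"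
        by (rule nn_integral_multc) measurable
      also have "(\<integral>\<^sup>+\<omega>. H (y, \<omega> - \<eta>) \<partial>lborel) = (\<integral>\<^sup>+\<omega>. H (y, \<omega>) \<partial>lborel)"
        by (rule nn_integral_translate(1)) measurable
      finally show "(\<integral>\<^sup>+\<omega>. H (y, \<omega> - \<eta>) * k \<eta> \<partial>lborel) = (\<integral>\<^sup>+\<omega>. H (y, \<omega>) \<partial>lborel) * k \<eta>" .
    qed
    also have "\<dots> = (\<integral>\<^sup>+y. (\<integral>\<^sup>+\<omega>. H (y, \<omega>) \<partial>lborel) * ?W \<partial>lborel)"
      by (intro nn_integral_cong nn_integral_cmult) measurable
    also have "\<dots> = (\<integral>\<^sup>+y. (\<integral>\<^sup>+\<omega>. H (y, \<omega>) \<partial>lborel) \<partial>lborel) * ?W"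
      by (rule nn_integral_multc) measurable
    finally show ?thesis by (simp only: nn_integral_swap[OF assms(1)] mult.commute[of ?W])
  qed
  have [measurable]: "(\<lambda>\<omega>. \<integral>\<^sup>+y. ?B (y, \<omega>) \<partial>lborel) \<in> borel_measurable borel" by measurable
  show ?thesis unfolding 1 2
    by (subst nn_integral_cmult) (simp_all only: 3 mult.assoc, measurable)
qed

section \<open>Finiteness of the norm for every window\<close>

definition modulation_norm :: "real \<Rightarrow> real \<Rightarrow> (real \<Rightarrow> real \<Rightarrow> complex) \<Rightarrow> ennreal" where
  "modulation_norm r l F = (\<integral>\<^sup>+\<omega>. (\<integral>\<^sup>+x. ennreal (norm (F x \<omega>) powr r * poly_weight l x \<omega> powr r) \<partial>lborel) \<partial>lborel)"

lemma modulation_space_iff: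
  "T \<in> modulation_space r (poly_weight l) g \<longleftrightarrow> T \<in> tempered \<and> modulation_norm r l (stft g T) < \<infinity>"
  unfolding modulation_space_def modulation_norm_def by simp

lemma borel_measurable_poly_weight [measurable]:
  "(\<lambda>p. poly_weight l (fst p) (snd p)) \<in> borel_measurable (borel \<Otimes>\<^sub>M borel)"
  unfolding poly_weight_def by measurable

text \<open>Of the \<open>Suc L\<close> powers in the kernel, \<open>L\<close> cancel the growth
  from Peetre's inequality and the last one leaves an integrable kernel. Jensen's inequality moves
  the power \<open>r\<close> inside, which reduces Young's inequality to its L1 case.\<close>

lemma modulation_norm_change_window:
  assumes r: "1 \<le> r" and T: "T \<in> tempered" and g: "g \<in> schwartz" "g \<noteq> (\<lambda>t. 0)" and h: "h \<in> schwartz"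
    and fin: "modulation_norm r l (stft g T) < \<infinity>"
  shows "modulation_norm r l (stft h T) < \<infinity>"
proof -
  define L where "L = nat \<lceil>\<bar>l / 2\<bar>\<rceil>"
  obtain C where C: "0 \<le> C" "\<And>x \<omega>. ennreal (norm (stft h T x \<omega>)) \<le> ennreal C *
    (\<integral>\<^sup>+y. (\<integral>\<^sup>+\<eta>. ennreal (norm (stft g T y (\<omega> - \<eta>)) * kernel (Suc L) (y - x) \<eta>) \<partial>lborel) \<partial>lborel)"
    using stft_change_window[OF T g h, of "Suc L"] by blast
  define a where "a = (\<lambda>p. norm (stft g T (fst p) (snd p)) * poly_weight l (fst p) (snd p))"
  have [measurable]: "(\<lambda>p. stft g T (fst p) (snd p)) \<in> borel_measurable (borel \<Otimes>\<^sub>M borel)"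
    using T g(1) by (rule borel_measurable_stft)
  have a [measurable]: "a \<in> borel_measurable (borel \<Otimes>\<^sub>M borel)" unfolding a_def by measurable
  have a_nonneg: "0 \<le> a p" for p
    unfolding a_def using poly_weight_pos[of l] by (simp add: less_imp_le)
  define \<kappa> where "\<kappa> = (\<lambda>u::real. 1 / (1 + u\<^sup>2))"
  have [measurable]: "\<kappa> \<in> borel_measurable borel" unfolding \<kappa>_def by measurable
  have \<kappa>_nonneg: "0 \<le> \<kappa> u" for u unfolding \<kappa>_def by simp
  have \<kappa>_int: "(\<integral>\<^sup>+u. ennreal (\<kappa> u) \<partial>lborel) = ennreal pi"
    using integrable_inverse_one_plus_square integral_inverse_one_plus_square
    unfolding \<kappa>_def by (subst nn_integral_eq_integral) auto
  \<comment> \<open>\<open>2 ^ L\<close> is the constant of Peetre's inequality; adding 1 makes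
    \<open>K\<close> positive even if \<open>C\<close> is 0, as Jensen's inequality above
    requires.\<close>
  define K where "K = C * 2 ^ L + 1"
  have K: "0 < K" unfolding K_def using C(1) by (simp add: add_nonneg_pos)
  have point: "ennreal ((norm (stft h T x \<omega>) * poly_weight l x \<omega>) powr r) \<le> ennreal (K * (K * (pi * pi)) powr (r - 1)) *
      (\<integral>\<^sup>+y. (\<integral>\<^sup>+\<eta>. ennreal (a (y, \<omega> - \<eta>) powr r) * (ennreal (\<kappa> (y - x)) * ennreal (\<kappa> \<eta>)) \<partial>lborel) \<partial>lborel)" for x \<omega>
  proof -
    let ?a = "\<lambda>p. a (fst p, \<omega> - snd p)" and ?w = "\<lambda>p. \<kappa> (fst p - x) * \<kappa> (snd p)"
    let ?m = "poly_weight l x \<omega>"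
    have m: "0 < ?m" by (rule poly_weight_pos)
    have ptw: "?m * (norm (stft g T y (\<omega> - \<eta>)) * kernel (Suc L) (y - x) \<eta>)
        \<le> 2 ^ L * (a (y, \<omega> - \<eta>) * (\<kappa> (y - x) * \<kappa> \<eta>))" for y \<eta>
    proof -
      let ?u = "1 + (y - x)\<^sup>2" and ?n = "1 + \<eta>\<^sup>2"
      have pos: "0 < ?u" "0 < ?n" by (rule one_plus_square_pos)+
      have "?m * (norm (stft g T y (\<omega> - \<eta>)) * (1 / ?u ^ Suc L * (1 / ?n ^ Suc L))) \<le>
          (poly_weight l y (\<omega> - \<eta>) * (2 ^ L * ?u ^ L * ?n ^ L)) *
          (norm (stft g T y (\<omega> - \<eta>)) * (1 / ?u ^ Suc L * (1 / ?n ^ Suc L)))"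
        using poly_weight_submultiplicative[of l x \<omega> y "\<omega> - \<eta>"] pos
        by (intro mult_right_mono) (auto simp: L_def)
      also have "\<dots> = 2 ^ L * (a (y, \<omega> - \<eta>) * ((?u ^ L / ?u ^ Suc L) * (?n ^ L / ?n ^ Suc L)))"
        by (simp add: a_def)
      also have "?u ^ L / ?u ^ Suc L = \<kappa> (y - x)" unfolding \<kappa>_def using pos by simp
      also have "?n ^ L / ?n ^ Suc L = \<kappa> \<eta>" unfolding \<kappa>_def using pos by simp
      finally show ?thesis .
    qed
    have "ennreal (norm (stft h T x \<omega>) * ?m) = ennreal ?m * ennreal (norm (stft h T x \<omega>))"
      using m by (simp add: ennreal_mult mult.commute)
    also have "\<dots> \<le> ennreal ?m * (ennreal C *
      (\<integral>\<^sup>+y. (\<integral>\<^sup>+\<eta>. ennreal (norm (stft g T y (\<omega> - \<eta>)) * kernel (Suc L) (y - x) \<eta>) \<partial>lborel) \<partial>lborel))"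
      by (intro mult_left_mono C(2)) simp
    also have "\<dots> = ennreal C * (\<integral>\<^sup>+y. (\<integral>\<^sup>+\<eta>. ennreal ?m *
        ennreal (norm (stft g T y (\<omega> - \<eta>)) * kernel (Suc L) (y - x) \<eta>) \<partial>lborel) \<partial>lborel)"
    proof -
      note borel_measurable_stft_reflect[OF T g(1), measurable]
      show ?thesis by (simp add: nn_integral_cmult mult.left_commute)
    qed
    also have "\<dots> \<le> ennreal C * (\<integral>\<^sup>+y. (\<integral>\<^sup>+\<eta>. ennreal (2 ^ L) * ennreal (a (y, \<omega> - \<eta>) * (\<kappa> (y - x) * \<kappa> \<eta>)) \<partial>lborel) \<partial>lborel)"
    proof (intro mult_left_mono nn_integral_mono)
      fix y \<eta>
      show "ennreal ?m * ennreal (norm (stft g T y (\<omega> - \<eta>)) * kernel (Suc L) (y - x) \<eta>)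
        \<le> ennreal (2 ^ L) * ennreal (a (y, \<omega> - \<eta>) * (\<kappa> (y - x) * \<kappa> \<eta>))"
        using ennreal_leI[OF ptw[of y \<eta>]] m a_nonneg \<kappa>_nonneg
        by (subst (1 2) ennreal_mult[symmetric]) (auto simp: one_plus_square_nonneg)
    qed simp
    also have "\<dots> = ennreal C * (ennreal (2 ^ L) * (\<integral>\<^sup>+y. (\<integral>\<^sup>+\<eta>. ennreal (a (y, \<omega> - \<eta>) * (\<kappa> (y - x) * \<kappa> \<eta>)) \<partial>lborel) \<partial>lborel))"
      by (simp add: nn_integral_cmult)
    also have "\<dots> = ennreal (C * 2 ^ L) * (\<integral>\<^sup>+p. ennreal (?a p * ?w p) \<partial>(lborel \<Otimes>\<^sub>M lborel))"
      using C(1) by (subst lborel.nn_integral_fst[symmetric]) (auto simp: ennreal_mult mult.assoc)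
    also have "\<dots> \<le> ennreal K * (\<integral>\<^sup>+p. ennreal (?a p * ?w p) \<partial>(lborel \<Otimes>\<^sub>M lborel))"
      unfolding K_def by (intro mult_right_mono ennreal_leI) auto
    finally have le: "ennreal (norm (stft h T x \<omega>) * ?m) \<le> ennreal K * (\<integral>\<^sup>+p. ennreal (?a p * ?w p) \<partial>(lborel \<Otimes>\<^sub>M lborel))" .
    have W: "(\<integral>\<^sup>+p. ennreal (?w p) \<partial>(lborel \<Otimes>\<^sub>M lborel)) = ennreal (pi * pi)"
    proof -
      have "(\<integral>\<^sup>+p. ennreal (?w p) \<partial>(lborel \<Otimes>\<^sub>M lborel)) =
          (\<integral>\<^sup>+y. (\<integral>\<^sup>+\<eta>. ennreal (\<kappa> (y - x)) * ennreal (\<kappa> \<eta>) \<partial>lborel) \<partial>lborel)"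
        using \<kappa>_nonneg by (subst lborel.nn_integral_fst[symmetric]) (auto simp: ennreal_mult)
      also have "\<dots> = (\<integral>\<^sup>+y. ennreal (\<kappa> (y - x)) \<partial>lborel) * ennreal pi"
        by (simp add: nn_integral_cmult nn_integral_multc \<kappa>_int)
      also have "(\<integral>\<^sup>+y. ennreal (\<kappa> (y - x)) \<partial>lborel) = ennreal pi"
        using nn_integral_translate(1)[of "\<lambda>y. ennreal (\<kappa> y)" x] \<kappa>_int by simp
      finally show ?thesis by (simp flip: ennreal_mult)
    qed
    have "ennreal ((norm (stft h T x \<omega>) * ?m) powr r) \<le> ennreal (K * (K * (pi * pi)) powr (r - 1)) *
        (\<integral>\<^sup>+p. ennreal (?a p powr r * ?w p) \<partial>(lborel \<Otimes>\<^sub>M lborel))"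
      using m K r a_nonneg \<kappa>_nonneg by (intro powr_nn_integral_le[OF _ _ _ _ W _ _ _ _ le]) auto
    also have "(\<integral>\<^sup>+p. ennreal (?a p powr r * ?w p) \<partial>(lborel \<Otimes>\<^sub>M lborel)) =
        (\<integral>\<^sup>+y. (\<integral>\<^sup>+\<eta>. ennreal (a (y, \<omega> - \<eta>) powr r) * (ennreal (\<kappa> (y - x)) * ennreal (\<kappa> \<eta>)) \<partial>lborel) \<partial>lborel)"
      using \<kappa>_nonneg by (subst lborel.nn_integral_fst[symmetric]) (auto simp: ennreal_mult)
    finally show ?thesis .
  qed
  let ?c = "ennreal (K * (K * (pi * pi)) powr (r - 1))"
  let ?G = "\<lambda>x \<omega>. \<integral>\<^sup>+y. (\<integral>\<^sup>+\<eta>. ennreal (a (y, \<omega> - \<eta>) powr r) * (ennreal (\<kappa> (y - x)) * ennreal (\<kappa> \<eta>)) \<partial>lborel) \<partial>lborel"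
  have "modulation_norm r l (stft h T) \<le> (\<integral>\<^sup>+\<omega>. (\<integral>\<^sup>+x. ?c * ?G x \<omega> \<partial>lborel) \<partial>lborel)"
    unfolding modulation_norm_def using point poly_weight_pos[of l]
    by (intro nn_integral_mono) (simp add: powr_mult less_imp_le)
  also have "\<dots> = ?c * (\<integral>\<^sup>+\<omega>. (\<integral>\<^sup>+x. ?G x \<omega> \<partial>lborel) \<partial>lborel)"
    by (simp add: nn_integral_cmult)
  also have "(\<integral>\<^sup>+\<omega>. (\<integral>\<^sup>+x. ?G x \<omega> \<partial>lborel) \<partial>lborel) =
      ennreal pi * ennreal pi * (\<integral>\<^sup>+\<omega>. (\<integral>\<^sup>+x. ennreal (a (x, \<omega>) powr r) \<partial>lborel) \<partial>lborel)"
    using nn_integral_double_convolution[of "\<lambda>p. ennreal (a p powr r)" "\<lambda>u. ennreal (\<kappa> u)"] \<kappa>_int by simp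
  also have "(\<integral>\<^sup>+\<omega>. (\<integral>\<^sup>+x. ennreal (a (x, \<omega>) powr r) \<partial>lborel) \<partial>lborel) = modulation_norm r l (stft g T)"
    unfolding modulation_norm_def a_def using poly_weight_pos[of l]
    by (simp add: powr_mult less_imp_le)
  also have "?c * (ennreal pi * ennreal pi * modulation_norm r l (stft g T)) < \<infinity>"
    using fin by (simp add: ennreal_mult_less_top)
  finally show ?thesis .
qed

section \<open>Invariance under the factors of the transform\<close>

text \<open>The factors act, up to phases, by measure-preserving substitutions of the plane.
  Comparability of the quadratic expressions in both directions makes the weights comparable
  whatever the sign of \<open>l\<close>.\<close>

lemma modulation_norm_transfer:
  fixes F G :: "real \<Rightarrow> real \<Rightarrow> complex" and u v :: "real \<Rightarrow> real \<Rightarrow> real"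
  assumes r: "1 \<le> r" and G: "(\<lambda>p. G (fst p) (snd p)) \<in> borel_measurable (borel \<Otimes>\<^sub>M borel)"
    and F: "\<And>x \<omega>. norm (F x \<omega>) = norm (G (u x \<omega>) (v x \<omega>))"
    and D: "\<And>x \<omega>. 1 + x\<^sup>2 + \<omega>\<^sup>2 \<le> (1 + (u x \<omega>)\<^sup>2 + (v x \<omega>)\<^sup>2) * D"
      "\<And>x \<omega>. 1 + (u x \<omega>)\<^sup>2 + (v x \<omega>)\<^sup>2 \<le> (1 + x\<^sup>2 + \<omega>\<^sup>2) * D"
    and [measurable]: "(\<lambda>p. u (fst p) (snd p)) \<in> borel_measurable (borel \<Otimes>\<^sub>M borel)"
      "(\<lambda>p. v (fst p) (snd p)) \<in> borel_measurable (borel \<Otimes>\<^sub>M borel)"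
    and subst: "\<And>H. H \<in> borel_measurable (borel \<Otimes>\<^sub>M borel) \<Longrightarrow>
      (\<integral>\<^sup>+\<omega>. (\<integral>\<^sup>+x. H (u x \<omega>, v x \<omega>) \<partial>lborel) \<partial>lborel) = (\<integral>\<^sup>+\<omega>. (\<integral>\<^sup>+x. H (x, \<omega>) \<partial>lborel) \<partial>lborel)"
    and fin: "modulation_norm r l G < \<infinity>"
  shows "modulation_norm r l F < \<infinity>"
proof -
  define H where "H = (\<lambda>p. ennreal (norm (G (fst p) (snd p)) powr r * poly_weight l (fst p) (snd p) powr r))"
  have H [measurable]: "H \<in> borel_measurable (borel \<Otimes>\<^sub>M borel)"
    unfolding H_def using G by measurable
  have [measurable]: "(\<lambda>p. (u (fst p) (snd p), v (fst p) (snd p))) \<in> borel \<Otimes>\<^sub>M borel \<rightarrow>\<^sub>M borel \<Otimes>\<^sub>M borel"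
    by measurable
  have m [measurable]: "(\<lambda>p. H (u (fst p) (snd p), v (fst p) (snd p))) \<in> borel_measurable (borel \<Otimes>\<^sub>M borel)"
    using measurable_compose[OF \<open>(\<lambda>p. (u (fst p) (snd p), v (fst p) (snd p))) \<in> _\<close> H] .
  let ?c = "(D powr \<bar>l / 2\<bar>) powr r"
  have "ennreal (norm (F x \<omega>) powr r * poly_weight l x \<omega> powr r) \<le> ennreal ?c * H (u x \<omega>, v x \<omega>)" for x \<omega>
  proof -
    have "poly_weight l x \<omega> powr r \<le> (poly_weight l (u x \<omega>) (v x \<omega>) * D powr \<bar>l / 2\<bar>) powr r"
      using r poly_weight_pos[of l x \<omega>] by (intro powr_mono2 poly_weight_comparable D) auto
    also have "\<dots> = poly_weight l (u x \<omega>) (v x \<omega>) powr r * ?c"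
      by (rule powr_mult)
    finally have "norm (F x \<omega>) powr r * poly_weight l x \<omega> powr r \<le>
        norm (G (u x \<omega>) (v x \<omega>)) powr r * (poly_weight l (u x \<omega>) (v x \<omega>) powr r * ?c)"
      unfolding F by (rule mult_left_mono) simp
    then show ?thesis
      unfolding H_def by (simp add: ennreal_leI mult_ac flip: ennreal_mult)
  qed
  then have "modulation_norm r l F \<le> (\<integral>\<^sup>+\<omega>. (\<integral>\<^sup>+x. ennreal ?c * H (u x \<omega>, v x \<omega>) \<partial>lborel) \<partial>lborel)"
    unfolding modulation_norm_def by (intro nn_integral_mono)
  also have "\<dots> = ennreal ?c * (\<integral>\<^sup>+\<omega>. (\<integral>\<^sup>+x. H (u x \<omega>, v x \<omega>) \<partial>lborel) \<partial>lborel)"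
  proof -
    \<comment> \<open>The variable integrated first is put second, so that measurability of the
      inner integral as a function of \<omega> is available.\<close>
    define Q where "Q = (\<lambda>(\<omega>, x). H (u x \<omega>, v x \<omega>))"
    have [measurable]: "Q \<in> borel_measurable (borel \<Otimes>\<^sub>M borel)"
      unfolding Q_def case_prod_beta'
      using measurable_compose[OF measurable_Pair[OF measurable_snd measurable_fst] m]
      by (simp only: fst_conv snd_conv)
    have "(\<integral>\<^sup>+\<omega>. (\<integral>\<^sup>+x. ennreal ?c * Q (\<omega>, x) \<partial>lborel) \<partial>lborel) =
        (\<integral>\<^sup>+\<omega>. ennreal ?c * (\<integral>\<^sup>+x. Q (\<omega>, x) \<partial>lborel) \<partial>lborel)"
      by (intro nn_integral_cong nn_integral_cmult) measurable
    also have "\<dots> = ennreal ?c * (\<integral>\<^sup>+\<omega>. (\<integral>\<^sup>+x. Q (\<omega>, x) \<partial>lborel) \<partial>lborel)"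
      by (rule nn_integral_cmult) measurable
    finally show ?thesis unfolding Q_def prod.case .
  qed
  also have "(\<integral>\<^sup>+\<omega>. (\<integral>\<^sup>+x. H (u x \<omega>, v x \<omega>) \<partial>lborel) \<partial>lborel) = modulation_norm r l G"
    unfolding subst[OF H] by (simp add: H_def modulation_norm_def)
  also have "ennreal ?c * modulation_norm r l G < \<infinity>"
    using fin by (simp add: ennreal_mult_less_top)
  finally show ?thesis .
qed

text \<open>Each factor of the transform replaces the window by another one; demanding all windows
  makes the predicate stable under composition.\<close>

definition in_modulation_space :: "real \<Rightarrow> real \<Rightarrow> ((real \<Rightarrow> complex) \<Rightarrow> complex) \<Rightarrow> bool" where
  "in_modulation_space r l T \<longleftrightarrow> T \<in> tempered \<and> (\<forall>h\<in>schwartz. modulation_norm r l (stft h T) < \<infinity>)"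

section \<open>Covariance of the short-time Fourier transform\<close>

lemma stft_dist_chirp:
  assumes T: "T \<in> tempered" and g: "g \<in> schwartz"
  shows "stft g (dist_chirp s T) x \<omega> = cis (- pi * s * x\<^sup>2) * stft (chirp (- s) g) T x (\<omega> - s * x)"
proof -
  let ?\<phi> = "\<lambda>t. cnj (chirp (- s) g (t - x)) * cis (- 2 * pi * (\<omega> - s * x) * t)"
  have "chirp s (\<lambda>t. cnj (g (t - x)) * cis (- 2 * pi * \<omega> * t)) = (\<lambda>t. cis (- pi * s * x\<^sup>2) * ?\<phi> t)"
  proof
    fix t
    \<comment> \<open>Completing the square around \<open>x\<close>: the quadratic term goes to the
      window, with opposite sign because the window is conjugated; the cross term shears the
      frequency, and a phase independent of \<open>t\<close> remains.\<close>
    have "pi * s * t\<^sup>2 + - 2 * pi * \<omega> * t = - pi * s * x\<^sup>2 + (pi * s * (t - x)\<^sup>2 + - 2 * pi * (\<omega> - s * x) * t)"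
      by (simp add: power2_eq_square algebra_simps)
    then have 1: "cis (pi * s * t\<^sup>2) * cis (- 2 * pi * \<omega> * t) =
        cis (- pi * s * x\<^sup>2) * (cis (pi * s * (t - x)\<^sup>2) * cis (- 2 * pi * (\<omega> - s * x) * t))"
      by (simp only: cis_mult)
    have 2: "cnj (chirp (- s) g (t - x)) = cis (pi * s * (t - x)\<^sup>2) * cnj (g (t - x))"
      by (simp add: chirp_def cis_cnj)
    have "chirp s (\<lambda>t. cnj (g (t - x)) * cis (- 2 * pi * \<omega> * t)) t =
        cnj (g (t - x)) * (cis (pi * s * t\<^sup>2) * cis (- 2 * pi * \<omega> * t))"
      unfolding chirp_def by (rule mult.left_commute)
    also have "\<dots> = cis (- pi * s * x\<^sup>2) * ?\<phi> t"
      unfolding 1 2 by (simp only: mult_ac)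
    finally show "chirp s (\<lambda>t. cnj (g (t - x)) * cis (- 2 * pi * \<omega> * t)) t = cis (- pi * s * x\<^sup>2) * ?\<phi> t" .
  qed
  moreover have "?\<phi> \<in> schwartz" using schwartz_stft_atom[OF schwartz_chirp[OF g]] .
  ultimately show ?thesis
    unfolding stft_def dist_chirp_def dist_transpose_def
    using schwartz_stft_atom[OF g] tempered_scale[OF T] by (simp only: restrict_apply if_True)
qed

lemma stft_dist_modulation:
  assumes g: "g \<in> schwartz"
  shows "stft g (dist_modulation s T) x \<omega> = stft g T x (\<omega> - s)"
proof -
  have "modulation s (\<lambda>t. cnj (g (t - x)) * cis (- 2 * pi * \<omega> * t)) = (\<lambda>t. cnj (g (t - x)) * cis (- 2 * pi * (\<omega> - s) * t))"
  proof
    fix t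
    have "2 * pi * s * t + - 2 * pi * \<omega> * t = - 2 * pi * (\<omega> - s) * t" by (simp add: algebra_simps)
    then show "modulation s (\<lambda>t. cnj (g (t - x)) * cis (- 2 * pi * \<omega> * t)) t = cnj (g (t - x)) * cis (- 2 * pi * (\<omega> - s) * t)"
      by (simp only: modulation_def mult.left_commute[of "cis _" "cnj _"] cis_mult)
  qed
  then show ?thesis
    unfolding stft_def dist_modulation_def dist_transpose_def
    using schwartz_stft_atom[OF g] by (simp only: restrict_apply if_True)
qed

lemma stft_dist_dilation:
  assumes g: "g \<in> schwartz" and s: "s \<noteq> 0"
  shows "stft g (dist_dilation s T) x \<omega> = stft (dilation (1 / s) g) T (x / s) (s * \<omega>)"
proof -
  have "dilation (1 / s) (\<lambda>t. cnj (g (t - x)) * cis (- 2 * pi * \<omega> * t)) =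
      (\<lambda>t. cnj (dilation (1 / s) g (t - x / s)) * cis (- 2 * pi * (s * \<omega>) * t))"
    using s by (auto simp: dilation_def algebra_simps)
  then show ?thesis
    unfolding stft_def dist_dilation_def dist_transpose_def
    using schwartz_stft_atom[OF g] by (simp only: restrict_apply if_True)
qed

text \<open>The new window is the inverse Fourier transform of \<open>g\<close>, written with
  conjugations, and the plane turns by a quarter.\<close>

lemma stft_dist_fourier:
  assumes T: "T \<in> tempered" and g: "g \<in> schwartz"
  shows "stft g (dist_fourier T) x \<omega> =
    cis (- 2 * pi * \<omega> * x) * stft (\<lambda>t. cnj (fourier (\<lambda>t. cnj (g t)) t)) T (- \<omega>) x"
proof -
  let ?g = "\<lambda>t. cnj (fourier (\<lambda>t. cnj (g t)) t)"
  let ?\<phi> = "\<lambda>t. cnj (?g (t - - \<omega>)) * cis (- 2 * pi * x * t)"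
  have "?g \<in> schwartz" using g by (intro schwartz_cnj schwartz_fourier)
  then have \<phi>: "?\<phi> \<in> schwartz" by (rule schwartz_stft_atom)
  have "fourier (\<lambda>t. cnj (g (t - x)) * cis (- 2 * pi * \<omega> * t)) = (\<lambda>\<xi>. cis (- 2 * pi * \<omega> * x) * ?\<phi> \<xi>)"
  proof
    fix \<xi>
    have "fourier (\<lambda>t. cnj (g (t - x)) * cis (- 2 * pi * \<omega> * t)) \<xi> = fourier (\<lambda>t. cnj (g (t - x))) (\<xi> + \<omega>)"
      by (rule fourier_mult_cis)
    also have "\<dots> = cis (- 2 * pi * (\<xi> + \<omega>) * x) * fourier (\<lambda>t. cnj (g t)) (\<xi> + \<omega>)"
      by (rule fourier_translate)
    also have "- 2 * pi * (\<xi> + \<omega>) * x = - 2 * pi * \<omega> * x + - 2 * pi * x * \<xi>" by (simp add: algebra_simps)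
    also have "cis (- 2 * pi * \<omega> * x + - 2 * pi * x * \<xi>) * fourier (\<lambda>t. cnj (g t)) (\<xi> + \<omega>) =
        cis (- 2 * pi * \<omega> * x) * ?\<phi> \<xi>"
      by (simp only: cis_mult[symmetric] complex_cnj_cnj diff_minus_eq_add mult_ac)
    finally show "fourier (\<lambda>t. cnj (g (t - x)) * cis (- 2 * pi * \<omega> * t)) \<xi> = cis (- 2 * pi * \<omega> * x) * ?\<phi> \<xi>" .
  qed
  then show ?thesis
    unfolding stft_def dist_fourier_def dist_transpose_def
    using schwartz_stft_atom[OF g] tempered_scale[OF T \<phi>] by (simp only: restrict_apply if_True)
qed

text \<open>The hypothesis admits both \<open>v = s * x\<close>, for the chirp, and the constant
  \<open>v = s\<close>, for the modulation, as well as their negatives.\<close>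

lemma shear_square_le:
  fixes x \<omega> s v :: real
  assumes "v\<^sup>2 \<le> s\<^sup>2 * (1 + x\<^sup>2)"
  shows "1 + x\<^sup>2 + (\<omega> + v)\<^sup>2 \<le> (1 + x\<^sup>2 + \<omega>\<^sup>2) * (2 + 2 * s\<^sup>2)"
proof -
  have "(\<omega> + v)\<^sup>2 \<le> 2 * \<omega>\<^sup>2 + 2 * v\<^sup>2" by (rule square_sum_le)
  moreover have "0 \<le> s\<^sup>2 * \<omega>\<^sup>2" "0 \<le> x\<^sup>2" by simp_all
  moreover have "(1 + x\<^sup>2 + \<omega>\<^sup>2) * (2 + 2 * s\<^sup>2) =
      2 + 2 * x\<^sup>2 + 2 * \<omega>\<^sup>2 + 2 * (s\<^sup>2 * (1 + x\<^sup>2)) + 2 * (s\<^sup>2 * \<omega>\<^sup>2)"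
    by (simp add: algebra_simps)
  ultimately show ?thesis using assms by linarith
qed

section \<open>Stability under each factor\<close>

lemma in_modulation_spaceD:
  assumes "in_modulation_space r l T"
  shows "T \<in> tempered" "\<And>h. h \<in> schwartz \<Longrightarrow> modulation_norm r l (stft h T) < \<infinity>"
  using assms unfolding in_modulation_space_def by auto

text \<open>For fixed \<open>x\<close> the shear is a translation of the frequency, so it disappears
  once the frequency is integrated first.\<close>

lemma in_modulation_space_chirp:
  assumes r: "1 \<le> r" and T: "in_modulation_space r l T"
  shows "in_modulation_space r l (dist_chirp s T)"
  unfolding in_modulation_space_def
proof (intro conjI ballI)
  note fin = in_modulation_spaceD(2)[OF T] and T = in_modulation_spaceD(1)[OF T]
  show "dist_chirp s T \<in> tempered" using T by (rule tempered_dist_chirp)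
  fix h assume h: "h \<in> schwartz"
  then have h': "chirp (- s) h \<in> schwartz" by (rule schwartz_chirp)
  show "modulation_norm r l (stft h (dist_chirp s T)) < \<infinity>"
  proof (rule modulation_norm_transfer[OF r borel_measurable_stft[OF T h'], where u = "\<lambda>x \<omega>. x" and v = "\<lambda>x \<omega>. \<omega> - s * x" and D = "2 + 2 * s\<^sup>2"])
    show "norm (stft h (dist_chirp s T) x \<omega>) = norm (stft (chirp (- s) h) T x (\<omega> - s * x))" for x \<omega>
      by (simp add: stft_dist_chirp[OF T h] norm_mult)
    show "1 + x\<^sup>2 + \<omega>\<^sup>2 \<le> (1 + x\<^sup>2 + (\<omega> - s * x)\<^sup>2) * (2 + 2 * s\<^sup>2)" for x \<omega>
      using shear_square_le[of "s * x" s x "\<omega> - s * x"] by (simp add: power_mult_distrib distrib_left)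
    show "1 + x\<^sup>2 + (\<omega> - s * x)\<^sup>2 \<le> (1 + x\<^sup>2 + \<omega>\<^sup>2) * (2 + 2 * s\<^sup>2)" for x \<omega>
      using shear_square_le[of "- (s * x)" s x \<omega>] by (simp add: power_mult_distrib distrib_left)
    fix H :: "real \<times> real \<Rightarrow> ennreal" assume [measurable]: "H \<in> borel_measurable (borel \<Otimes>\<^sub>M borel)"
    have "(\<integral>\<^sup>+\<omega>. (\<integral>\<^sup>+x. H (x, \<omega> - s * x) \<partial>lborel) \<partial>lborel) = (\<integral>\<^sup>+x. (\<integral>\<^sup>+\<omega>. H (x, \<omega> - s * x) \<partial>lborel) \<partial>lborel)"
      by (rule lborel_pair.Fubini') measurable
    also have "\<dots> = (\<integral>\<^sup>+x. (\<integral>\<^sup>+\<omega>. H (x, \<omega>) \<partial>lborel) \<partial>lborel)"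
    proof (rule nn_integral_cong)
      fix x
      show "(\<integral>\<^sup>+\<omega>. H (x, \<omega> - s * x) \<partial>lborel) = (\<integral>\<^sup>+\<omega>. H (x, \<omega>) \<partial>lborel)"
        by (rule nn_integral_translate(1)) measurable
    qed
    finally show "(\<integral>\<^sup>+\<omega>. (\<integral>\<^sup>+x. H (x, \<omega> - s * x) \<partial>lborel) \<partial>lborel) = (\<integral>\<^sup>+\<omega>. (\<integral>\<^sup>+x. H (x, \<omega>) \<partial>lborel) \<partial>lborel)"
      by (simp add: nn_integral_swap)
  qed (use fin[OF h'] in measurable)
qed

lemma in_modulation_space_modulation:
  assumes r: "1 \<le> r" and T: "in_modulation_space r l T"
  shows "in_modulation_space r l (dist_modulation s T)"
  unfolding in_modulation_space_def
proof (intro conjI ballI)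
  note fin = in_modulation_spaceD(2)[OF T] and T = in_modulation_spaceD(1)[OF T]
  show "dist_modulation s T \<in> tempered" using T by (rule tempered_dist_modulation)
  fix h assume h: "h \<in> schwartz"
  show "modulation_norm r l (stft h (dist_modulation s T)) < \<infinity>"
  proof (rule modulation_norm_transfer[OF r borel_measurable_stft[OF T h], where u = "\<lambda>x \<omega>. x" and v = "\<lambda>x \<omega>. \<omega> - s" and D = "2 + 2 * s\<^sup>2"])
    show "norm (stft h (dist_modulation s T) x \<omega>) = norm (stft h T x (\<omega> - s))" for x \<omega>
      by (simp add: stft_dist_modulation[OF h])
    show "1 + x\<^sup>2 + \<omega>\<^sup>2 \<le> (1 + x\<^sup>2 + (\<omega> - s)\<^sup>2) * (2 + 2 * s\<^sup>2)" for x \<omega>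
      using shear_square_le[of s s x "\<omega> - s"] by (simp add: distrib_left)
    show "1 + x\<^sup>2 + (\<omega> - s)\<^sup>2 \<le> (1 + x\<^sup>2 + \<omega>\<^sup>2) * (2 + 2 * s\<^sup>2)" for x \<omega>
      using shear_square_le[of "- s" s x \<omega>] by (simp add: distrib_left)
    fix H :: "real \<times> real \<Rightarrow> ennreal" assume [measurable]: "H \<in> borel_measurable (borel \<Otimes>\<^sub>M borel)"
    show "(\<integral>\<^sup>+\<omega>. (\<integral>\<^sup>+x. H (x, \<omega> - s) \<partial>lborel) \<partial>lborel) = (\<integral>\<^sup>+\<omega>. (\<integral>\<^sup>+x. H (x, \<omega>) \<partial>lborel) \<partial>lborel)"
      by (rule nn_integral_translate(1)) measurable
  qed (use fin[OF h] in measurable)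
qed

text \<open>Time is scaled by \<open>1 / s\<close> and frequency by \<open>s\<close>, so the two
  Jacobians cancel.\<close>

lemma in_modulation_space_dilation:
  assumes r: "1 \<le> r" and s: "s \<noteq> 0" and T: "in_modulation_space r l T"
  shows "in_modulation_space r l (dist_dilation s T)"
  unfolding in_modulation_space_def
proof (intro conjI ballI)
  note fin = in_modulation_spaceD(2)[OF T] and T = in_modulation_spaceD(1)[OF T]
  show "dist_dilation s T \<in> tempered" using T s by (rule tempered_dist_dilation)
  fix h assume h: "h \<in> schwartz"
  then have h': "dilation (1 / s) h \<in> schwartz" using s by (intro schwartz_dilation) auto
  \<comment> \<open>Dominates 1, \<open>s^2\<close> and \<open>1 / s^2\<close> at once, as both
    scalings occur in both directions of the comparison.\<close>
  let ?D = "1 + s\<^sup>2 + 1 / s\<^sup>2"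
  have D: "1 \<le> ?D" "s\<^sup>2 \<le> ?D" "1 / s\<^sup>2 \<le> ?D" by (simp_all add: add_nonneg_nonneg add_increasing)
  show "modulation_norm r l (stft h (dist_dilation s T)) < \<infinity>"
  proof (rule modulation_norm_transfer[OF r borel_measurable_stft[OF T h'], where u = "\<lambda>x \<omega>. x / s" and v = "\<lambda>x \<omega>. s * \<omega>" and D = ?D])
    show "norm (stft h (dist_dilation s T) x \<omega>) = norm (stft (dilation (1 / s) h) T (x / s) (s * \<omega>))" for x \<omega>
      by (simp add: stft_dist_dilation[OF h s])
    fix x \<omega> :: real
    have "(x / s)\<^sup>2 * s\<^sup>2 \<le> (x / s)\<^sup>2 * ?D" "(s * \<omega>)\<^sup>2 * (1 / s\<^sup>2) \<le> (s * \<omega>)\<^sup>2 * ?D"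
      by (intro mult_left_mono D zero_le_power2)+
    moreover have "(x / s)\<^sup>2 * s\<^sup>2 = x\<^sup>2" "(s * \<omega>)\<^sup>2 * (1 / s\<^sup>2) = \<omega>\<^sup>2"
      using s by (simp_all add: power_divide power_mult_distrib)
    ultimately have "1 + x\<^sup>2 + \<omega>\<^sup>2 \<le> ?D + (x / s)\<^sup>2 * ?D + (s * \<omega>)\<^sup>2 * ?D" using D(1) by linarith
    also have "\<dots> = (1 + (x / s)\<^sup>2 + (s * \<omega>)\<^sup>2) * ?D" by (simp only: distrib_right mult_1)
    finally show "1 + x\<^sup>2 + \<omega>\<^sup>2 \<le> (1 + (x / s)\<^sup>2 + (s * \<omega>)\<^sup>2) * ?D" .
    have "x\<^sup>2 * (1 / s\<^sup>2) \<le> x\<^sup>2 * ?D" "\<omega>\<^sup>2 * s\<^sup>2 \<le> \<omega>\<^sup>2 * ?D"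
      by (intro mult_left_mono D zero_le_power2)+
    moreover have "(x / s)\<^sup>2 = x\<^sup>2 * (1 / s\<^sup>2)" "(s * \<omega>)\<^sup>2 = \<omega>\<^sup>2 * s\<^sup>2"
      by (simp_all add: power_divide power_mult_distrib)
    ultimately have "1 + (x / s)\<^sup>2 + (s * \<omega>)\<^sup>2 \<le> ?D + x\<^sup>2 * ?D + \<omega>\<^sup>2 * ?D" using D(1) by linarith
    also have "\<dots> = (1 + x\<^sup>2 + \<omega>\<^sup>2) * ?D" by (simp only: distrib_right mult_1)
    finally show "1 + (x / s)\<^sup>2 + (s * \<omega>)\<^sup>2 \<le> (1 + x\<^sup>2 + \<omega>\<^sup>2) * ?D" .
  next
    fix H :: "real \<times> real \<Rightarrow> ennreal" assume [measurable]: "H \<in> borel_measurable (borel \<Otimes>\<^sub>M borel)"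
    have 1: "(\<integral>\<^sup>+x. H (x / s, s * \<omega>) \<partial>lborel) = ennreal \<bar>s\<bar> * (\<integral>\<^sup>+x. H (x, s * \<omega>) \<partial>lborel)" for \<omega>
    proof -
      have "(\<lambda>x. H (x / s, s * \<omega>)) \<in> borel_measurable borel" by measurable
      from nn_integral_real_affine[OF this s, of 0] show ?thesis using s by simp
    qed
    have "(\<lambda>\<omega>. \<integral>\<^sup>+x. H (x, \<omega>) \<partial>lborel) \<in> borel_measurable borel" by measurable
    from nn_integral_real_affine[OF this s, of 0]
    have 2: "(\<integral>\<^sup>+\<omega>. (\<integral>\<^sup>+x. H (x, \<omega>) \<partial>lborel) \<partial>lborel) = ennreal \<bar>s\<bar> * (\<integral>\<^sup>+\<omega>. (\<integral>\<^sup>+x. H (x, s * \<omega>) \<partial>lborel) \<partial>lborel)"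
      by simp
    show "(\<integral>\<^sup>+\<omega>. (\<integral>\<^sup>+x. H (x / s, s * \<omega>) \<partial>lborel) \<partial>lborel) = (\<integral>\<^sup>+\<omega>. (\<integral>\<^sup>+x. H (x, \<omega>) \<partial>lborel) \<partial>lborel)"
      unfolding 1 2 by (rule nn_integral_cmult) measurable
  qed (use fin[OF h'] in measurable)
qed

text \<open>A quarter turn preserves the weight exactly, hence \<open>D = 1\<close>; its invariance
  of measure is a reflection and an exchange of integrals.\<close>

lemma in_modulation_space_fourier:
  assumes r: "1 \<le> r" and T: "in_modulation_space r l T"
  shows "in_modulation_space r l (dist_fourier T)"
  unfolding in_modulation_space_def
proof (intro conjI ballI)
  note fin = in_modulation_spaceD(2)[OF T] and T = in_modulation_spaceD(1)[OF T]
  show "dist_fourier T \<in> tempered" using T by (rule tempered_dist_fourier)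
  fix h assume h: "h \<in> schwartz"
  let ?h = "\<lambda>t. cnj (fourier (\<lambda>t. cnj (h t)) t)"
  have h': "?h \<in> schwartz" using h by (intro schwartz_cnj schwartz_fourier)
  show "modulation_norm r l (stft h (dist_fourier T)) < \<infinity>"
  proof (rule modulation_norm_transfer[OF r borel_measurable_stft[OF T h'], where u = "\<lambda>x \<omega>. - \<omega>" and v = "\<lambda>x \<omega>. x" and D = 1])
    show "norm (stft h (dist_fourier T) x \<omega>) = norm (stft ?h T (- \<omega>) x)" for x \<omega>
      by (simp add: stft_dist_fourier[OF T h] norm_mult)
    fix H :: "real \<times> real \<Rightarrow> ennreal" assume [measurable]: "H \<in> borel_measurable (borel \<Otimes>\<^sub>M borel)"
    have "(\<lambda>\<omega>. \<integral>\<^sup>+x. H (\<omega>, x) \<partial>lborel) \<in> borel_measurable borel" by measurable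
    from nn_integral_translate(2)[OF this, of 0]
    show "(\<integral>\<^sup>+\<omega>. (\<integral>\<^sup>+x. H (- \<omega>, x) \<partial>lborel) \<partial>lborel) = (\<integral>\<^sup>+\<omega>. (\<integral>\<^sup>+x. H (x, \<omega>) \<partial>lborel) \<partial>lborel)"
      by (simp add: nn_integral_swap)
  qed (use fin[OF h'] in \<open>simp_all\<close>)
qed

theorem corollary4p9:
  fixes a b c d p q r l :: real
    and g :: "real \<Rightarrow> complex"
    and f :: "(real \<Rightarrow> complex) \<Rightarrow> complex"
  assumes "a * d - b * c = 1" and "b \<noteq> 0"
    and "1 \<le> r"
    and "g \<in> schwartz" and "g \<noteq> (\<lambda>t. 0)"
    and "f \<in> modulation_space r (poly_weight l) g"
  shows "saft a b c d p q f \<in> modulation_space r (poly_weight l) g"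
proof -
  \<comment> \<open>The single change of window: from \<open>g\<close> to every Schwartz window.
    Since \<open>g\<close> is one of them, the way back is a specialisation.\<close>
  have "in_modulation_space r l f"
    using assms modulation_norm_change_window[OF assms(3) _ assms(4,5), of f _ l]
    unfolding in_modulation_space_def modulation_space_iff by blast
  then have "in_modulation_space r l (saft a b c d p q f)"
    unfolding saft_def using assms(2,3)
    by (intro in_modulation_space_chirp in_modulation_space_modulation in_modulation_space_dilation
        in_modulation_space_fourier)
  then show ?thesis
    using assms(4) unfolding in_modulation_space_def modulation_space_iff by blast
qed

end
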